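(* Let $G$ be a solvable group with a purely positive length function, and suppose $G$ has finite virtual cohomological dimension. Then there exists a finite-index subgroup $K<G$ such that either (1) $K$ is abelian, or (2) there exist abelian groups $A,B$ and a short exact sequence $1\to A\to K\to B\to 1$ such that $A\otimes_{\mathbb{Z}}\mathbb{Q}$ is finite-dimensional, the action of $B$ on $A\otimes_{\mathbb{Z}}\mathbb{Q}$ induced by conjugation is effective, and every non-identity element of $B$ acts by a non-unipotent element of $\mathrm{Aut}(A\otimes_{\mathbb{Z}}\mathbb{Q})\hookrightarrow\mathrm{GL}_{n}(\mathbb{C})$. In particular, $G$ is either virtually abelian or virtually a non-nilpotent abelian-by-abelian group.
   Context: A length function on a group $G$ is a function $l:G\to[0,\infty)$ such that $l(g^{n})=|n|\,l(g)$ for all $g\in G,n\in\mathbb{Z}$; $l(hgh^{-1})=l(g)$ for all $g,h$; and $l(ab)\leq l(a)+l(b)$ whenever $a,b$ commute. It is purely positive if $l(g)>0$ for every element of infinite order. Virtual cohomological dimension is the cohomological dimension of a torsion-free finite-index subgroup. A matrix is unipotent if all its eigenvalues equal $1$. *)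

theory Defs
  imports "HOL-Algebra.Solvable_Groups" "HOL-Algebra.Coset" "HOL-Library.Function_Algebras"
          "Jordan_Normal_Form.Char_Poly"
begin

definition length_function :: "('g, 'b) monoid_scheme \<Rightarrow> ('g \<Rightarrow> real) \<Rightarrow> bool" where
  "length_function G l \<longleftrightarrow>
     (\<forall>g\<in>carrier G. 0 \<le> l g) \<and>
     (\<forall>g\<in>carrier G. \<forall>n::int. l (g [^]\<^bsub>G\<^esub> n) = \<bar>real_of_int n\<bar> * l g) \<and>
     (\<forall>g\<in>carrier G. \<forall>h\<in>carrier G. l (h \<otimes>\<^bsub>G\<^esub> g \<otimes>\<^bsub>G\<^esub> inv\<^bsub>G\<^esub> h) = l g) \<and>
     (\<forall>a\<in>carrier G. \<forall>b\<in>carrier G. a \<otimes>\<^bsub>G\<^esub> b = b \<otimes>\<^bsub>G\<^esub> a \<longrightarrow> l (a \<otimes>\<^bsub>G\<^esub> b) \<le> l a + l b)"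

definition infinite_order :: "('g, 'b) monoid_scheme \<Rightarrow> 'g \<Rightarrow> bool" where
  "infinite_order G g \<longleftrightarrow> (\<forall>m::nat. m > 0 \<longrightarrow> g [^]\<^bsub>G\<^esub> m \<noteq> \<one>\<^bsub>G\<^esub>)"

definition purely_positive :: "('g, 'b) monoid_scheme \<Rightarrow> ('g \<Rightarrow> real) \<Rightarrow> bool" where
  "purely_positive G l \<longleftrightarrow> (\<forall>g\<in>carrier G. infinite_order G g \<longrightarrow> l g > 0)"

definition module_on :: "('g, 'b) monoid_scheme \<Rightarrow> 'm::ab_group_add set \<Rightarrow> ('g \<Rightarrow> 'm \<Rightarrow> 'm) \<Rightarrow> bool" where
  "module_on H M act \<longleftrightarrow>
     0 \<in> M \<and> (\<forall>x\<in>M. \<forall>y\<in>M. x + y \<in> M) \<and> (\<forall>x\<in>M. - x \<in> M) \<and>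
     (\<forall>h\<in>carrier H. \<forall>x\<in>M. act h x \<in> M) \<and>
     (\<forall>h\<in>carrier H. \<forall>x\<in>M. \<forall>y\<in>M. act h (x + y) = act h x + act h y) \<and>
     (\<forall>x\<in>M. act \<one>\<^bsub>H\<^esub> x = x) \<and>
     (\<forall>g\<in>carrier H. \<forall>h\<in>carrier H. \<forall>x\<in>M. act (g \<otimes>\<^bsub>H\<^esub> h) x = act g (act h x))"

definition hom_on :: "('g, 'b) monoid_scheme \<Rightarrow> 'm::ab_group_add set \<Rightarrow> ('g \<Rightarrow> 'm \<Rightarrow> 'm)
     \<Rightarrow> 'n::ab_group_add set \<Rightarrow> ('g \<Rightarrow> 'n \<Rightarrow> 'n) \<Rightarrow> ('m \<Rightarrow> 'n) \<Rightarrow> bool" where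
  "hom_on H M a N b f \<longleftrightarrow>
     (\<forall>x\<in>M. f x \<in> N) \<and> (\<forall>x\<in>M. \<forall>y\<in>M. f (x + y) = f x + f y) \<and>
     (\<forall>h\<in>carrier H. \<forall>x\<in>M. f (a h x) = b h (f x))"

text \<open>The free ZH-module with basis indexed by the type 'i: finitely supported
  functions 'i => H => int, with H acting by left translation.\<close>

definition free_carrier :: "('g, 'b) monoid_scheme \<Rightarrow> ('i \<Rightarrow> 'g \<Rightarrow> int) set" where
  "free_carrier H = {f. finite {(i, x). f i x \<noteq> 0} \<and> (\<forall>i x. f i x \<noteq> 0 \<longrightarrow> x \<in> carrier H)}"

definition free_act :: "('g, 'b) monoid_scheme \<Rightarrow> 'g \<Rightarrow> ('i \<Rightarrow> 'g \<Rightarrow> int) \<Rightarrow> ('i \<Rightarrow> 'g \<Rightarrow> int)" where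
  "free_act H h f = (\<lambda>i x. if x \<in> carrier H then f i (inv\<^bsub>H\<^esub> h \<otimes>\<^bsub>H\<^esub> x) else 0)"

text \<open>Projective = direct summand of a free module (free on the elements of the ambient type).\<close>

definition projective_on :: "('g, 'b) monoid_scheme \<Rightarrow> 'm::ab_group_add set \<Rightarrow> ('g \<Rightarrow> 'm \<Rightarrow> 'm) \<Rightarrow> bool" where
  "projective_on H P act \<longleftrightarrow> module_on H P act \<and>
     (\<exists>(s :: 'm \<Rightarrow> ('m \<Rightarrow> 'g \<Rightarrow> int)) r.
        hom_on H P act (free_carrier H) (free_act H) s \<and>
        hom_on H (free_carrier H) (free_act H) P act r \<and>
        (\<forall>x\<in>P. r (s x) = x))"

definition proj_resolution :: "('g, 'b) monoid_scheme \<Rightarrow> nat \<Rightarrow> (nat \<Rightarrow> 'm::ab_group_add set)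
     \<Rightarrow> (nat \<Rightarrow> 'g \<Rightarrow> 'm \<Rightarrow> 'm) \<Rightarrow> (nat \<Rightarrow> 'm \<Rightarrow> 'm) \<Rightarrow> ('m \<Rightarrow> int) \<Rightarrow> bool" where
  "proj_resolution H n P act d eps \<longleftrightarrow>
     (\<forall>k\<le>n. projective_on H (P k) (act k)) \<and>
     (\<forall>k\<in>{1..n}. hom_on H (P k) (act k) (P (k - 1)) (act (k - 1)) (d k)) \<and>
     hom_on H (P 0) (act 0) (UNIV :: int set) (\<lambda>_ z. z) eps \<and>
     eps ` P 0 = UNIV \<and>
     (\<forall>k\<in>{1..<n}. {x\<in>P k. d k x = 0} = d (k + 1) ` P (k + 1)) \<and>
     (n = 0 \<longrightarrow> inj_on eps (P 0)) \<and>
     (0 < n \<longrightarrow> {x\<in>P 0. eps x = 0} = d 1 ` P 1 \<and> inj_on (d n) (P n))"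

definition finite_cd :: "('g, 'b) monoid_scheme \<Rightarrow> 'm::ab_group_add itself \<Rightarrow> bool" where
  "finite_cd H _ \<longleftrightarrow>
     (\<exists>n (P :: nat \<Rightarrow> 'm set) act d eps. proj_resolution H n P act d eps)"

definition torsion_free :: "('g, 'b) monoid_scheme \<Rightarrow> bool" where
  "torsion_free G \<longleftrightarrow> (\<forall>g\<in>carrier G. g \<noteq> \<one>\<^bsub>G\<^esub> \<longrightarrow> infinite_order G g)"

definition finite_vcd :: "('g, 'b) monoid_scheme \<Rightarrow> 'm::ab_group_add itself \<Rightarrow> bool" where
  "finite_vcd G T \<longleftrightarrow>
     (\<exists>H. subgroup H G \<and> finite (rcosets\<^bsub>G\<^esub> H) \<and> torsion_free (G\<lparr>carrier := H\<rparr>) \<and>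
          finite_cd (G\<lparr>carrier := H\<rparr>) T)"

section \<open>A \<otimes> Q for an abelian subgroup A, via coordinates w.r.t. a Q-basis\<close>

definition lincomb :: "('g, 'b) monoid_scheme \<Rightarrow> 'g list \<Rightarrow> int list \<Rightarrow> 'g" where
  "lincomb G as cs = foldr (\<lambda>(a, c) x. (a [^]\<^bsub>G\<^esub> c) \<otimes>\<^bsub>G\<^esub> x) (zip as cs) \<one>\<^bsub>G\<^esub>"

text \<open>The images a_i \<otimes> 1 of the elements of as form a basis of A \<otimes> Q.\<close>

definition Q_basis :: "('g, 'b) monoid_scheme \<Rightarrow> 'g set \<Rightarrow> 'g list \<Rightarrow> bool" where
  "Q_basis G A as \<longleftrightarrow> set as \<subseteq> A \<and>
     (\<forall>cs. length cs = length as \<and> \<not> infinite_order G (lincomb G as cs) \<longrightarrow> (\<forall>c\<in>set cs. c = 0)) \<and>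
     (\<forall>a\<in>A. \<exists>m::nat. m > 0 \<and> (\<exists>cs. length cs = length as \<and> a [^]\<^bsub>G\<^esub> m = lincomb G as cs))"

text \<open>M is the matrix of the automorphism of A \<otimes> Q induced by conjugation by k,
  with respect to the basis as.\<close>

definition conj_matrix :: "('g, 'b) monoid_scheme \<Rightarrow> 'g list \<Rightarrow> 'g \<Rightarrow> rat mat \<Rightarrow> bool" where
  "conj_matrix G as k M \<longleftrightarrow> M \<in> carrier_mat (length as) (length as) \<and>
     (\<forall>j < length as. \<exists>m::nat. m > 0 \<and> (\<exists>cs. length cs = length as \<and>
        (k \<otimes>\<^bsub>G\<^esub> (as ! j) \<otimes>\<^bsub>G\<^esub> inv\<^bsub>G\<^esub> k) [^]\<^bsub>G\<^esub> m = lincomb G as cs \<and>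
        (\<forall>i < length as. M $$ (i, j) = of_int (cs ! i) / of_nat m)))"

definition unipotent :: "complex mat \<Rightarrow> bool" where
  "unipotent M \<longleftrightarrow> (\<forall>e. eigenvalue M e \<longrightarrow> e = 1)"

end

theory Submission
  imports Defs "Jordan_Normal_Form.Schur_Decomposition"
begin

text \<open>
  Pass to a torsion-free subgroup of finite index, again called \<open>G\<close>, with a projective resolution of
  length \<open>n\<close>. For commuting independent elements \<open>t\<^sub>1, \<dots>, t\<^sub>m\<close> the operators \<open>t\<^sub>i - 1\<close> form a regular
  sequence on every projective module; dividing the resolution by them one after the other yields
  \<open>m \<le> n\<close>. So abelian subgroups have finite rank.

  Let \<open>A\<close> be a maximal abelian normal subgroup. A commutator \<open>z = [x, y]\<close> that commutes with \<open>x\<close> and \<open>y\<close>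
  satisfies \<open>l(z\<^sup>n) \<le> 2 l(y)\<close> for all \<open>n\<close> and is therefore trivial. Consequently \<open>A\<close> is its own
  centralizer, and only the elements of \<open>A\<close> act unipotently on \<open>A \<otimes> \<rat>\<close>. Thus \<open>G/A\<close> is a solvable linear
  group without nontrivial unipotent elements, and such a group is virtually abelian: its centralizers
  satisfy the descending chain condition, and a commuting set of conjugates of one element is finite
  because two of its members with the same eigenvalues on all layers of an invariant flag differ by a
  unipotent.
\<close>

section \<open>Regular sequences and the length of a resolution\<close>

text \<open>The rank bound is the Koszul form of cd(Z^m) = m. It is proved directly on the given
  resolution, so that neither homology groups nor tensor products nor the restriction of modules to
  a subgroup have to be formed. Finite rank is what is needed, not finite generation: A may look
  like Z[1/p]. Hence elements of A receive rational coordinates by clearing a denominator, and only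
  then does conjugation become a matrix. The commutator trick makes every subgroup of nilpotency
  class two abelian. It serves twice: for a layer of the derived series inside the centralizer of A,
  and for an element h acting unipotently on A, where the last nontrivial iterate of a -> [h, a]
  would be a commutator that commutes with both of its entries. For the linear group, simultaneous
  triangularization of a finite-index subgroup is replaced by a count: conjugates of one matrix have
  the same eigenvalues, so a commuting family of them admits only finitely many eigenvalue patterns.
  The absence of unipotents makes the pattern determine the element.\<close>

primrec aug :: "(nat \<Rightarrow> 'm \<Rightarrow> 'm) \<Rightarrow> 'm::ab_group_add set \<Rightarrow> nat \<Rightarrow> 'm set" where
  "aug x P 0 = {0}"
| "aug x P (Suc j) = {a + x j w | a w. a \<in> aug x P j \<and> w \<in> P}"

text \<open>Modules are subsets \<open>P\<close> of a type, so the operators are controlled on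
  \<open>P\<close> only. They are indexed by all naturals; when finitely many group elements are
  given, the surplus indices get zero operators.\<close>

definition comm_endos :: "(nat \<Rightarrow> 'm \<Rightarrow> 'm) \<Rightarrow> 'm::ab_group_add set \<Rightarrow> bool" where
  "comm_endos x P \<longleftrightarrow> 0 \<in> P \<and> (\<forall>a\<in>P. \<forall>b\<in>P. a + b \<in> P) \<and> (\<forall>a\<in>P. - a \<in> P) \<and>
     (\<forall>i. \<forall>a\<in>P. x i a \<in> P) \<and> (\<forall>i. \<forall>a\<in>P. \<forall>b\<in>P. x i (a + b) = x i a + x i b) \<and>
     (\<forall>i j. \<forall>a\<in>P. x i (x j a) = x j (x i a))"

text \<open>\<open>aug x P j\<close> is x_0 P + ... + x_{j-1} P, so x_j is required to be injective
  on P modulo its predecessors. Nonvanishing of the quotients is not built in; the class of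
  \<open>p0\<close> in \<open>regular_resolution_length\<close> takes care of it.\<close>

definition regular_seq :: "nat \<Rightarrow> (nat \<Rightarrow> 'm \<Rightarrow> 'm) \<Rightarrow> 'm::ab_group_add set \<Rightarrow> bool" where
  "regular_seq m x P \<longleftrightarrow> (\<forall>j<m. \<forall>w\<in>P. x j w \<in> aug x P j \<longrightarrow> w \<in> aug x P j)"

lemma additive_on_zero:
  fixes f :: "'m::ab_group_add \<Rightarrow> 'n::ab_group_add"
  assumes "0 \<in> P" "\<And>a b. a \<in> P \<Longrightarrow> b \<in> P \<Longrightarrow> f (a + b) = f a + f b"
  shows "f 0 = 0"
  using assms(2)[OF assms(1) assms(1)] by simp

lemma additive_on_minus:
  fixes f :: "'m::ab_group_add \<Rightarrow> 'n::ab_group_add"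
  assumes "0 \<in> P" "\<And>a. a \<in> P \<Longrightarrow> - a \<in> P" "\<And>a b. a \<in> P \<Longrightarrow> b \<in> P \<Longrightarrow> f (a + b) = f a + f b" "a \<in> P"
  shows "f (- a) = - f a"
proof -
  have "f (- a + a) = f (- a) + f a" using assms by blast
  then show ?thesis using additive_on_zero[of P f] assms by (simp add: add_eq_0_iff2)
qed

context
  fixes x :: "nat \<Rightarrow> 'm \<Rightarrow> 'm::ab_group_add" and P
  assumes ce: "comm_endos x P"
begin

lemma ce_zero: "0 \<in> P" and ce_add: "a \<in> P \<Longrightarrow> b \<in> P \<Longrightarrow> a + b \<in> P"
  and ce_neg: "a \<in> P \<Longrightarrow> - a \<in> P" and ce_cl: "a \<in> P \<Longrightarrow> x i a \<in> P"
  and ce_x_add: "a \<in> P \<Longrightarrow> b \<in> P \<Longrightarrow> x i (a + b) = x i a + x i b"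
  and ce_comm: "a \<in> P \<Longrightarrow> x i (x j a) = x j (x i a)"
  using ce unfolding comm_endos_def by blast+

lemma ce_diff: "a \<in> P \<Longrightarrow> b \<in> P \<Longrightarrow> a - b \<in> P"
  using ce_add ce_neg by (metis diff_conv_add_uminus)

lemma ce_x_zero: "x i 0 = 0"
  by (rule additive_on_zero[of P]) (auto intro: ce_zero ce_x_add)

lemma ce_x_neg: "a \<in> P \<Longrightarrow> x i (- a) = - x i a"
  by (rule additive_on_minus[of P]) (auto intro: ce_zero ce_x_add ce_neg)

lemma ce_x_diff: "a \<in> P \<Longrightarrow> b \<in> P \<Longrightarrow> x i (a - b) = x i a - x i b"
  using ce_x_add[of a "- b"] ce_neg ce_x_neg by simp

lemma aug_sub: "a \<in> aug x P j \<Longrightarrow> a \<in> P"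
  by (induction j arbitrary: a) (auto intro: ce_zero ce_add ce_cl)

lemma aug_zero: "0 \<in> aug x P j"
proof (induction j)
  case (Suc j)
  then have "0 + x j 0 \<in> aug x P (Suc j)" using ce_zero by (simp only: aug.simps) blast
  then show ?case using ce_x_zero by simp
qed simp

lemma aug_mem_Suc: "a \<in> aug x P j \<Longrightarrow> w \<in> P \<Longrightarrow> a + x j w \<in> aug x P (Suc j)"
  by (simp only: aug.simps) blast

lemma aug_mono_Suc: "a \<in> aug x P j \<Longrightarrow> a \<in> aug x P (Suc j)"
  using aug_mem_Suc[of a j 0] ce_zero ce_x_zero by simp

lemma aug_add: "a \<in> aug x P j \<Longrightarrow> b \<in> aug x P j \<Longrightarrow> a + b \<in> aug x P j"
proof (induction j arbitrary: a b)
  case (Suc j)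
  then obtain a' v b' w where "a = a' + x j v" "b = b' + x j w" "a' \<in> aug x P j" "b' \<in> aug x P j"
    "v \<in> P" "w \<in> P" by auto
  then have "a + b = (a' + b') + x j (v + w)" "a' + b' \<in> aug x P j" "v + w \<in> P"
    using Suc.IH by (auto simp: ce_x_add ce_add algebra_simps)
  then show ?case using aug_mem_Suc by metis
qed simp

lemma aug_neg: "a \<in> aug x P j \<Longrightarrow> - a \<in> aug x P j"
proof (induction j arbitrary: a)
  case (Suc j)
  then obtain a' v where "a = a' + x j v" "a' \<in> aug x P j" "v \<in> P" by auto
  then have "- a = (- a') + x j (- v)" "- a' \<in> aug x P j" "- v \<in> P"
    using Suc.IH by (auto simp: ce_x_neg ce_neg)
  then show ?case using aug_mem_Suc by metis
qed simp

lemma aug_diff: "a \<in> aug x P j \<Longrightarrow> b \<in> aug x P j \<Longrightarrow> a - b \<in> aug x P j"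
  using aug_add aug_neg by (metis diff_conv_add_uminus)

lemma aug_x: "a \<in> aug x P j \<Longrightarrow> x i a \<in> aug x P j"
proof (induction j arbitrary: a)
  case (Suc j)
  then obtain a' v where *: "a = a' + x j v" "a' \<in> aug x P j" "v \<in> P" by auto
  then have "x i a = x i a' + x j (x i v)"
    using aug_sub[OF *(2)] by (simp add: ce_x_add ce_cl ce_comm[of v i j])
  then show ?case using aug_mem_Suc[OF Suc.IH[OF *(2)] ce_cl[OF *(3)]] by metis
qed (simp add: ce_x_zero)

lemma aug_gen: "i < j \<Longrightarrow> w \<in> P \<Longrightarrow> x i w \<in> aug x P j"
proof (induction j)
  case (Suc j)
  show ?case
  proof (cases "i = j")
    case True
    then show ?thesis using aug_mem_Suc[OF aug_zero Suc.prems(2), of j] by simp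
  next
    case False
    then show ?thesis using Suc aug_mono_Suc by simp
  qed
qed simp

end

lemma aug_map:
  assumes "comm_endos x P" "comm_endos y Q"
    "\<And>a. a \<in> P \<Longrightarrow> f a \<in> Q" "\<And>a b. a \<in> P \<Longrightarrow> b \<in> P \<Longrightarrow> f (a + b) = f a + f b"
    "\<And>i a. a \<in> P \<Longrightarrow> f (x i a) = y i (f a)" "a \<in> aug x P j"
  shows "f a \<in> aug y Q j"
  using assms(6)
proof (induction j arbitrary: a)
  case 0
  then show ?case using additive_on_zero[of P f] assms(4) ce_zero[OF assms(1)] by simp
next
  case (Suc j)
  then obtain a' v where *: "a = a' + x j v" "a' \<in> aug x P j" "v \<in> P" by auto
  then have "f a = f a' + y j (f v)" using assms aug_sub[OF assms(1)] ce_cl[OF assms(1)] by metis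
  then show ?case using aug_mem_Suc[OF assms(2) Suc.IH[OF *(2)]] assms(3) * by metis
qed

text \<open>The section s carries a relation from P to Q, regularity is applied there, and r brings
  the result back. This passes from free modules to their direct summands.\<close>

lemma regular_seq_retract:
  assumes "comm_endos x P" "comm_endos y Q"
    and s: "\<And>a. a \<in> P \<Longrightarrow> s a \<in> Q" "\<And>a b. a \<in> P \<Longrightarrow> b \<in> P \<Longrightarrow> s (a + b) = s a + s b"
      "\<And>i a. a \<in> P \<Longrightarrow> s (x i a) = y i (s a)"
    and r: "\<And>a. a \<in> Q \<Longrightarrow> r a \<in> P" "\<And>a b. a \<in> Q \<Longrightarrow> b \<in> Q \<Longrightarrow> r (a + b) = r a + r b"
      "\<And>i a. a \<in> Q \<Longrightarrow> r (y i a) = x i (r a)"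
    and rs: "\<And>a. a \<in> P \<Longrightarrow> r (s a) = a"
    and reg: "regular_seq m y Q"
  shows "regular_seq m x P"
  unfolding regular_seq_def
proof (intro allI impI ballI)
  fix j w assume *: "j < m" "w \<in> P" "x j w \<in> aug x P j"
  have "s (x j w) \<in> aug y Q j"
    by (rule aug_map[where f = s, OF assms(1,2) s]) (use * in auto)
  then have "y j (s w) \<in> aug y Q j" using s * by simp
  then have "s w \<in> aug y Q j" using reg * s unfolding regular_seq_def by blast
  then have "r (s w) \<in> aug x P j"
    by (rule aug_map[where f = r, OF assms(2,1) r, rotated -1])
  then show "w \<in> aug x P j" using rs * by simp
qed

text \<open>Each step of the induction divides the resolution by one more of the commuting operators,
  which shortens it by one while an invariant class survives in its cokernel.\<close>

lemma regular_resolution_length: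
  fixes P :: "nat \<Rightarrow> 'm::ab_group_add set"
  assumes ce: "\<And>k. k \<le> n \<Longrightarrow> comm_endos (x k) (P k)"
    and reg: "\<And>k. k \<le> n \<Longrightarrow> regular_seq m (x k) (P k)"
    and dP: "\<And>k a. k < n \<Longrightarrow> a \<in> P (Suc k) \<Longrightarrow> d (Suc k) a \<in> P k"
    and d_add: "\<And>k a b. k < n \<Longrightarrow> a \<in> P (Suc k) \<Longrightarrow> b \<in> P (Suc k) \<Longrightarrow>
                  d (Suc k) (a + b) = d (Suc k) a + d (Suc k) b"
    and d_x: "\<And>k i a. k < n \<Longrightarrow> a \<in> P (Suc k) \<Longrightarrow> d (Suc k) (x (Suc k) i a) = x k i (d (Suc k) a)"
    and D_def: "\<And>k. D k = (if k < n then d (Suc k) ` P (Suc k) else {0})"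
    and exact: "\<And>k. k < n \<Longrightarrow> {a \<in> P (Suc k). d (Suc k) a = 0} = D (Suc k)"
    and p0: "p0 \<in> P 0" "p0 \<notin> D 0" "\<And>i. x 0 i p0 \<in> D 0"
  shows "m \<le> n"
proof (rule ccontr)
  assume "\<not> m \<le> n"
  then have nm: "n < m" by simp
  \<comment> \<open>P_k modulo \<open>I j k\<close> is the degree-k module of the resolution divided
    by x_0, ..., x_{j-1}.\<close>
  define I where "I j k = aug (x k) (P k) j" for j k
  have DP: "D k \<subseteq> P k" if "k \<le> n" for k
    using dP that ce_zero[OF ce] by (auto simp: D_def)
  have d0: "d (Suc k) 0 = 0" if "k < n" for k
    using additive_on_zero[of "P (Suc k)" "d (Suc k)"] d_add ce_zero[OF ce] that by simp
  have dneg: "d (Suc k) (- a) = - d (Suc k) a" if "k < n" "a \<in> P (Suc k)" for k a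
    by (rule additive_on_minus[of "P (Suc k)"]) (use d_add ce_zero[OF ce] ce_neg[OF ce] that in auto)
  have ddiff: "d (Suc k) (a - b) = d (Suc k) a - d (Suc k) b"
    if "k < n" "a \<in> P (Suc k)" "b \<in> P (Suc k)" for k a b
    using d_add[of k a "- b"] dneg[of k b] ce_neg[OF ce] that by simp
  have dd: "d (Suc k) a = 0" if "k < n" "a \<in> D (Suc k)" for k a
    using exact that by blast
  have dI: "d (Suc k) a \<in> I j k" if "k < n" "a \<in> I j (Suc k)" for k j a
    unfolding I_def
    by (rule aug_map[where f = "d (Suc k)", OF ce ce, of "Suc k" k])
      (use that dP d_add d_x in \<open>auto simp: I_def\<close>)
  have IP: "I j k \<subseteq> P k" if "k \<le> n" for j k
    using that aug_sub[OF ce] unfolding I_def by blast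
  \<comment> \<open>At stage j the divided complex is exact in the degrees above j, and the cokernel
    of d in degree j keeps a nonzero class p annihilated by every x_i. Passing to the next stage
    imitates the long exact sequence of multiplication by x_j: a class in degree j killed by x_j
    reappears as homology in degree j + 1.\<close>
  have main: "j \<le> n \<Longrightarrow>
     (\<forall>k y. j \<le> k \<and> k < n \<and> y \<in> P (Suc k) \<and> d (Suc k) y \<in> I j k \<longrightarrow>
           (\<exists>b\<in>D (Suc k). \<exists>c\<in>I j (Suc k). y = b + c)) \<and>
     (\<exists>p\<in>P j. \<not> (\<exists>b\<in>D j. \<exists>c\<in>I j j. p = b + c) \<and> (\<forall>i. \<exists>b\<in>D j. \<exists>c\<in>I j j. x j i p = b + c))" for j
  proof (induction j)
    case 0
    have "\<exists>b\<in>D (Suc k). \<exists>c\<in>I 0 (Suc k). y = b + c" if "k < n" "y \<in> P (Suc k)" "d (Suc k) y \<in> I 0 k" for k y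
      using that exact[of k] by (auto simp: I_def)
    then show ?case using p0 by (auto simp: I_def)
  next
    case (Suc j)
    then have jn: "j < n" by simp
    have jm: "j < m" using jn nm by simp
    from Suc have Ea: "\<And>k y. j \<le> k \<Longrightarrow> k < n \<Longrightarrow> y \<in> P (Suc k) \<Longrightarrow> d (Suc k) y \<in> I j k \<Longrightarrow>
           (\<exists>b\<in>D (Suc k). \<exists>c\<in>I j (Suc k). y = b + c)" by auto
    from Suc obtain p where p: "p \<in> P j" "\<not> (\<exists>b\<in>D j. \<exists>c\<in>I j j. p = b + c)"
      "\<And>i. \<exists>b\<in>D j. \<exists>c\<in>I j j. x j i p = b + c" by auto
    have regj: "w \<in> I j k" if "k \<le> n" "w \<in> P k" "x k j w \<in> I j k" for k w
      using reg[OF that(1)] that jm unfolding regular_seq_def I_def by blast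
    have part1: "\<exists>b\<in>D (Suc k). \<exists>c\<in>I (Suc j) (Suc k). y = b + c"
      if H: "Suc j \<le> k" "k < n" "y \<in> P (Suc k)" "d (Suc k) y \<in> I (Suc j) k" for k y
    proof -
      from H(1) obtain k' where k': "k = Suc k'" "j \<le> k'" by (cases k) auto
      have cek: "comm_endos (x k) (P k)" "comm_endos (x (Suc k)) (P (Suc k))" using ce H by auto
      from H(4) obtain a w where aw: "d (Suc k) y = a + x k j w" "a \<in> I j k" "w \<in> P k"
        unfolding I_def by auto
      \<comment> \<open>Applying d once more removes the left side, so x_j (d w) lies in
        \<open>I j\<close>, and regularity one degree lower puts d w there too. Exactness at stage j
        then splits w.\<close>
      have "d (Suc k) y \<in> D k" using k' H by (auto simp: D_def)
      then have "d k (d (Suc k) y) = 0" using dd[of k'] k' H by simp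
      then have "d k a + x k' j (d k w) = 0"
        using aw d_add[of k' a "x k j w"] d_x[of k' w j] k' H IP[of k j] ce_cl[OF cek(1) aw(3)] by auto
      then have "x k' j (d k w) = - d k a" by (metis add_eq_0_iff)
      moreover have "d k a \<in> I j k'" using dI[of k' a j] k' H aw by simp
      moreover have "comm_endos (x k') (P k')" using ce k' H by simp
      ultimately have "x k' j (d k w) \<in> I j k'" unfolding I_def using aug_neg by metis
      moreover have "d k w \<in> P k'" using dP[of k' w] k' H aw by simp
      ultimately have "d k w \<in> I j k'" using regj[of k'] k' H by simp
      then obtain b c where bc: "w = b + c" "b \<in> D k" "c \<in> I j k"
        using Ea[of k' w] k' H aw by auto
      then obtain z where z: "z \<in> P (Suc k)" "b = d (Suc k) z" using H by (auto simp: D_def)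
      have bP: "b \<in> P k" "c \<in> P k" using bc IP[of k j] DP[of k] H by auto
      \<comment> \<open>Replacing y by y - x_j z, where d z = b, cancels x_j b. The remaining
        boundary a + x_j c lies in \<open>I j\<close>, where stage j applies.\<close>
      have "d (Suc k) (y - x (Suc k) j z) = d (Suc k) y - x k j b"
        using ddiff[of k y "x (Suc k) j z"] d_x[of k z j] H z ce_cl[OF cek(2) z(1)] by simp
      also have "\<dots> = a + x k j c" using aw bc ce_x_add[OF cek(1) bP] by simp
      also have "\<dots> \<in> I j k" using aw(2) bc(3) aug_add[OF cek(1)] aug_x[OF cek(1)] unfolding I_def by blast
      finally have "d (Suc k) (y - x (Suc k) j z) \<in> I j k" .
      then obtain b' c' where b': "y - x (Suc k) j z = b' + c'" "b' \<in> D (Suc k)" "c' \<in> I j (Suc k)"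
        using Ea[of k "y - x (Suc k) j z"] k' H ce_diff[OF cek(2) H(3) ce_cl[OF cek(2) z(1)]] by auto
      then have "y = b' + (c' + x (Suc k) j z)" by (simp add: algebra_simps)
      moreover have "c' + x (Suc k) j z \<in> I (Suc j) (Suc k)"
        using b' z aug_mem_Suc[OF cek(2)] unfolding I_def by blast
      ultimately show ?thesis using b' by blast
    qed
    have ce0: "comm_endos (x j) (P j)" "comm_endos (x (Suc j)) (P (Suc j))" using ce jn by auto
    \<comment> \<open>q is the image of p under the connecting map: its boundary is x_j p up to an
      element of \<open>I j\<close>.\<close>
    obtain b c where bc: "b \<in> D j" "c \<in> I j j" "x j j p = b + c" using p(3)[of j] by auto
    then obtain q where q: "q \<in> P (Suc j)" "b = d (Suc j) q" using jn by (auto simp: D_def)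
    have dq: "d (Suc j) q = x j j p - c" using bc q by simp
    have cP: "c \<in> P j" using bc IP[of j j] jn by auto
    \<comment> \<open>If q were trivial, p could be corrected by a boundary d r so that x_j sends it
      into \<open>I j\<close>; regularity then makes p itself trivial.\<close>
    have part2: False if H: "b' \<in> D (Suc j)" "c' \<in> I (Suc j) (Suc j)" "q = b' + c'" for b' c'
    proof -
      obtain a r where ar: "c' = a + x (Suc j) j r" "a \<in> I j (Suc j)" "r \<in> P (Suc j)"
        using H(2) unfolding I_def by auto
      have P: "b' \<in> P (Suc j)" "a \<in> P (Suc j)" "x (Suc j) j r \<in> P (Suc j)"
        using H(1) DP[of "Suc j"] ar IP[of "Suc j" j] jn ce_cl[OF ce0(2)] by auto
      have "d (Suc j) q = d (Suc j) b' + (d (Suc j) a + d (Suc j) (x (Suc j) j r))"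
        using H(3) ar(1) d_add[OF jn] P ce_add[OF ce0(2)] by simp
      then have "x j j p - x j j (d (Suc j) r) = c + d (Suc j) a"
        using dd[OF jn H(1)] d_x[OF jn ar(3), of j] dq by (simp add: algebra_simps)
      moreover have "d (Suc j) r \<in> P j" using dP[OF jn ar(3)] .
      ultimately have "x j j (p - d (Suc j) r) = c + d (Suc j) a" using ce_x_diff[OF ce0(1) p(1)] by simp
      moreover have "c + d (Suc j) a \<in> I j j"
        using bc(2) dI[OF jn ar(2)] aug_add[OF ce0(1)] unfolding I_def by blast
      ultimately have "p - d (Suc j) r \<in> I j j"
        using regj[of j "p - d (Suc j) r"] jn ce_diff[OF ce0(1) p(1) dP[OF jn ar(3)]] by simp
      moreover have "d (Suc j) r \<in> D j" using ar jn by (auto simp: D_def)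
      moreover have "p = d (Suc j) r + (p - d (Suc j) r)" by simp
      ultimately show False using p(2) by blast
    qed
    \<comment> \<open>x_i q is compared with x_j z, where d z is the boundary part of x_i p. Their
      boundaries agree modulo \<open>I j\<close> because x_i and x_j commute.\<close>
    have part3: "\<exists>b\<in>D (Suc j). \<exists>c\<in>I (Suc j) (Suc j). x (Suc j) i q = b + c" for i
    proof -
      obtain b1 c1 where b1: "b1 \<in> D j" "c1 \<in> I j j" "x j i p = b1 + c1" using p(3)[of i] by auto
      then obtain z where z: "z \<in> P (Suc j)" "b1 = d (Suc j) z" using jn by (auto simp: D_def)
      have P: "b1 \<in> P j" "c1 \<in> P j" using b1 IP[of j j] DP[of j] jn by auto
      have "d (Suc j) (x (Suc j) i q - x (Suc j) j z) = x j i (x j j p - c) - x j j b1"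
        using ddiff[OF jn, of "x (Suc j) i q" "x (Suc j) j z"] d_x[OF jn z(1), of j] d_x[OF jn q(1), of i]
          ce_cl[OF ce0(2)] q(1) z dq by simp
      also have "\<dots> = x j j (x j i p) - x j i c - x j j b1"
        using ce_x_diff[OF ce0(1) ce_cl[OF ce0(1) p(1)] cP] ce_comm[OF ce0(1) p(1), of i j] by simp
      also have "\<dots> = x j j c1 - x j i c" using b1(3) ce_x_add[OF ce0(1) P] by simp
      also have "\<dots> \<in> I j j" using b1(2) bc(2) aug_diff[OF ce0(1)] aug_x[OF ce0(1)] unfolding I_def by blast
      finally obtain b2 c2 where b2: "x (Suc j) i q - x (Suc j) j z = b2 + c2" "b2 \<in> D (Suc j)" "c2 \<in> I j (Suc j)"
        using Ea[of j "x (Suc j) i q - x (Suc j) j z"] jn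
          ce_diff[OF ce0(2) ce_cl[OF ce0(2) q(1)] ce_cl[OF ce0(2) z(1)]] by auto
      then have "x (Suc j) i q = b2 + (c2 + x (Suc j) j z)" by (simp add: algebra_simps)
      moreover have "c2 + x (Suc j) j z \<in> I (Suc j) (Suc j)"
        using b2 z aug_mem_Suc[OF ce0(2)] unfolding I_def by blast
      ultimately show ?thesis using b2 by blast
    qed
    show ?case
    proof (intro conjI allI impI)
      fix k y assume "Suc j \<le> k \<and> k < n \<and> y \<in> P (Suc k) \<and> d (Suc k) y \<in> I (Suc j) k"
      then show "\<exists>b\<in>D (Suc k). \<exists>c\<in>I (Suc j) (Suc k). y = b + c" using part1 by blast
    next
      show "\<exists>p\<in>P (Suc j). \<not> (\<exists>b\<in>D (Suc j). \<exists>c\<in>I (Suc j) (Suc j). p = b + c) \<and>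
        (\<forall>i. \<exists>b\<in>D (Suc j). \<exists>c\<in>I (Suc j) (Suc j). x (Suc j) i p = b + c)"
        using q(1) part2 part3 by blast
    qed
  qed
  \<comment> \<open>In the top degree \<open>D n\<close> is {0}, so p contradicts injectivity of x_n
    modulo its predecessors; this operator belongs to the regular sequence since n < m.\<close>
  obtain p where p: "p \<in> P n" "p \<notin> I n n" "x n n p \<in> I n n"
    using main[of n] by (auto simp: D_def)
  then show False using reg[of n] nm unfolding regular_seq_def I_def by blast
qed

section \<open>Projective modules over group rings\<close>

lemma additive_on_diff:
  fixes f :: "'m::ab_group_add \<Rightarrow> 'n::ab_group_add"
  assumes "0 \<in> P" "\<And>a. a \<in> P \<Longrightarrow> - a \<in> P" "\<And>a b. a \<in> P \<Longrightarrow> b \<in> P \<Longrightarrow> f (a + b) = f a + f b"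
    "a \<in> P" "b \<in> P"
  shows "f (a - b) = f a - f b"
  using assms(3)[of a "- b"] additive_on_minus[of P f b] assms by (metis diff_conv_add_uminus)

lemma free_carrierD:
  assumes "f \<in> free_carrier H"
  shows "finite {(i, y). f i y \<noteq> 0}" "f i y \<noteq> 0 \<Longrightarrow> y \<in> carrier H" "finite {y. f i y \<noteq> 0}"
proof -
  show *: "finite {(i, y). f i y \<noteq> 0}" and "f i y \<noteq> 0 \<Longrightarrow> y \<in> carrier H"
    using assms unfolding free_carrier_def by auto
  have "{y. f i y \<noteq> 0} \<subseteq> snd ` {(i, y). f i y \<noteq> 0}" by force
  then show "finite {y. f i y \<noteq> 0}" using * finite_surj by blast
qed

context group
begin

lemma free_act_support:
  assumes "f \<in> free_carrier G" "h \<in> carrier G"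
  shows "{(i, y). free_act G h f i y \<noteq> 0} = (\<lambda>(i, y). (i, h \<otimes> y)) ` {(i, y). f i y \<noteq> 0}"
proof (intro equalityI subsetI)
  fix p assume "p \<in> {(i, y). free_act G h f i y \<noteq> 0}"
  then obtain i y where p: "p = (i, y)" "y \<in> carrier G" "f i (inv h \<otimes> y) \<noteq> 0"
    by (auto simp: free_act_def split: if_splits)
  then have "p = (\<lambda>(i, y). (i, h \<otimes> y)) (i, inv h \<otimes> y)" using assms by (simp add: m_assoc[symmetric])
  then show "p \<in> (\<lambda>(i, y). (i, h \<otimes> y)) ` {(i, y). f i y \<noteq> 0}" using p by blast
next
  fix p assume "p \<in> (\<lambda>(i, y). (i, h \<otimes> y)) ` {(i, y). f i y \<noteq> 0}"
  then obtain i y where p: "p = (i, h \<otimes> y)" "f i y \<noteq> 0" by auto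
  then have "y \<in> carrier G" using assms free_carrierD by metis
  then show "p \<in> {(i, y). free_act G h f i y \<noteq> 0}"
    using p assms by (simp add: free_act_def m_assoc[symmetric])
qed

lemma module_free: "module_on G (free_carrier G :: ('i \<Rightarrow> 'a \<Rightarrow> int) set) (free_act G)"
  unfolding module_on_def
proof (intro conjI ballI)
  show "0 \<in> free_carrier G" by (simp add: free_carrier_def zero_fun_def)
next
  fix f g :: "'i \<Rightarrow> 'a \<Rightarrow> int" assume fg: "f \<in> free_carrier G" "g \<in> free_carrier G"
  have "{(i, y). (f + g) i y \<noteq> 0} \<subseteq> {(i, y). f i y \<noteq> 0} \<union> {(i, y). g i y \<noteq> 0}" by auto
  moreover have "finite ({(i, y). f i y \<noteq> 0} \<union> {(i, y). g i y \<noteq> 0})" using fg free_carrierD(1) by blast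
  ultimately have "finite {(i, y). (f + g) i y \<noteq> 0}" using finite_subset by blast
  moreover have "y \<in> carrier G" if "(f + g) i y \<noteq> 0" for i y
    using that free_carrierD(2)[OF fg(1), of i y] free_carrierD(2)[OF fg(2), of i y] by (cases "f i y = 0") auto
  ultimately show "f + g \<in> free_carrier G" unfolding free_carrier_def by blast
next
  fix f assume "f \<in> free_carrier G"
  then show "- f \<in> free_carrier G" by (simp add: free_carrier_def)
next
  fix h f assume hf: "h \<in> carrier G" "f \<in> free_carrier G"
  have "finite {(i, y). free_act G h f i y \<noteq> 0}"
    using free_act_support[OF hf(2,1)] free_carrierD(1)[OF hf(2)] by simp
  then show "free_act G h f \<in> free_carrier G" by (auto simp: free_carrier_def free_act_def)
next
  fix h f g show "free_act G h (f + g) = free_act G h f + free_act G h g"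
    by (auto simp: free_act_def fun_eq_iff)
next
  fix f assume "f \<in> free_carrier G"
  then show "free_act G \<one> f = f"
    using free_carrierD(2) by (fastforce simp: free_act_def fun_eq_iff)
next
  fix g h f assume "g \<in> carrier G" "h \<in> carrier G" "f \<in> free_carrier G"
  then show "free_act G (g \<otimes> h) f = free_act G g (free_act G h f)"
    by (auto simp: free_act_def fun_eq_iff inv_mult_group m_assoc)
qed

lemma comm_endos_module:
  assumes M: "module_on G P act" and t: "\<And>i. t i \<in> carrier G" "\<And>i j. t i \<otimes> t j = t j \<otimes> t i"
  shows "comm_endos (\<lambda>i a. act (t i) a - a) P"
proof -
  have z: "0 \<in> P" and add: "\<And>a b. a \<in> P \<Longrightarrow> b \<in> P \<Longrightarrow> a + b \<in> P" and neg: "\<And>a. a \<in> P \<Longrightarrow> - a \<in> P"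
    and cl: "\<And>h a. h \<in> carrier G \<Longrightarrow> a \<in> P \<Longrightarrow> act h a \<in> P"
    and act_add: "\<And>h a b. h \<in> carrier G \<Longrightarrow> a \<in> P \<Longrightarrow> b \<in> P \<Longrightarrow> act h (a + b) = act h a + act h b"
    and act_mult: "\<And>g h a. g \<in> carrier G \<Longrightarrow> h \<in> carrier G \<Longrightarrow> a \<in> P \<Longrightarrow> act (g \<otimes> h) a = act g (act h a)"
    using M unfolding module_on_def by blast+
  have diff: "a - b \<in> P" if "a \<in> P" "b \<in> P" for a b using add neg that by (metis diff_conv_add_uminus)
  have act_diff: "act h (a - b) = act h a - act h b" if "h \<in> carrier G" "a \<in> P" "b \<in> P" for h a b
    by (rule additive_on_diff[of P]) (use that z neg act_add in auto)
  have "act (t i) (act (t j) a - a) - (act (t j) a - a) = act (t j) (act (t i) a - a) - (act (t i) a - a)"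
    if "a \<in> P" for i j a
  proof -
    have "act (t i) (act (t j) a) = act (t j) (act (t i) a)"
      using act_mult[OF t(1) t(1) that, of i j] act_mult[OF t(1) t(1) that, of j i] t(2) by simp
    then show ?thesis using that t cl by (simp add: act_diff)
  qed
  then show ?thesis unfolding comm_endos_def using z add neg diff cl t act_add by (auto simp: algebra_simps)
qed

section \<open>Orbit sums and the augmentation submodule\<close>

definition pairing :: "('i \<Rightarrow> 'a \<Rightarrow> int) \<Rightarrow> 'i \<Rightarrow> ('a \<Rightarrow> int) \<Rightarrow> int" where
  "pairing f i \<theta> = (\<Sum>y | f i y \<noteq> 0. f i y * \<theta> y)"

lemma pairing_superset:
  assumes "finite S" "{y. f i y \<noteq> 0} \<subseteq> S"
  shows "pairing f i \<theta> = (\<Sum>y\<in>S. f i y * \<theta> y)"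
  unfolding pairing_def by (rule sum.mono_neutral_left) (use assms in auto)

lemma pairing_diff:
  assumes "f \<in> free_carrier G" "g \<in> free_carrier G"
  shows "pairing (f - g) i \<theta> = pairing f i \<theta> - pairing g i \<theta>"
proof -
  let ?S = "{y. f i y \<noteq> 0} \<union> {y. g i y \<noteq> 0}"
  have S: "finite ?S" using free_carrierD(3)[OF assms(1)] free_carrierD(3)[OF assms(2)] by simp
  have "pairing (f - g) i \<theta> = (\<Sum>y\<in>?S. (f - g) i y * \<theta> y)" by (rule pairing_superset[OF S]) auto
  also have "\<dots> = (\<Sum>y\<in>?S. f i y * \<theta> y) - (\<Sum>y\<in>?S. g i y * \<theta> y)"
    by (simp add: sum_subtractf left_diff_distrib)
  also have "(\<Sum>y\<in>?S. f i y * \<theta> y) = pairing f i \<theta>" by (rule pairing_superset[OF S, symmetric]) auto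
  also have "(\<Sum>y\<in>?S. g i y * \<theta> y) = pairing g i \<theta>" by (rule pairing_superset[OF S, symmetric]) auto
  finally show ?thesis .
qed

lemma pairing_act:
  assumes "f \<in> free_carrier G" "h \<in> carrier G"
  shows "pairing (free_act G h f) i \<theta> = pairing f i (\<lambda>y. \<theta> (h \<otimes> y))"
  unfolding pairing_def
proof (rule sum.reindex_bij_witness[where i = "\<lambda>y. h \<otimes> y" and j = "\<lambda>y. inv h \<otimes> y"])
  fix y assume "y \<in> {y. free_act G h f i y \<noteq> 0}"
  then have y: "y \<in> carrier G" "f i (inv h \<otimes> y) \<noteq> 0" by (auto simp: free_act_def split: if_splits)
  then show "h \<otimes> (inv h \<otimes> y) = y" using assms by (simp add: m_assoc[symmetric])
  show "inv h \<otimes> y \<in> {y. f i y \<noteq> 0}" using y by simp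
  show "f i (inv h \<otimes> y) * \<theta> (h \<otimes> (inv h \<otimes> y)) = free_act G h f i y * \<theta> y"
    using y assms by (simp add: free_act_def m_assoc[symmetric])
next
  fix y assume "y \<in> {y. f i y \<noteq> 0}"
  then have y: "y \<in> carrier G" "f i y \<noteq> 0" using free_carrierD[OF assms(1)] by auto
  then show "inv h \<otimes> (h \<otimes> y) = y" "h \<otimes> y \<in> {y. free_act G h f i y \<noteq> 0}"
    using assms by (auto simp: m_assoc[symmetric] free_act_def)
qed

text \<open>For a subgroup \<open>L\<close> this says that f vanishes in the
  \<open>L\<close>-coinvariants, that is, each coordinate of f has sum zero over every
  \<open>L\<close>-orbit. The test functions need not have finite support:
  \<open>null_pairing_shift\<close> uses the indicator of an infinite union of orbits.\<close>

definition null_pairing :: "'a set \<Rightarrow> ('i \<Rightarrow> 'a \<Rightarrow> int) \<Rightarrow> bool" where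
  "null_pairing L f \<longleftrightarrow> f \<in> free_carrier G \<and>
     (\<forall>i \<theta>. (\<forall>l\<in>L. \<forall>y\<in>carrier G. \<theta> (l \<otimes> y) = \<theta> y) \<longrightarrow> pairing f i \<theta> = 0)"

lemma pairing_cong:
  assumes "f \<in> free_carrier G" "\<And>y. y \<in> carrier G \<Longrightarrow> \<theta> y = \<theta>' y"
  shows "pairing f i \<theta> = pairing f i \<theta>'"
  unfolding pairing_def by (rule sum.cong) (use assms(2) free_carrierD(2)[OF assms(1)] in auto)

context
  fixes t :: "nat \<Rightarrow> 'a"
  assumes t: "\<And>i. t i \<in> carrier G" "\<And>i j. t i \<otimes> t j = t j \<otimes> t i"
begin

abbreviation (input) "shift \<equiv> (\<lambda>i f. free_act G (t i) f - f)"
abbreviation (input) "L j \<equiv> generate G (t ` {..<j})"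

lemma ce_free: "comm_endos shift (free_carrier G)"
  by (rule comm_endos_module[OF module_free t])

lemma L_subgroup: "subgroup (L j) G"
  by (rule generate_is_subgroup) (use t in auto)

lemma free_act_cl: "h \<in> carrier G \<Longrightarrow> f \<in> free_carrier G \<Longrightarrow> free_act G h f \<in> free_carrier G"
  and free_act_mult: "g \<in> carrier G \<Longrightarrow> h \<in> carrier G \<Longrightarrow> f \<in> free_carrier G \<Longrightarrow>
     free_act G (g \<otimes> h) f = free_act G g (free_act G h f)"
  and free_act_one: "f \<in> free_carrier G \<Longrightarrow> free_act G \<one> f = f"
  using module_free unfolding module_on_def by blast+

text \<open>In the pairing a translation of w can be moved to the test function, which is invariant;
  hence (t_j - 1) w pairs to zero.\<close>

lemma null_pairing_aug:
  assumes "f \<in> aug shift (free_carrier G) j"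
  shows "null_pairing (L j) f"
  using assms
proof (induction j arbitrary: f)
  case 0
  then have "f = 0" by simp
  moreover from this have "pairing f i \<theta> = 0" for i \<theta> by (simp add: pairing_def)
  ultimately show ?case using ce_zero[OF ce_free] by (simp only: null_pairing_def) blast
next
  case (Suc j)
  then obtain a w where aw: "f = a + (free_act G (t j) w - w)" "a \<in> aug shift (free_carrier G) j"
    "w \<in> free_carrier G" unfolding aug.simps by blast
  have N: "null_pairing (L j) a" using Suc.IH aw by blast
  have aF: "a \<in> free_carrier G" using aug_sub[OF ce_free aw(2)] .
  have fF: "f \<in> free_carrier G" using aug_sub[OF ce_free Suc.prems] .
  have "pairing f i \<theta> = 0" if \<theta>: "\<forall>l\<in>L (Suc j). \<forall>y\<in>carrier G. \<theta> (l \<otimes> y) = \<theta> y" for i \<theta>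
  proof -
    have "L j \<subseteq> L (Suc j)" by (rule mono_generate) auto
    then have 1: "pairing a i \<theta> = 0" using N \<theta> unfolding null_pairing_def by blast
    have tj: "t j \<in> L (Suc j)" by (rule generate.incl) auto
    have wF: "free_act G (t j) w - w \<in> free_carrier G" "free_act G (t j) w \<in> free_carrier G"
      using ce_cl[OF ce_free aw(3)] free_act_cl t aw(3) by auto
    have "f = a - (w - free_act G (t j) w)" using aw by simp
    then have "pairing f i \<theta> = pairing a i \<theta> - (pairing w i \<theta> - pairing (free_act G (t j) w) i \<theta>)"
      using pairing_diff[OF aw(3) wF(2)] pairing_diff[OF aF ce_diff[OF ce_free aw(3) wF(2)]] by simp
    also have "pairing (free_act G (t j) w) i \<theta> = pairing w i \<theta>"
      using pairing_act[OF aw(3) t(1)] pairing_cong[OF aw(3), of "\<lambda>y. \<theta> (t j \<otimes> y)" \<theta> i] \<theta> tj by simp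
    finally show ?thesis using 1 by simp
  qed
  then show ?case using fF unfolding null_pairing_def by blast
qed

text \<open>For l in the generated group, l - 1 is a combination of the t_i - 1, by gh - 1 = (g - 1)
  h + (h - 1) and g^{-1} - 1 = -(g - 1) g^{-1}.\<close>

lemma aug_shift_L:
  assumes "l \<in> L j" "f \<in> free_carrier G"
  shows "free_act G l f - f \<in> aug shift (free_carrier G) j"
  using assms
proof (induction arbitrary: f rule: generate.induct)
  case one
  have "free_act G \<one> f - f = 0" using free_act_one[OF one] by simp
  then show ?case using aug_zero[OF ce_free, of j] by (simp only:)
next
  case (incl h)
  then obtain i where "i < j" "h = t i" by auto
  then show ?case using aug_gen[OF ce_free] incl by blast
next
  case (inv h)
  then obtain i where i: "i < j" "h = t i" by auto
  let ?f = "free_act G (inv h) f"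
  have f: "?f \<in> free_carrier G" by (rule free_act_cl[OF _ inv(2)]) (simp add: i t)
  have "free_act G h ?f = f" using free_act_mult[of h "inv h" f] free_act_one[OF inv(2)] inv i t by simp
  then have "?f - f = - (free_act G h ?f - ?f)" by simp
  then show ?case using aug_neg[OF ce_free aug_gen[OF ce_free i(1) f]] by (simp only: i(2))
next
  case (eng h1 h2)
  have h: "h1 \<in> carrier G" "h2 \<in> carrier G" using eng subgroup.mem_carrier[OF L_subgroup] by auto
  have *: "free_act G (h1 \<otimes> h2) f - f =
     (free_act G h1 (free_act G h2 f) - free_act G h2 f) + (free_act G h2 f - f)"
    using free_act_mult h eng by simp
  show ?case unfolding * by (rule aug_add[OF ce_free eng.IH(1)[OF free_act_cl[OF h(2) eng.prems]] eng.IH(2)[OF eng.prems]])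
qed

text \<open>Moving the value of \<open>f\<close> at a support point to another support point of the same orbit
  shrinks the support and changes \<open>f\<close> by an element of the augmentation part.\<close>

lemma aug_null_pairing:
  assumes "null_pairing (L j) f"
  shows "f \<in> aug shift (free_carrier G) j"
  using assms
proof (induction "card {(i, y). f i y \<noteq> 0}" arbitrary: f rule: less_induct)
  case less
  have fF: "f \<in> free_carrier G" using less.prems by (simp add: null_pairing_def)
  show ?case
  proof (cases "\<exists>i y. f i y \<noteq> 0")
    case False
    then have "f = 0" by (auto simp: fun_eq_iff)
    then show ?thesis using aug_zero[OF ce_free] by simp
  next
    case True
    then obtain i0 y0 where y0: "f i0 y0 \<noteq> 0" by blast
    have y0c: "y0 \<in> carrier G" using y0 fF free_carrierD by metis
    \<comment> \<open>The indicator of the orbit of y0. Its pairing with f is an orbit sum and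
      vanishes, so the orbit contains a second support point y1.\<close>
    define \<theta> :: "'a \<Rightarrow> int" where "\<theta> y = of_bool (\<exists>l\<in>L j. y = l \<otimes> y0)" for y
    have "\<theta> (l \<otimes> y) = \<theta> y" if l: "l \<in> L j" and y: "y \<in> carrier G" for l y
    proof -
      have lc: "l \<in> carrier G" using subgroup.mem_carrier[OF L_subgroup] l by blast
      have "(\<exists>k\<in>L j. l \<otimes> y = k \<otimes> y0) \<longleftrightarrow> (\<exists>k\<in>L j. y = k \<otimes> y0)"
      proof
        assume "\<exists>k\<in>L j. l \<otimes> y = k \<otimes> y0"
        then obtain k where k: "k \<in> L j" "l \<otimes> y = k \<otimes> y0" by blast
        have kc: "k \<in> carrier G" using subgroup.mem_carrier[OF L_subgroup] k by blast
        have "y = (inv l \<otimes> k) \<otimes> y0" using k(2) lc kc y y0c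
          by (metis inv_closed inv_solve_left m_assoc m_closed)
        moreover have "inv l \<otimes> k \<in> L j"
          using subgroup.m_closed[OF L_subgroup] subgroup.m_inv_closed[OF L_subgroup] l k by blast
        ultimately show "\<exists>k\<in>L j. y = k \<otimes> y0" by blast
      next
        assume "\<exists>k\<in>L j. y = k \<otimes> y0"
        then obtain k where k: "k \<in> L j" "y = k \<otimes> y0" by blast
        have kc: "k \<in> carrier G" using subgroup.mem_carrier[OF L_subgroup] k by blast
        have "l \<otimes> y = (l \<otimes> k) \<otimes> y0" using k lc kc y0c by (simp add: m_assoc)
        then show "\<exists>k\<in>L j. l \<otimes> y = k \<otimes> y0" using subgroup.m_closed[OF L_subgroup l k(1)] by blast
      qed
      then show ?thesis by (simp add: \<theta>_def)
    qed
    then have "pairing f i0 \<theta> = 0" using less.prems unfolding null_pairing_def by blast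
    moreover have "pairing f i0 \<theta> = f i0 y0 * \<theta> y0 + (\<Sum>y\<in>{y. f i0 y \<noteq> 0} - {y0}. f i0 y * \<theta> y)"
      unfolding pairing_def by (rule sum.remove) (use free_carrierD(3)[OF fF] y0 in auto)
    moreover have "\<theta> y0 = 1" unfolding \<theta>_def using subgroup.one_closed[OF L_subgroup, of j] y0c
      by (auto intro!: bexI[of _ \<one>])
    ultimately have "(\<Sum>y\<in>{y. f i0 y \<noteq> 0} - {y0}. f i0 y * \<theta> y) \<noteq> 0" using y0 by simp
    then obtain y1 where "y1 \<in> {y. f i0 y \<noteq> 0} - {y0}" and y1t: "f i0 y1 * \<theta> y1 \<noteq> 0"
      using sum.not_neutral_contains_not_neutral by meson
    then have y1: "f i0 y1 \<noteq> 0" "y1 \<noteq> y0" by auto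
    then obtain l where l: "l \<in> L j" "y1 = l \<otimes> y0" using y1t by (auto simp: \<theta>_def split: if_splits)
    have lc: "l \<in> carrier G" using subgroup.mem_carrier[OF L_subgroup] l by blast
    \<comment> \<open>e is the part of f at y0 in the coordinate i0; translating it by l puts the
      same value at y1.\<close>
    define e where "e = (\<lambda>i y. if i = i0 \<and> y = y0 then f i0 y0 else 0)"
    have "{(i, y). e i y \<noteq> 0} \<subseteq> {(i0, y0)}" by (auto simp: e_def)
    then have "finite {(i, y). e i y \<noteq> 0}" using finite_subset by blast
    then have eF: "e \<in> free_carrier G" unfolding free_carrier_def using y0c by (auto simp: e_def)
    have le: "free_act G l e = (\<lambda>i y. if i = i0 \<and> y = y1 then f i0 y0 else 0)"
    proof (intro ext)
      fix i y show "free_act G l e i y = (if i = i0 \<and> y = y1 then f i0 y0 else 0)"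
      proof (cases "y \<in> carrier G")
        case True
        then have "inv l \<otimes> y = y0 \<longleftrightarrow> y = y1" using l lc y0c inv_solve_left[of y0 l y] by metis
        then show ?thesis using True by (simp add: free_act_def e_def)
      next
        case False
        then show ?thesis using l lc y0c by (auto simp: free_act_def)
      qed
    qed
    define u where "u = free_act G l e - e"
    have uA: "u \<in> aug shift (free_carrier G) j" unfolding u_def using aug_shift_L[OF l(1) eF] .
    have uF: "u \<in> free_carrier G" using aug_sub[OF ce_free uA] .
    \<comment> \<open>This is f + u; the double negation gives it the shape of
      \<open>pairing_diff\<close>. The support loses y0 and gains nothing, since y1 already belongs
      to it.\<close>
    define f' where "f' = f - - u"
    have f'v: "f' i y = (if i = i0 \<and> y = y0 then 0 else if i = i0 \<and> y = y1 then f i y + f i0 y0 else f i y)" for i y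
      unfolding f'_def u_def minus_apply uminus_apply le using y1(2) by (simp add: e_def)
    have nuF: "- u \<in> free_carrier G" using uF ce_neg[OF ce_free] by blast
    have "f' \<in> free_carrier G" unfolding f'_def using ce_diff[OF ce_free fF nuF] .
    moreover have "pairing f' i \<theta>' = 0" if "\<forall>l\<in>L j. \<forall>y\<in>carrier G. \<theta>' (l \<otimes> y) = \<theta>' y" for i \<theta>'
    proof -
      have "pairing (- u) i \<theta>' = 0" using null_pairing_aug[OF aug_neg[OF ce_free uA]] that
        unfolding null_pairing_def by blast
      moreover have "pairing f i \<theta>' = 0" using less.prems that unfolding null_pairing_def by blast
      ultimately show ?thesis unfolding f'_def using pairing_diff[OF fF nuF] by simp
    qed
    ultimately have N: "null_pairing (L j) f'" unfolding null_pairing_def by blast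
    have "{(i, y). f' i y \<noteq> 0} \<subset> {(i, y). f i y \<noteq> 0}"
    proof
      show "{(i, y). f' i y \<noteq> 0} \<subseteq> {(i, y). f i y \<noteq> 0}" using y1 by (auto simp: f'v split: if_splits)
      have "(i0, y0) \<in> {(i, y). f i y \<noteq> 0}" "(i0, y0) \<notin> {(i, y). f' i y \<noteq> 0}" using y0 by (auto simp: f'v)
      then show "{(i, y). f' i y \<noteq> 0} \<noteq> {(i, y). f i y \<noteq> 0}" by blast
    qed
    then have "card {(i, y). f' i y \<noteq> 0} < card {(i, y). f i y \<noteq> 0}"
      by (rule psubset_card_mono[OF free_carrierD(1)[OF fF]])
    then have "f' \<in> aug shift (free_carrier G) j" using less.hyps N by blast
    then have "f' - u \<in> aug shift (free_carrier G) j" using aug_diff[OF ce_free] uA by blast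
    then show ?thesis by (simp add: f'_def)
  qed
qed

lemma L_commutes: "l \<in> L j \<Longrightarrow> l \<otimes> t k = t k \<otimes> l"
proof (induction rule: generate.induct)
  case one
  then show ?case using t by simp
next
  case (incl h)
  then show ?case using t by auto
next
  case (inv h)
  then obtain i where i: "h = t i" by auto
  have "t k = inv h \<otimes> (t k \<otimes> h)" using t i by (metis inv_solve_left m_closed)
  then show ?case using t i by (metis inv_closed inv_solve_right m_assoc m_closed)
next
  case (eng h1 h2)
  have "h1 \<in> carrier G" "h2 \<in> carrier G" using eng subgroup.mem_carrier[OF L_subgroup] by auto
  then show ?case using eng t by (metis m_assoc)
qed

text \<open>If \<open>t\<^sub>j w\<close> and \<open>w\<close> have the same sums over the orbits of \<open>t\<^sub>0, \<dots>, t\<^sub>j\<^sub>-\<^sub>1\<close>, pair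
  \<open>t\<^sub>j w - w\<close> with the indicator of the translates of an orbit by \<open>t\<^sub>j, t\<^sub>j\<^sup>2, \<dots>\<close>: since
  these are disjoint from the orbit, the result is the sum of \<open>w\<close> over the orbit.\<close>

lemma null_pairing_shift:
  assumes w: "w \<in> free_carrier G" and N: "null_pairing (L j) (free_act G (t j) w - w)"
    and ind: "\<And>k::nat. k > 0 \<Longrightarrow> t j [^] k \<notin> L j"
  shows "null_pairing (L j) w"
proof -
  define T where "T = t j"
  have T: "T \<in> carrier G" using t by (simp add: T_def)
  have Lc: "l \<in> carrier G" if "l \<in> L j" for l using subgroup.mem_carrier[OF L_subgroup that] .
  have Lpow: "l \<otimes> T [^] k = T [^] k \<otimes> l" if "l \<in> L j" for l and k :: nat
  proof (induction k)
    case (Suc k)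
    have "l \<otimes> T [^] Suc k = (l \<otimes> T [^] k) \<otimes> T" using Lc[OF that] T by (simp add: m_assoc)
    also have "\<dots> = T [^] k \<otimes> (l \<otimes> T)" using Lc[OF that] T Suc by (simp add: m_assoc)
    also have "\<dots> = T [^] Suc k \<otimes> l" using Lc[OF that] T L_commutes[OF that] by (simp add: m_assoc T_def)
    finally show ?case .
  qed (use Lc[OF that] in simp)
  have "pairing w i \<theta> = 0" if \<theta>: "\<forall>l\<in>L j. \<forall>y\<in>carrier G. \<theta> (l \<otimes> y) = \<theta> y" for i and \<theta> :: "'a \<Rightarrow> int"
  proof -
    define rel where "rel y z \<longleftrightarrow> (\<exists>l\<in>L j. z = l \<otimes> y)" for y z
    \<comment> \<open>Since \<theta> is constant on orbits, it is enough that the orbit sums of w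
      vanish.\<close>
    have orb: "(\<Sum>y | w i y \<noteq> 0 \<and> rel y0 y. w i y) = 0" if y0: "y0 \<in> carrier G" for y0
    proof -
      \<comment> \<open>U is the union of the forward translates T^k L y0 with k at least 1. T maps
        the orbit into U, and the hypothesis on powers of T keeps the orbit itself outside U; so
        1_U(T y) - 1_U(y) is the indicator of the orbit.\<close>
      define U where "U = {y. \<exists>k\<ge>1::nat. \<exists>l\<in>L j. y = T [^] k \<otimes> (l \<otimes> y0)}"
      have Uinv1: "l \<otimes> y \<in> U" if ly: "l \<in> L j" "y \<in> U" for l y
      proof -
        obtain k l' where k: "k \<ge> 1" "l' \<in> L j" "y = T [^] (k::nat) \<otimes> (l' \<otimes> y0)" using ly unfolding U_def by blast
        have "l \<otimes> y = (l \<otimes> T [^] k) \<otimes> (l' \<otimes> y0)" using k Lc ly T y0 by (simp add: m_assoc)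
        also have "\<dots> = T [^] k \<otimes> ((l \<otimes> l') \<otimes> y0)" using k Lc ly T y0 by (simp add: m_assoc Lpow)
        finally show ?thesis unfolding U_def using k subgroup.m_closed[OF L_subgroup ly(1) k(2)] by blast
      qed
      have Uc: "y \<in> carrier G" if "y \<in> U" for y using that Lc T y0 by (auto simp: U_def)
      have Uinv: "l \<otimes> y \<in> U \<longleftrightarrow> y \<in> U" if ly: "l \<in> L j" "y \<in> carrier G" for l y
      proof
        assume "l \<otimes> y \<in> U"
        then have "inv l \<otimes> (l \<otimes> y) \<in> U" using Uinv1 subgroup.m_inv_closed[OF L_subgroup ly(1)] by blast
        then show "y \<in> U" using Lc ly by (simp add: m_assoc[symmetric])
      qed (use Uinv1 ly in blast)
      have disj: "\<not> rel y0 y" if "y \<in> U" for y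
      proof
        assume "rel y0 y"
        then obtain l where l: "l \<in> L j" "y = l \<otimes> y0" by (auto simp: rel_def)
        obtain k l' where k: "k \<ge> 1" "l' \<in> L j" "y = T [^] (k::nat) \<otimes> (l' \<otimes> y0)" using \<open>y \<in> U\<close> unfolding U_def by blast
        then have "T [^] k \<otimes> l' \<otimes> y0 = l \<otimes> y0" using l T y0 Lc by (simp add: m_assoc)
        then have "T [^] k \<otimes> l' = l" using T y0 Lc l k by simp
        then have "T [^] k = l \<otimes> inv l'" using T Lc l k inv_solve_right by (metis nat_pow_closed)
        then have "T [^] k \<in> L j"
          using subgroup.m_closed[OF L_subgroup l(1) subgroup.m_inv_closed[OF L_subgroup k(2)]] by simp
        then show False using ind[of k] k by (simp add: T_def)
      qed
      have step: "T \<otimes> y \<in> U \<longleftrightarrow> y \<in> U \<or> rel y0 y" if y: "y \<in> carrier G" for y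
      proof
        assume "T \<otimes> y \<in> U"
        then obtain k l where k: "k \<ge> 1" "l \<in> L j" "T \<otimes> y = T [^] (k::nat) \<otimes> (l \<otimes> y0)" unfolding U_def by blast
        then obtain k' where k': "k = Suc k'" by (cases k) auto
        have "T \<otimes> y = T \<otimes> (T [^] k' \<otimes> (l \<otimes> y0))"
          using k(3) nat_pow_Suc2[OF T, of k'] T Lc k y0 by (simp add: k' m_assoc del: nat_pow_Suc)
        then have *: "y = T [^] k' \<otimes> (l \<otimes> y0)" using T y Lc k y0 by simp
        show "y \<in> U \<or> rel y0 y"
        proof (cases "k' = 0")
          case True
          then show ?thesis using * k Lc y0 by (auto simp: rel_def)
        next
          case False
          then have "k' \<ge> 1" by simp
          then show ?thesis using * k unfolding U_def by blast
        qed
      next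
        assume "y \<in> U \<or> rel y0 y"
        then obtain k l where k: "l \<in> L j" "y = T [^] (k::nat) \<otimes> (l \<otimes> y0)"
        proof
          assume "rel y0 y"
          then obtain l where "l \<in> L j" "y = l \<otimes> y0" by (auto simp: rel_def)
          then show thesis using that[of l 0] Lc y0 by simp
        qed (auto simp: U_def)
        then have "T \<otimes> y = T [^] Suc k \<otimes> (l \<otimes> y0)"
          using nat_pow_Suc2[OF T, of k] T Lc y0 by (simp add: m_assoc del: nat_pow_Suc)
        then show "T \<otimes> y \<in> U" unfolding U_def using k(1) by (metis (mono_tags, lifting) One_nat_def Suc_le_mono le0 mem_Collect_eq)
      qed
      define \<eta> :: "'a \<Rightarrow> int" where "\<eta> y = of_bool (y \<in> U)" for y
      have "\<forall>l\<in>L j. \<forall>y\<in>carrier G. \<eta> (l \<otimes> y) = \<eta> y" using Uinv by (simp add: \<eta>_def)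
      then have "pairing (free_act G (t j) w - w) i \<eta> = 0" using N unfolding null_pairing_def by blast
      then have "pairing w i (\<lambda>y. \<eta> (T \<otimes> y)) - pairing w i \<eta> = 0"
        using pairing_diff[OF free_act_cl[OF t(1) w] w] pairing_act[OF w t(1)] by (simp add: T_def)
      then have "(\<Sum>y | w i y \<noteq> 0. w i y * (\<eta> (T \<otimes> y) - \<eta> y)) = 0"
        unfolding pairing_def by (simp add: sum_subtractf right_diff_distrib)
      moreover have "(\<Sum>y | w i y \<noteq> 0. w i y * (\<eta> (T \<otimes> y) - \<eta> y)) =
          (\<Sum>y | w i y \<noteq> 0. if rel y0 y then w i y else 0)"
      proof (rule sum.cong)
        fix y assume "y \<in> {y. w i y \<noteq> 0}"
        then have "y \<in> carrier G" using free_carrierD[OF w] by auto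
        then show "w i y * (\<eta> (T \<otimes> y) - \<eta> y) = (if rel y0 y then w i y else 0)"
          using step[of y] disj[of y] by (auto simp: \<eta>_def)
      qed simp
      ultimately have "(\<Sum>y | w i y \<noteq> 0. if rel y0 y then w i y else 0) = 0" by simp
      then show ?thesis using sum.inter_filter[OF free_carrierD(3)[OF w, of i], of "w i" "rel y0"] by simp
    qed
    have relref: "rel y y" if "y \<in> carrier G" for y
      using that subgroup.one_closed[OF L_subgroup, of j] by (auto simp: rel_def intro!: bexI[of _ \<one>])
    define S where "S = {y. w i y \<noteq> 0}"
    have S: "finite S" "S \<subseteq> carrier G" using free_carrierD[OF w] by (auto simp: S_def)
    \<comment> \<open>An orbit is labelled by its trace on the support; grouping by these labels
      splits the sum over S into orbit sums.\<close>
    define cls where "cls y = {z \<in> S. rel y z}" for y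
    have cls_eq: "cls y = cls z" if yz: "y \<in> carrier G" "rel y z" for y z
    proof -
      obtain l where l: "l \<in> L j" "z = l \<otimes> y" using yz by (auto simp: rel_def)
      have "rel y v \<longleftrightarrow> rel z v" if v: "v \<in> carrier G" for v
      proof
        assume "rel y v"
        then obtain k where k: "k \<in> L j" "v = k \<otimes> y" by (auto simp: rel_def)
        then have "v = (k \<otimes> inv l) \<otimes> z" using l Lc \<open>y \<in> carrier G\<close> by (simp add: m_assoc inv_solve_left)
        then show "rel z v" unfolding rel_def
          using subgroup.m_closed[OF L_subgroup k(1) subgroup.m_inv_closed[OF L_subgroup l(1)]] by blast
      next
        assume "rel z v"
        then obtain k where k: "k \<in> L j" "v = k \<otimes> z" by (auto simp: rel_def)
        then have "v = (k \<otimes> l) \<otimes> y" using l Lc \<open>y \<in> carrier G\<close> by (simp add: m_assoc)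
        then show "rel y v" unfolding rel_def using subgroup.m_closed[OF L_subgroup k(1) l(1)] by blast
      qed
      then show ?thesis using S unfolding cls_def by blast
    qed
    have "(\<Sum>y\<in>S. w i y * \<theta> y) = (\<Sum>c\<in>cls ` S. \<Sum>y\<in>{y\<in>S. cls y = c}. w i y * \<theta> y)"
      by (rule sum.image_gen[OF S(1)])
    also have "\<dots> = 0"
    proof (rule sum.neutral, rule ballI)
      fix c assume "c \<in> cls ` S"
      then obtain y0 where y0: "y0 \<in> S" "c = cls y0" by blast
      have y0c: "y0 \<in> carrier G" using y0 S by blast
      have eq: "{y\<in>S. cls y = c} = {y\<in>S. rel y0 y}"
      proof (intro equalityI subsetI)
        fix y assume "y \<in> {y\<in>S. cls y = c}"
        then have "y \<in> S" "y \<in> cls y0" using y0 relref S by (auto simp: cls_def)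
        then show "y \<in> {y\<in>S. rel y0 y}" by (simp add: cls_def)
      next
        fix y assume "y \<in> {y\<in>S. rel y0 y}"
        then show "y \<in> {y\<in>S. cls y = c}" using cls_eq[OF y0c] y0 by auto
      qed
      have "(\<Sum>y\<in>{y\<in>S. rel y0 y}. w i y * \<theta> y) = (\<Sum>y\<in>{y\<in>S. rel y0 y}. w i y * \<theta> y0)"
      proof (rule sum.cong)
        fix y assume "y \<in> {y\<in>S. rel y0 y}"
        then have "\<theta> y = \<theta> y0" using \<theta> y0c by (auto simp: rel_def)
        then show "w i y * \<theta> y = w i y * \<theta> y0" by simp
      qed simp
      also have "\<dots> = (\<Sum>y\<in>{y\<in>S. rel y0 y}. w i y) * \<theta> y0" by (simp add: sum_distrib_right)
      also have "\<dots> = 0" using orb[OF y0c] by (simp add: S_def)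
      finally show "(\<Sum>y\<in>{y\<in>S. cls y = c}. w i y * \<theta> y) = 0" using eq by simp
    qed
    finally show ?thesis by (simp add: pairing_def S_def)
  qed
  then show ?thesis using w unfolding null_pairing_def by blast
qed

lemma regular_free:
  assumes "\<And>j (k::nat). j < m \<Longrightarrow> k > 0 \<Longrightarrow> t j [^] k \<notin> L j"
  shows "regular_seq m shift (free_carrier G)"
  unfolding regular_seq_def
proof (intro allI impI ballI)
  fix j w assume "j < m" and w: "w \<in> free_carrier G"
    and "free_act G (t j) w - w \<in> aug shift (free_carrier G) j"
  then have "null_pairing (L j) w"
    using null_pairing_shift[OF w null_pairing_aug] assms by blast
  then show "w \<in> aug shift (free_carrier G) j" by (rule aug_null_pairing)
qed

text \<open>A projective module is a retract of a free one, and both maps of the retraction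
  intertwine the operators t_i - 1.\<close>

lemma regular_projective:
  fixes P :: "'m::ab_group_add set"
  assumes "projective_on G P act" "\<And>j (k::nat). j < m \<Longrightarrow> k > 0 \<Longrightarrow> t j [^] k \<notin> L j"
  shows "regular_seq m (\<lambda>i a. act (t i) a - a) P"
proof -
  have M: "module_on G P act" using assms(1) unfolding projective_on_def by (rule conjunct1)
  from assms(1)[unfolded projective_on_def, THEN conjunct2] obtain s :: "'m \<Rightarrow> 'm \<Rightarrow> 'a \<Rightarrow> int" and r
    where s: "hom_on G P act (free_carrier G) (free_act G) s"
    and r: "hom_on G (free_carrier G) (free_act G) P act r" and rs: "\<forall>x\<in>P. r (s x) = x"
    by blast
  have ceP: "comm_endos (\<lambda>i a. act (t i) a - a) P" by (rule comm_endos_module[OF M t])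
  have actP: "act (t i) a \<in> P" if "a \<in> P" for i a using M t that unfolding module_on_def by blast
  have s': "\<And>a. a \<in> P \<Longrightarrow> s a \<in> free_carrier G" "\<And>a b. a \<in> P \<Longrightarrow> b \<in> P \<Longrightarrow> s (a + b) = s a + s b"
    "\<And>i a. a \<in> P \<Longrightarrow> s (act (t i) a) = free_act G (t i) (s a)"
    using s t unfolding hom_on_def by blast+
  have r': "\<And>a. a \<in> free_carrier G \<Longrightarrow> r a \<in> P"
    "\<And>a b. a \<in> free_carrier G \<Longrightarrow> b \<in> free_carrier G \<Longrightarrow> r (a + b) = r a + r b"
    "\<And>i a. a \<in> free_carrier G \<Longrightarrow> r (free_act G (t i) a) = act (t i) (r a)"
    using r t unfolding hom_on_def by blast+
  have s_diff: "s (a - b) = s a - s b" if "a \<in> P" "b \<in> P" for a b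
    by (rule additive_on_diff[OF ce_zero[OF ceP] ce_neg[OF ceP] s'(2) that])
  have r_diff: "r (a - b) = r a - r b" if "a \<in> free_carrier G" "b \<in> free_carrier G" for a b
    by (rule additive_on_diff[OF ce_zero[OF ce_free] ce_neg[OF ce_free] r'(2) that])
  have s_x: "s (act (t i) a - a) = free_act G (t i) (s a) - s a" if "a \<in> P" for i a
    unfolding s_diff[OF actP[OF that] that] s'(3)[OF that] ..
  have r_x: "r (free_act G (t i) a - a) = act (t i) (r a) - r a" if "a \<in> free_carrier G" for i a
    unfolding r_diff[OF free_act_cl[OF t(1) that] that] r'(3)[OF that] ..
  have rs': "\<And>a. a \<in> P \<Longrightarrow> r (s a) = a" using rs by blast
  show ?thesis
    by (rule regular_seq_retract[where s = s and r = r,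
          OF ceP ce_free s'(1,2) s_x r'(1,2) r_x rs' regular_free[OF assms(2)]])
qed

text \<open>The class that starts the induction is that of an element p of augmentation one: each
  (t_i - 1) p has augmentation zero and is a boundary, while p is not. The condition on powers says
  that t_0, ..., t_{m-1} generate a free abelian group of rank m.\<close>

theorem cd_bounds_rank:
  assumes "proj_resolution G n P act d eps" "\<And>j (k::nat). j < m \<Longrightarrow> k > 0 \<Longrightarrow> t j [^] k \<notin> L j"
  shows "m \<le> n"
proof -
  have d': "\<And>k. k \<in> {1..n} \<Longrightarrow> hom_on G (P k) (act k) (P (k - 1)) (act (k - 1)) (d k)"
    using assms(1) unfolding proj_resolution_def by blast
  have d: "hom_on G (P (Suc k)) (act (Suc k)) (P k) (act k) (d (Suc k))" if "k < n" for k
    using d'[of "Suc k"] that by simp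
  have proj: "\<And>k. k \<le> n \<Longrightarrow> projective_on G (P k) (act k)"
    and eps: "hom_on G (P 0) (act 0) (UNIV :: int set) (\<lambda>_ z. z) eps" "eps ` P 0 = UNIV"
    and ex: "\<And>k. k \<in> {1..<n} \<Longrightarrow> {x\<in>P k. d k x = 0} = d (k + 1) ` P (k + 1)"
    and ex0: "n = 0 \<Longrightarrow> inj_on eps (P 0)" "0 < n \<Longrightarrow> {x\<in>P 0. eps x = 0} = d 1 ` P 1 \<and> inj_on (d n) (P n)"
    using assms(1) unfolding proj_resolution_def by (simp_all add: Ball_def)
  have M: "module_on G (P k) (act k)" if "k \<le> n" for k using proj[OF that] unfolding projective_on_def by blast
  define x where "x k i a = act k (t i) a - a" for k i a
  have ce: "comm_endos (x k) (P k)" if "k \<le> n" for k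
    using comm_endos_module[OF M[OF that] t] unfolding x_def .
  have reg: "regular_seq m (x k) (P k)" if "k \<le> n" for k
    using regular_projective[OF proj[OF that] assms(2)] unfolding x_def .
  have actP: "act k (t i) a \<in> P k" if "k \<le> n" "a \<in> P k" for k i a
    using M[OF that(1)] t that unfolding module_on_def by blast
  define D where "D k = (if k < n then d (Suc k) ` P (Suc k) else {0})" for k
  have dP: "d (Suc k) a \<in> P k" and d_act: "d (Suc k) (act (Suc k) (t i) a) = act k (t i) (d (Suc k) a)"
    if "k < n" "a \<in> P (Suc k)" for k a i using d[OF that(1)] that t unfolding hom_on_def by blast+
  have d_add: "d (Suc k) (a + b) = d (Suc k) a + d (Suc k) b" if "k < n" "a \<in> P (Suc k)" "b \<in> P (Suc k)" for k a b
    using d[OF that(1)] that unfolding hom_on_def by blast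
  have d0: "d (Suc k) 0 = 0" if "k < n" for k
    by (rule additive_on_zero[of "P (Suc k)"]) (use that d_add ce_zero[OF ce] in auto)
  have d_x: "d (Suc k) (x (Suc k) i a) = x k i (d (Suc k) a)" if "k < n" "a \<in> P (Suc k)" for k i a
  proof -
    have c: "comm_endos (x (Suc k)) (P (Suc k))" using ce that by simp
    have "d (Suc k) (act (Suc k) (t i) a + - a) = d (Suc k) (act (Suc k) (t i) a) + - d (Suc k) a"
      using d_add[OF that(1), of "act (Suc k) (t i) a" "- a"] actP[of "Suc k" a i] that ce_neg[OF c]
        additive_on_minus[of "P (Suc k)" "d (Suc k)" a] ce_zero[OF c] d_add by simp
    then show ?thesis using d_act[OF that] by (simp add: x_def)
  qed
  have eps_add: "eps (a + b) = eps a + eps b" and eps_act: "eps (act 0 (t i) a) = eps a"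
    if "a \<in> P 0" "b \<in> P 0" for a b i using eps(1) that t unfolding hom_on_def by blast+
  have eps0: "eps 0 = 0" by (rule additive_on_zero[of "P 0"]) (use eps_add ce_zero[OF ce] in auto)
  \<comment> \<open>For n = 0 there are no boundaries: \<open>D 0\<close> is {0} and exactness means
    that \<open>eps\<close> is injective.\<close>
  have ker0: "{a \<in> P 0. eps a = 0} = D 0"
  proof (cases "n = 0")
    case True
    have "a = 0" if "a \<in> P 0" "eps a = 0" for a
      using inj_onD[OF ex0(1)[OF True], of a 0] eps0 ce_zero[OF ce, of 0] that by simp
    then show ?thesis using True eps0 ce_zero[OF ce, of 0] by (auto simp: D_def)
  next
    case False
    then show ?thesis using ex0(2) by (simp add: D_def)
  qed
  have exact: "{a \<in> P (Suc k). d (Suc k) a = 0} = D (Suc k)" if "k < n" for k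
  proof (cases "Suc k < n")
    case True
    then show ?thesis using ex[of "Suc k"] by (simp add: D_def)
  next
    case False
    then have "Suc k = n" using that by simp
    have "a = 0" if "a \<in> P (Suc k)" "d (Suc k) a = 0" for a
      using inj_onD[of "d n" "P n" a 0] ex0(2) d0[OF \<open>k < n\<close>] ce_zero[OF ce, of n] that \<open>Suc k = n\<close> by auto
    then show ?thesis using d0[OF that] ce_zero[OF ce, of n] \<open>Suc k = n\<close> by (auto simp: D_def)
  qed
  obtain p where p: "p \<in> P 0" "eps p = 1" using eps(2) by (metis UNIV_I imageE)
  have "x 0 i p \<in> D 0" for i
  proof -
    have "eps (act 0 (t i) p + - p) = 0"
      using eps_add[of "act 0 (t i) p" "- p"] actP[of 0 p i] ce_neg[OF ce, of 0 p] p eps_act[OF p(1) p(1)]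
        additive_on_minus[of "P 0" eps p] ce_zero[OF ce, of 0] ce_neg[OF ce, of 0] eps_add by simp
    then show ?thesis using ker0 ce_cl[OF ce, of 0 p i] p by (auto simp: x_def)
  qed
  moreover have "p \<notin> D 0" using p(2) unfolding ker0[symmetric] by simp
  ultimately show ?thesis
    using regular_resolution_length[of n x P m d D p] ce reg dP d_add d_x D_def exact p by blast
qed

end

end

section \<open>A criterion for virtually abelian groups\<close>

context group
begin

definition commutant :: "'a set \<Rightarrow> 'a set" where
  "commutant S = {g \<in> carrier G. \<forall>s\<in>S. g \<otimes> s = s \<otimes> g}"

text \<open>A transversal replaces the set of cosets, so that K may be a subgroup not contained in
  S, such as the centralizer of some elements of a layer.\<close>

definition finite_index_in :: "'a set \<Rightarrow> 'a set \<Rightarrow> bool" where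
  "finite_index_in K S \<longleftrightarrow> (\<exists>F. finite F \<and> F \<subseteq> S \<and> (\<forall>g\<in>S. \<exists>f\<in>F. g \<otimes> inv f \<in> K))"

lemma finite_index_in_fibres:
  assumes "finite (\<kappa> ` S)" "\<And>g f. g \<in> S \<Longrightarrow> f \<in> S \<Longrightarrow> \<kappa> g = \<kappa> f \<Longrightarrow> g \<otimes> inv f \<in> K"
  shows "finite_index_in K S"
proof -
  define r where "r c = (SOME g. g \<in> S \<and> \<kappa> g = c)" for c
  have r: "r (\<kappa> g) \<in> S \<and> \<kappa> (r (\<kappa> g)) = \<kappa> g" if "g \<in> S" for g
    unfolding r_def by (rule someI[of _ g]) (use that in simp)
  have "\<exists>f\<in>r ` \<kappa> ` S. g \<otimes> inv f \<in> K" if "g \<in> S" for g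
    using assms(2)[OF that] r[OF that] that by fastforce
  then show ?thesis unfolding finite_index_in_def using assms(1) r by (intro exI[of _ "r ` \<kappa> ` S"]) auto
qed

lemma commutant_subgroup:
  assumes "S \<subseteq> carrier G"
  shows "subgroup (commutant S) G"
proof (rule subgroupI)
  show "commutant S \<subseteq> carrier G" by (auto simp: commutant_def)
  have "\<one> \<in> commutant S" using assms by (auto simp: commutant_def)
  then show "commutant S \<noteq> {}" by blast
next
  fix a assume a: "a \<in> commutant S"
  have "inv a \<otimes> s = s \<otimes> inv a" if "s \<in> S" for s
  proof -
    have c: "a \<in> carrier G" "s \<in> carrier G" "a \<otimes> s = s \<otimes> a" using a that assms by (auto simp: commutant_def)
    then have "s = inv a \<otimes> (s \<otimes> a)" by (metis inv_solve_left m_closed)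
    then show ?thesis using c by (metis inv_closed inv_solve_right m_assoc m_closed)
  qed
  then show "inv a \<in> commutant S" using a by (auto simp: commutant_def)
next
  fix a b assume ab: "a \<in> commutant S" "b \<in> commutant S"
  have "a \<otimes> b \<otimes> s = s \<otimes> (a \<otimes> b)" if "s \<in> S" for s
  proof -
    have c: "a \<in> carrier G" "b \<in> carrier G" "s \<in> carrier G" "a \<otimes> s = s \<otimes> a" "b \<otimes> s = s \<otimes> b"
      using ab that assms by (auto simp: commutant_def)
    then show ?thesis by (metis m_assoc)
  qed
  then show "a \<otimes> b \<in> commutant S" using ab by (auto simp: commutant_def)
qed

lemma commutator_cancel:
  assumes "x \<in> carrier G" "y \<in> carrier G"
  shows "x \<otimes> y \<otimes> inv x \<otimes> inv y \<otimes> y = x \<otimes> y \<otimes> inv x" "x \<otimes> y \<otimes> inv x \<otimes> x = x \<otimes> y"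
  using assms by (simp_all add: m_assoc)

lemma commutator_eq_one_iff:
  assumes "x \<in> carrier G" "y \<in> carrier G"
  shows "x \<otimes> y \<otimes> inv x \<otimes> inv y = \<one> \<longleftrightarrow> x \<otimes> y = y \<otimes> x"
proof
  assume "x \<otimes> y \<otimes> inv x \<otimes> inv y = \<one>"
  then have "x \<otimes> y \<otimes> inv x = y" using commutator_cancel(1)[OF assms] assms by simp
  then show "x \<otimes> y = y \<otimes> x" using commutator_cancel(2)[OF assms] by simp
next
  assume "x \<otimes> y = y \<otimes> x"
  then show "x \<otimes> y \<otimes> inv x \<otimes> inv y = \<one>" using assms by (simp add: m_assoc)
qed

lemma inv_mult_cancel:
  assumes "a \<in> carrier G" "b \<in> carrier G"
  shows "inv a \<otimes> (a \<otimes> b) = b" "a \<otimes> (inv a \<otimes> b) = b"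
  using assms by (simp_all add: m_assoc[symmetric])

lemma conj_mult:
  assumes "h \<in> carrier G" "a \<in> carrier G" "b \<in> carrier G"
  shows "h \<otimes> (a \<otimes> b) \<otimes> inv h = (h \<otimes> a \<otimes> inv h) \<otimes> (h \<otimes> b \<otimes> inv h)"
  using assms by (simp add: m_assoc inv_mult_cancel)

lemma conj_inv:
  assumes "h \<in> carrier G" "a \<in> carrier G"
  shows "h \<otimes> inv a \<otimes> inv h = inv (h \<otimes> a \<otimes> inv h)"
  using assms by (simp add: inv_mult_group m_assoc)

lemma conj_generate:
  assumes "S \<subseteq> carrier G" "h \<in> carrier G" "\<And>s. s \<in> S \<Longrightarrow> h \<otimes> s \<otimes> inv h \<in> generate G S" "x \<in> generate G S"
  shows "h \<otimes> x \<otimes> inv h \<in> generate G S"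
  using assms(4)
proof (induction rule: generate.induct)
  case one
  then show ?case using assms(2) generate.one by simp
next
  case (incl s)
  then show ?case using assms(3) by blast
next
  case (inv s)
  have "h \<otimes> inv s \<otimes> inv h = inv (h \<otimes> s \<otimes> inv h)"
    using inv assms(1,2) by (simp add: inv_mult_group m_assoc subset_iff)
  then show ?case using assms(3)[OF inv] generate_m_inv_closed[OF assms(1)] by simp
next
  case (eng a b)
  have ab: "a \<in> carrier G" "b \<in> carrier G" using eng generate_in_carrier[OF assms(1)] by auto
  then have "h \<otimes> (a \<otimes> b) \<otimes> inv h = (h \<otimes> a \<otimes> inv h) \<otimes> (h \<otimes> b \<otimes> inv h)"
    using assms(2) conj_mult by blast
  then show ?case using eng generate.eng by metis
qed

lemma conj_derived:
  assumes "S \<subseteq> carrier G" "h \<in> carrier G" "\<And>s. s \<in> S \<Longrightarrow> h \<otimes> s \<otimes> inv h \<in> S" "x \<in> derived G S"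
  shows "h \<otimes> x \<otimes> inv h \<in> derived G S"
  unfolding derived_def
proof (rule conj_generate)
  fix s assume "s \<in> derived_set G S"
  then obtain a b where ab: "a \<in> S" "b \<in> S" "s = a \<otimes> b \<otimes> inv a \<otimes> inv b" by auto
  have c: "a \<in> carrier G" "b \<in> carrier G" using ab assms by auto
  have "h \<otimes> s \<otimes> inv h = (h \<otimes> a \<otimes> inv h) \<otimes> (h \<otimes> b \<otimes> inv h) \<otimes> inv (h \<otimes> a \<otimes> inv h) \<otimes> inv (h \<otimes> b \<otimes> inv h)"
    unfolding ab(3) using c assms(2) conj_mult[of h "a \<otimes> b \<otimes> inv a" "inv b"]
      conj_mult[of h "a \<otimes> b" "inv a"] conj_mult[of h a b] conj_inv[of h a] conj_inv[of h b] by simp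
  then show "h \<otimes> s \<otimes> inv h \<in> generate G (derived_set G S)"
    using assms(3)[OF ab(1)] assms(3)[OF ab(2)] generate.incl[of _ "derived_set G S"] by auto
qed (use assms derived_set_in_carrier in \<open>auto simp: derived_def\<close>)

lemma conj_exp_of_derived:
  assumes "S \<subseteq> carrier G" "h \<in> carrier G" "\<And>s. s \<in> S \<Longrightarrow> h \<otimes> s \<otimes> inv h \<in> S" "x \<in> (derived G ^^ n) S"
  shows "h \<otimes> x \<otimes> inv h \<in> (derived G ^^ n) S"
  using assms(4)
proof (induction n arbitrary: x)
  case (Suc n)
  then show ?case
    using conj_derived[of "(derived G ^^ n) S" h x] exp_of_derived_in_carrier[OF assms(1)] assms(2) by auto
qed (use assms in simp)

text \<open>The layer is cut out by the last term of the derived series of H whose intersection with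
  C is not contained in D; commutators of its elements lie in the next term and hence in D. It is
  applied with D a center and with D a maximal abelian normal subgroup.\<close>

lemma solvable_layer:
  assumes H: "subgroup H G" "(derived G ^^ n) H = {\<one>}"
    and C: "subgroup C G" and D: "\<one> \<in> D" "\<not> H \<inter> C \<subseteq> D"
  obtains M where "subgroup M G" "M \<subseteq> H \<inter> C" "\<not> M \<subseteq> D"
    "\<And>x y. x \<in> M \<Longrightarrow> y \<in> M \<Longrightarrow> x \<otimes> y \<otimes> inv x \<otimes> inv y \<in> D"
    "\<And>h x. h \<in> H \<Longrightarrow> (\<And>c. c \<in> C \<Longrightarrow> h \<otimes> c \<otimes> inv h \<in> C) \<Longrightarrow> x \<in> M \<Longrightarrow> h \<otimes> x \<otimes> inv h \<in> M"
proof -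
  define E where "E i = (derived G ^^ i) H \<inter> C" for i
  define k where "k = (LEAST i. E i \<subseteq> D)"
  have Hc: "H \<subseteq> carrier G" using subgroup.subset[OF H(1)] .
  have sub: "subgroup ((derived G ^^ i) H) G" for i
    using exp_of_derived_is_subgroup[OF H(1)] .
  have dec: "(derived G ^^ i) H \<subseteq> H" for i
  proof (induction i)
    case (Suc i)
    then show ?case using derived_incl[OF order_refl sub[of i]] by auto
  qed simp
  have "E n \<subseteq> D" using H(2) D by (auto simp: E_def)
  then have k: "E k \<subseteq> D" unfolding k_def by (rule LeastI)
  have "k \<noteq> 0" using k D by (auto simp: E_def)
  then obtain i where i: "k = Suc i" by (cases k) auto
  have "\<not> E i \<subseteq> D" using not_less_Least[of i "\<lambda>i. E i \<subseteq> D"] i unfolding k_def by simp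
  moreover have "subgroup (E i) G" unfolding E_def using subgroups_Inter_pair[OF sub C] .
  moreover have "E i \<subseteq> H \<inter> C" using dec by (auto simp: E_def)
  moreover have "x \<otimes> y \<otimes> inv x \<otimes> inv y \<in> D" if "x \<in> E i" "y \<in> E i" for x y
  proof -
    have "x \<otimes> y \<otimes> inv x \<otimes> inv y \<in> (derived G ^^ k) H"
      using that i by (auto simp: E_def derived_def intro!: generate.incl)
    moreover have "x \<otimes> y \<otimes> inv x \<otimes> inv y \<in> C"
      using that subgroup.m_closed[OF C] subgroup.m_inv_closed[OF C] by (auto simp: E_def)
    ultimately show ?thesis using k by (auto simp: E_def)
  qed
  moreover have "h \<otimes> x \<otimes> inv h \<in> E i"
    if "h \<in> H" "\<And>c. c \<in> C \<Longrightarrow> h \<otimes> c \<otimes> inv h \<in> C" "x \<in> E i" for h x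
    using that conj_exp_of_derived[OF Hc, of h x i] Hc subgroup.m_closed[OF H(1)] subgroup.m_inv_closed[OF H(1)]
    by (auto simp: E_def)
  ultimately show thesis using that by blast
qed

definition conj_class :: "'a set \<Rightarrow> 'a \<Rightarrow> 'a set" where
  "conj_class S x = (\<lambda>g. inv g \<otimes> x \<otimes> g) ` S"

text \<open>An element of T is classified by the tuple of conjugates it produces from the members of
  S. Finitely many tuples occur, and elements with the same tuple differ by something that commutes
  with S.\<close>

lemma finite_index_commutant:
  assumes "finite S" "S \<subseteq> carrier G" "T \<subseteq> carrier G" "\<And>s. s \<in> S \<Longrightarrow> finite (conj_class T s)"
  shows "finite_index_in (commutant S) T"
proof (rule finite_index_in_fibres[where \<kappa> = "\<lambda>g. restrict (\<lambda>s. inv g \<otimes> s \<otimes> g) S"])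
  have "(\<lambda>g. restrict (\<lambda>s. inv g \<otimes> s \<otimes> g) S) ` T \<subseteq> (\<Pi>\<^sub>E s\<in>S. conj_class T s)"
    by (auto simp: conj_class_def)
  then show "finite ((\<lambda>g. restrict (\<lambda>s. inv g \<otimes> s \<otimes> g) S) ` T)"
    by (rule finite_subset) (use assms finite_PiE in blast)
next
  fix g f assume gf: "g \<in> T" "f \<in> T"
    "restrict (\<lambda>s. inv g \<otimes> s \<otimes> g) S = restrict (\<lambda>s. inv f \<otimes> s \<otimes> f) S"
  have c: "g \<in> carrier G" "f \<in> carrier G" using gf assms by auto
  have "g \<otimes> inv f \<otimes> s = s \<otimes> (g \<otimes> inv f)" if s: "s \<in> S" for s
  proof -
    have sc: "s \<in> carrier G" using s assms by auto
    have "inv g \<otimes> s \<otimes> g = inv f \<otimes> s \<otimes> f" using fun_cong[OF gf(3), of s] s by simp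
    then have "g \<otimes> (inv g \<otimes> s \<otimes> g) \<otimes> inv f = g \<otimes> (inv f \<otimes> s \<otimes> f) \<otimes> inv f" by simp
    moreover have "g \<otimes> (inv g \<otimes> s \<otimes> g) \<otimes> inv f = s \<otimes> (g \<otimes> inv f)"
      using c sc by (simp add: m_assoc[symmetric])
    moreover have "g \<otimes> (inv f \<otimes> s \<otimes> f) \<otimes> inv f = g \<otimes> inv f \<otimes> s"
      using c sc by (simp add: m_assoc)
    ultimately show ?thesis by simp
  qed
  then show "g \<otimes> inv f \<in> commutant S" using c by (auto simp: commutant_def)
qed

text \<open>Let \<open>K\<close> be the centralizer of the elements with finite conjugacy class. If \<open>K\<close> were not
  abelian, a layer \<open>M\<close> of its derived series that is central-by-abelian but not central would
  consist of elements with finite conjugacy class, which are central in \<open>K\<close>.\<close>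

theorem solvable_virtually_abelian_criterion:
  assumes sol: "solvable G"
    and dcc: "\<And>S. S \<subseteq> carrier G \<Longrightarrow> \<exists>S0\<subseteq>S. finite S0 \<and> commutant S0 \<subseteq> commutant S"
    and cc: "\<And>x X. x \<in> carrier G \<Longrightarrow> X \<subseteq> conj_class (carrier G) x \<Longrightarrow>
      (\<forall>y\<in>X. \<forall>z\<in>X. y \<otimes> z = z \<otimes> y) \<Longrightarrow> finite X"
  shows "\<exists>K. subgroup K G \<and> finite_index_in K (carrier G) \<and> (\<forall>x\<in>K. \<forall>y\<in>K. x \<otimes> y = y \<otimes> x)"
proof -
  \<comment> \<open>F is the FC-center. By the chain condition its centralizer K is already the
    centralizer of finitely many elements with finite conjugacy classes, hence of finite
    index.\<close>
  define F where "F = {x \<in> carrier G. finite (conj_class (carrier G) x)}"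
  define K where "K = commutant F"
  have Fc: "F \<subseteq> carrier G" by (auto simp: F_def)
  have K: "subgroup K G" unfolding K_def by (rule commutant_subgroup[OF Fc])
  have Kc: "K \<subseteq> carrier G" by (rule subgroup.subset[OF K])
  obtain S0 where S0: "S0 \<subseteq> F" "finite S0" "commutant S0 \<subseteq> K" using dcc[OF Fc] by (auto simp: K_def)
  have "finite_index_in (commutant S0) (carrier G)"
    by (rule finite_index_commutant) (use S0 Fc in \<open>auto simp: F_def\<close>)
  then obtain R where R: "finite R" "R \<subseteq> carrier G" "\<And>g. g \<in> carrier G \<Longrightarrow> \<exists>f\<in>R. g \<otimes> inv f \<in> K"
    unfolding finite_index_in_def using S0(3) by (metis subsetD)
  have fi: "finite_index_in K (carrier G)"
    unfolding finite_index_in_def by (intro exI[of _ R] conjI ballI R)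
  define Z where "Z = K \<inter> commutant K"
  \<comment> \<open>As K has finite index, a finite K-class gives a finite class in the whole group.
    Then x is in F and commutes with K, the centralizer of F.\<close>
  have central: "x \<in> Z" if x: "x \<in> K" and fin: "finite (conj_class K x)" for x
  proof -
    have xc: "x \<in> carrier G" using x Kc by blast
    have "conj_class (carrier G) x \<subseteq> (\<Union>f\<in>R. (\<lambda>y. inv f \<otimes> y \<otimes> f) ` conj_class K x)"
    proof
      fix y assume "y \<in> conj_class (carrier G) x"
      then obtain g where g: "g \<in> carrier G" "y = inv g \<otimes> x \<otimes> g" by (auto simp: conj_class_def)
      then obtain f where f: "f \<in> R" "g \<otimes> inv f \<in> K" using R(3) by blast
      have fc: "f \<in> carrier G" using f R by blast
      have "inv (g \<otimes> inv f) = f \<otimes> inv g" using g(1) fc by (simp add: inv_mult_group)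
      moreover have "inv f \<otimes> (f \<otimes> inv g \<otimes> x \<otimes> (g \<otimes> inv f)) \<otimes> f = inv g \<otimes> x \<otimes> g"
        using g(1) fc xc by (simp add: m_assoc inv_mult_cancel)
      ultimately have "y = inv f \<otimes> (inv (g \<otimes> inv f) \<otimes> x \<otimes> (g \<otimes> inv f)) \<otimes> f"
        using g(2) by simp
      then show "y \<in> (\<Union>f\<in>R. (\<lambda>y. inv f \<otimes> y \<otimes> f) ` conj_class K x)" using f by (auto simp: conj_class_def)
    qed
    then have "finite (conj_class (carrier G) x)" by (rule finite_subset) (use R fin in auto)
    then have "x \<in> F" using xc by (simp add: F_def)
    then have "x \<in> commutant K" using xc by (auto simp: K_def commutant_def)
    then show ?thesis using x by (simp add: Z_def)
  qed
  have "K \<subseteq> Z"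
  proof (rule ccontr)
    assume nab: "\<not> K \<subseteq> Z"
    obtain n where "(derived G ^^ n) (carrier G) = {\<one>}" using sol solvable_iff_trivial_derived_seq by auto
    then have "(derived G ^^ n) K \<subseteq> {\<one>}" using mono_exp_of_derived[OF Kc, of n] by simp
    then have dK: "(derived G ^^ n) K = {\<one>}"
      using subgroup.one_closed[OF exp_of_derived_is_subgroup[OF K, of n]] by blast
    have Z1: "\<one> \<in> Z" using subgroup.one_closed[OF K] Kc by (auto simp: Z_def commutant_def)
    obtain M where M: "subgroup M G" "M \<subseteq> K" "\<not> M \<subseteq> Z"
      "\<And>x y. x \<in> M \<Longrightarrow> y \<in> M \<Longrightarrow> x \<otimes> y \<otimes> inv x \<otimes> inv y \<in> Z"
      "\<And>h x. h \<in> K \<Longrightarrow> x \<in> M \<Longrightarrow> h \<otimes> x \<otimes> inv h \<in> M"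
    proof (rule solvable_layer[OF K dK K Z1])
      fix M assume a: "subgroup M G" "M \<subseteq> K \<inter> K" "\<not> M \<subseteq> Z"
        "\<And>x y. x \<in> M \<Longrightarrow> y \<in> M \<Longrightarrow> x \<otimes> y \<otimes> inv x \<otimes> inv y \<in> Z"
        "\<And>h x. h \<in> K \<Longrightarrow> (\<And>c. c \<in> K \<Longrightarrow> h \<otimes> c \<otimes> inv h \<in> K) \<Longrightarrow> x \<in> M \<Longrightarrow> h \<otimes> x \<otimes> inv h \<in> M"
      have "h \<otimes> c \<otimes> inv h \<in> K" if "h \<in> K" "c \<in> K" for h c
        using that subgroup.m_closed[OF K] subgroup.m_inv_closed[OF K] by simp
      then show thesis using a(2) by (intro that[OF a(1) _ a(3,4,5)]) auto
    qed (use nab in auto)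
    have Mc: "M \<subseteq> carrier G" using subgroup.subset[OF M(1)] .
    have Zcomm: "z \<otimes> x = x \<otimes> z" if "z \<in> Z" "x \<in> K" for z x using that by (auto simp: Z_def commutant_def)
    have Zsub: "subgroup Z G" unfolding Z_def using subgroups_Inter_pair[OF K commutant_subgroup[OF Kc]] .
    \<comment> \<open>Elements of one coset of the center Z commute; this is the source of the
      commuting sets of conjugates to which \<open>cc\<close> is applied.\<close>
    have coset_comm: "(x \<otimes> z) \<otimes> (x \<otimes> z') = (x \<otimes> z') \<otimes> (x \<otimes> z)"
      if "x \<in> K" "z \<in> Z" "z' \<in> Z" for x z z'
    proof -
      have c: "x \<in> carrier G" "z \<in> carrier G" "z' \<in> carrier G"
        using that Kc subgroup.subset[OF Zsub] by auto
      have "(x \<otimes> z) \<otimes> (x \<otimes> z') = x \<otimes> (z \<otimes> x) \<otimes> z'" using c by (simp add: m_assoc)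
      also have "\<dots> = x \<otimes> x \<otimes> (z \<otimes> z')" using c Zcomm[OF that(2,1)] by (simp add: m_assoc)
      also have "z \<otimes> z' = z' \<otimes> z" using Zcomm[OF that(2)] that(3) by (auto simp: Z_def)
      also have "x \<otimes> x \<otimes> (z' \<otimes> z) = x \<otimes> (z' \<otimes> x) \<otimes> z" using c Zcomm[OF that(3,1)] by (simp add: m_assoc)
      also have "\<dots> = (x \<otimes> z') \<otimes> (x \<otimes> z)" using c by (simp add: m_assoc)
      finally show ?thesis .
    qed
    \<comment> \<open>Commutators of M lie in Z, so all M-conjugates of x lie in the single coset x
      Z.\<close>
    have finM: "finite (conj_class M x)" if x: "x \<in> M" for x
    proof (rule cc)
      show "x \<in> carrier G" using x Mc by blast
      show "conj_class M x \<subseteq> conj_class (carrier G) x" using Mc by (auto simp: conj_class_def)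
      have "\<exists>z\<in>Z. y = x \<otimes> z" if y: "y \<in> conj_class M x" for y
      proof -
        obtain m where m: "m \<in> M" "y = inv m \<otimes> x \<otimes> m" using y by (auto simp: conj_class_def)
        have "inv x \<otimes> inv m \<otimes> inv (inv x) \<otimes> inv (inv m) \<in> Z"
          using M(4) x m subgroup.m_inv_closed[OF M(1)] by blast
        then have "inv x \<otimes> (inv m \<otimes> x \<otimes> m) \<in> Z" using m x Mc by (simp add: m_assoc subset_iff)
        moreover have "y = x \<otimes> (inv x \<otimes> (inv m \<otimes> x \<otimes> m))"
          using m x Mc by (simp add: m_assoc[symmetric] subset_iff)
        ultimately show ?thesis by blast
      qed
      then show "\<forall>y\<in>conj_class M x. \<forall>z\<in>conj_class M x. y \<otimes> z = z \<otimes> y"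
        using coset_comm x M(2) by (metis subsetD)
    qed
    obtain S1 where S1: "S1 \<subseteq> M" "finite S1" "commutant S1 \<subseteq> commutant M" using dcc[OF Mc] by blast
    have "finite_index_in (commutant S1) M"
      by (rule finite_index_commutant) (use S1 Mc finM in auto)
    then obtain R' where R': "finite R'" "R' \<subseteq> M" "\<And>g. g \<in> M \<Longrightarrow> \<exists>f\<in>R'. g \<otimes> inv f \<in> commutant M"
      unfolding finite_index_in_def using S1(3) by (metis subsetD)
    \<comment> \<open>M is normalized by K, hence the K-conjugates of an element of the center of M
      stay in that center and commute.\<close>
    have cMZ: "x \<in> Z" if x: "x \<in> M" "x \<in> commutant M" for x
    proof (rule central)
      show xK: "x \<in> K" using x M by blast
      have inM: "y \<in> M" if y: "y \<in> conj_class K x" for y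
      proof -
        obtain g where g: "g \<in> K" "y = inv g \<otimes> x \<otimes> g" using y by (auto simp: conj_class_def)
        then show ?thesis using M(5)[OF subgroup.m_inv_closed[OF K g(1)] x(1)] Kc by auto
      qed
      have inC: "y \<in> commutant M" if y: "y \<in> conj_class K x" for y
      proof -
        obtain g where g: "g \<in> K" "y = inv g \<otimes> x \<otimes> g" using y by (auto simp: conj_class_def)
        have c: "g \<in> carrier G" "x \<in> carrier G" using g x Kc Mc by auto
        have "y \<otimes> m = m \<otimes> y" if m: "m \<in> M" for m
        proof -
          have mc: "m \<in> carrier G" using m Mc by blast
          have "x \<otimes> (g \<otimes> m \<otimes> inv g) = (g \<otimes> m \<otimes> inv g) \<otimes> x"
            using x(2) M(5)[OF g(1) m] by (auto simp: commutant_def)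
          then have "inv g \<otimes> (x \<otimes> (g \<otimes> m \<otimes> inv g)) \<otimes> g = inv g \<otimes> ((g \<otimes> m \<otimes> inv g) \<otimes> x) \<otimes> g" by simp
          moreover have "inv g \<otimes> (x \<otimes> (g \<otimes> m \<otimes> inv g)) \<otimes> g = y \<otimes> m"
            using g(2) c mc by (simp add: m_assoc)
          moreover have "inv g \<otimes> ((g \<otimes> m \<otimes> inv g) \<otimes> x) \<otimes> g = m \<otimes> y"
            using g(2) c mc by (simp add: m_assoc[symmetric])
          ultimately show ?thesis by simp
        qed
        then show ?thesis using g c by (auto simp: commutant_def)
      qed
      show "finite (conj_class K x)"
      proof (rule cc)
        show "x \<in> carrier G" using x Mc by blast
        show "conj_class K x \<subseteq> conj_class (carrier G) x" using Kc by (auto simp: conj_class_def)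
        show "\<forall>y\<in>conj_class K x. \<forall>z\<in>conj_class K x. y \<otimes> z = z \<otimes> y"
          using inM inC by (auto simp: commutant_def)
      qed
    qed
    \<comment> \<open>M is finite modulo its center, and this center lies in Z; so finitely many
      cosets of Z cover M.\<close>
    have Mcov: "\<exists>f\<in>R'. \<exists>z\<in>Z. y = f \<otimes> z" if y: "y \<in> M" for y
    proof -
      obtain f where f: "f \<in> R'" "y \<otimes> inv f \<in> commutant M" using R'(3)[OF y] by blast
      have fM: "f \<in> M" using f R' by blast
      then have "y \<otimes> inv f \<in> M" using y subgroup.m_closed[OF M(1)] subgroup.m_inv_closed[OF M(1)] by blast
      then have z: "y \<otimes> inv f \<in> Z" using cMZ f by blast
      have "y = (y \<otimes> inv f) \<otimes> f" using y fM Mc by (simp add: m_assoc subset_iff)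
      also have "\<dots> = f \<otimes> (y \<otimes> inv f)" using Zcomm[OF z] fM M(2) by blast
      finally show ?thesis using f z by blast
    qed
    \<comment> \<open>A K-class inside M now splits into finitely many commuting pieces, one for
      each coset of Z.\<close>
    have "x \<in> Z" if x: "x \<in> M" for x
    proof (rule central)
      show "x \<in> K" using x M by blast
      have inM: "conj_class K x \<subseteq> M"
      proof
        fix y assume "y \<in> conj_class K x"
        then obtain g where g: "g \<in> K" "y = inv g \<otimes> x \<otimes> g" by (auto simp: conj_class_def)
        then show "y \<in> M" using M(5)[OF subgroup.m_inv_closed[OF K g(1)] x(1)] Kc by auto
      qed
      have "conj_class K x \<subseteq> (\<Union>f\<in>R'. conj_class K x \<inter> (\<lambda>z. f \<otimes> z) ` Z)"
      proof
        fix y assume y: "y \<in> conj_class K x"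
        obtain f z where "f \<in> R'" "z \<in> Z" "y = f \<otimes> z" using Mcov inM y by (metis subsetD)
        then show "y \<in> (\<Union>f\<in>R'. conj_class K x \<inter> (\<lambda>z. f \<otimes> z) ` Z)" using y by auto
      qed
      moreover have "finite (conj_class K x \<inter> (\<lambda>z. f \<otimes> z) ` Z)" if "f \<in> R'" for f
      proof (rule cc)
        show "x \<in> carrier G" using x Mc by blast
        show "conj_class K x \<inter> (\<lambda>z. f \<otimes> z) ` Z \<subseteq> conj_class (carrier G) x" using Kc by (auto simp: conj_class_def)
        show "\<forall>y\<in>conj_class K x \<inter> (\<lambda>z. f \<otimes> z) ` Z. \<forall>z\<in>conj_class K x \<inter> (\<lambda>z. f \<otimes> z) ` Z. y \<otimes> z = z \<otimes> y"
          using coset_comm that R'(2) M(2) by auto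
      qed
      ultimately show "finite (conj_class K x)" using R'(1) finite_subset by blast
    qed
    then show False using M(3) by blast
  qed
  then have "\<forall>x\<in>K. \<forall>y\<in>K. x \<otimes> y = y \<otimes> x" by (auto simp: Z_def commutant_def)
  then show ?thesis using K fi by blast
qed

end

section \<open>Solvable groups of matrices\<close>

text \<open>The leading positions of the members of U; for a linear subspace their number is its
  dimension. With \<open>co\<close> reading off coordinates, dimension arguments work for matrices
  and vectors alike without choosing bases.\<close>

definition pivots :: "nat \<Rightarrow> (nat \<Rightarrow> 'v \<Rightarrow> 'a::field) \<Rightarrow> 'v set \<Rightarrow> nat set" where
  "pivots N co U = {k. k < N \<and> (\<exists>u\<in>U. co k u \<noteq> 0 \<and> (\<forall>j<k. co j u = 0))}"

lemma finite_pivots: "finite (pivots N co U)" and card_pivots: "card (pivots N co U) \<le> N"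
proof -
  have *: "pivots N co U \<subseteq> {..<N}" by (auto simp: pivots_def)
  show "finite (pivots N co U)" using finite_subset[OF *] by simp
  show "card (pivots N co U) \<le> N" using card_mono[OF _ *] by simp
qed

lemma pivots_mono: "U \<subseteq> W \<Longrightarrow> pivots N co U \<subseteq> pivots N co W"
  by (auto simp: pivots_def)

text \<open>Gaussian elimination: the leading coordinate of w is cleared by a member of U with the
  same pivot, and the opposite step recovers w at the end. \<open>sb w c u\<close> stands for w + c
  u, kept abstract because matrices and vectors share the argument.\<close>

lemma eq_if_pivots_subset:
  assumes "U \<subseteq> W"
    and W: "\<And>w u c. w \<in> W \<Longrightarrow> u \<in> W \<Longrightarrow> sb w c u \<in> W"
    and U: "\<And>w u c. w \<in> U \<Longrightarrow> u \<in> U \<Longrightarrow> sb w c u \<in> U"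
    and undo_sb: "\<And>w u c. w \<in> W \<Longrightarrow> u \<in> W \<Longrightarrow> sb (sb w c u) (- c) u = w"
    and co: "\<And>w u c j. w \<in> W \<Longrightarrow> u \<in> W \<Longrightarrow> j < N \<Longrightarrow> co j (sb w c u) = co j w + c * (co j u :: 'a::field)"
    and zero: "\<And>w. w \<in> W \<Longrightarrow> (\<And>j. j < N \<Longrightarrow> co j w = 0) \<Longrightarrow> w \<in> U"
    and piv: "pivots N co W \<subseteq> pivots N co U"
  shows "W = U"
proof -
  have "w \<in> U" if "w \<in> W" "k \<le> N" "\<And>j. j < k \<Longrightarrow> co j w = 0" for k w
    using that
  proof (induction "N - k" arbitrary: k w)
    case 0
    then show ?case using zero by simp
  next
    case (Suc d)
    then have k: "k < N" "d = N - Suc k" by auto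
    show ?case
    proof (cases "co k w = 0")
      case True
      then show ?thesis using Suc.hyps(1)[OF k(2) Suc.prems(1)] k(1) Suc.prems(3) less_Suc_eq by auto
    next
      case False
      then have "k \<in> pivots N co W" using Suc.prems k by (auto simp: pivots_def)
      then obtain u where u: "u \<in> U" "co k u \<noteq> 0" "\<And>j. j < k \<Longrightarrow> co j u = 0"
        using piv by (auto simp: pivots_def)
      define c where "c = - (co k w / co k u)"
      have uW: "u \<in> W" using u assms(1) by blast
      have w': "sb w c u \<in> W" using W Suc.prems(1) uW by blast
      have "co j (sb w c u) = 0" if "j < Suc k" for j
        using that co[OF Suc.prems(1) uW, of j c] u Suc.prems(3) k by (auto simp: less_Suc_eq c_def)
      then have "sb w c u \<in> U" using Suc.hyps(1)[OF k(2) w'] k(1) by simp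
      then have "sb (sb w c u) (- c) u \<in> U" using U u by blast
      then show ?thesis using undo_sb Suc.prems uW by simp
    qed
  qed
  from this[of _ 0] show ?thesis using assms(1) by auto
qed

text \<open>Centralizers in the full matrix algebra are linear subspaces. If a finite subset of S
  has a centralizer of least dimension, adding one more element of S cannot shrink that
  centralizer.\<close>

lemma finite_subset_same_commutant:
  fixes S :: "'a::field mat set"
  assumes "S \<subseteq> carrier_mat n n"
  shows "\<exists>S0\<subseteq>S. finite S0 \<and>
    {Y \<in> carrier_mat n n. \<forall>s\<in>S0. s * Y = Y * s} \<subseteq> {Y \<in> carrier_mat n n. \<forall>s\<in>S. s * Y = Y * s}"
proof -
  define C where "C T = {Y \<in> carrier_mat n n. \<forall>s\<in>T. s * Y = Y * s}" for T :: "'a mat set"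
  \<comment> \<open>A square matrix is read row by row as a vector with n times n
    coordinates.\<close>
  define co where "co k M = M $$ (k div n, k mod n)" for k and M :: "'a mat"
  let ?p = "\<lambda>T. card (pivots (n * n) co (C T))"
  obtain T where T: "finite T" "T \<subseteq> S" and min: "\<And>T'. finite T' \<and> T' \<subseteq> S \<Longrightarrow> ?p T \<le> ?p T'"
    using ex_has_least_nat[of "\<lambda>T. finite T \<and> T \<subseteq> S" "{}" ?p] by auto
  have closed: "w + c \<cdot>\<^sub>m u \<in> C T'" if T': "T' \<subseteq> S" and w: "w \<in> C T'" and u: "u \<in> C T'" for T' w u c
  proof -
    have "s * (w + c \<cdot>\<^sub>m u) = (w + c \<cdot>\<^sub>m u) * s" if "s \<in> T'" for s
    proof -
      have car: "s \<in> carrier_mat n n" "w \<in> carrier_mat n n" "u \<in> carrier_mat n n"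
        using that T' assms w u by (auto simp: C_def)
      have "s * (w + c \<cdot>\<^sub>m u) = s * w + c \<cdot>\<^sub>m (s * u)"
        using car by (simp add: mult_add_distrib_mat[of _ n n _ n] mult_smult_distrib[of _ n n _ n])
      also have "\<dots> = w * s + c \<cdot>\<^sub>m (u * s)" using w u that by (auto simp: C_def)
      also have "\<dots> = (w + c \<cdot>\<^sub>m u) * s"
        using car by (simp add: add_mult_distrib_mat[of _ n n _ _ n] mult_smult_assoc_mat[of _ n n _ n])
      finally show ?thesis .
    qed
    then show ?thesis using w u by (auto simp: C_def)
  qed
  have "C T \<subseteq> C S"
  proof
    fix Y assume Y: "Y \<in> C T"
    have "s * Y = Y * s" if s: "s \<in> S" for s
    proof -
      have sub: "C (insert s T) \<subseteq> C T" by (auto simp: C_def)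
      have "?p T \<le> ?p (insert s T)" using min T s by simp
      then have eq: "pivots (n * n) co (C (insert s T)) = pivots (n * n) co (C T)"
        using card_seteq[OF finite_pivots pivots_mono[OF sub]] by blast
      have "C T = C (insert s T)"
      proof (rule eq_if_pivots_subset[where sb = "\<lambda>w c u. w + c \<cdot>\<^sub>m u" and co = co and N = "n * n"])
        fix w u c j assume wu: "w \<in> C T" "u \<in> C T" "j < n * n"
        have "n > 0" using wu(3) by (cases n) auto
        then have "j div n < n" "j mod n < n" using wu(3) less_mult_imp_div_less by auto
        then show "co j (w + c \<cdot>\<^sub>m u) = co j w + c * co j u" using wu by (auto simp: C_def co_def)
      next
        fix w assume w: "w \<in> C T" "\<And>j. j < n * n \<Longrightarrow> co j w = 0"
        have "w = 0\<^sub>m n n"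
        proof (rule eq_matI)
          fix i j assume ij: "i < dim_row (0\<^sub>m n n)" "j < dim_col (0\<^sub>m n n)"
          then have "i * n + j < n * n"
            using mult_le_mono1[of "Suc i" n n] by simp
          then have "co (i * n + j) w = 0" by (rule w(2))
          then show "w $$ (i, j) = 0\<^sub>m n n $$ (i, j)" using ij by (simp add: co_def)
        qed (use w in \<open>auto simp: C_def\<close>)
        moreover have "\<And>t. t \<in> insert s T \<Longrightarrow> t \<in> carrier_mat n n" using s T assms by auto
        moreover have "t * 0\<^sub>m n n = 0\<^sub>m n n * t" if "t \<in> carrier_mat n n" for t :: "'a mat"
          using left_mult_zero_mat[OF that, of n] right_mult_zero_mat[OF that, of n] by simp
        ultimately have "\<forall>t\<in>insert s T. t * w = w * t" by blast
        then show "w \<in> C (insert s T)" using w(1) unfolding C_def by blast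
      next
        fix w u c assume "w \<in> C T" "u \<in> C T"
        then show "w + c \<cdot>\<^sub>m u + - c \<cdot>\<^sub>m u = w" by (intro eq_matI) (auto simp: C_def)
      qed (use sub eq closed[OF T(2)] closed[of "insert s T"] s T in auto)
      then show ?thesis using Y by (auto simp: C_def)
    qed
    then show "Y \<in> C S" using Y by (auto simp: C_def)
  qed
  then show ?thesis using T unfolding C_def by blast
qed

section \<open>Annihilation by the factored characteristic polynomial\<close>

definition shift_vec :: "complex mat \<Rightarrow> complex \<Rightarrow> complex vec \<Rightarrow> complex vec" where
  "shift_vec A e v = A *\<^sub>v v - e \<cdot>\<^sub>v v"

lemma shift_vec_carrier [simp]:
  "A \<in> carrier_mat n n \<Longrightarrow> v \<in> carrier_vec n \<Longrightarrow> shift_vec A e v \<in> carrier_vec n"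
  unfolding shift_vec_def by (metis minus_carrier_vec mult_mat_vec_carrier smult_carrier_vec)

lemma foldr_shift_carrier [simp]:
  "A \<in> carrier_mat n n \<Longrightarrow> v \<in> carrier_vec n \<Longrightarrow> foldr (shift_vec A) es v \<in> carrier_vec n"
  by (induction es) auto

text \<open>If all entries of v beyond position k vanish, T multiplies entry k by T_kk and keeps the
  later entries zero; subtracting T_kk v clears position k as well.\<close>

lemma shift_upper_triangular:
  assumes T: "T \<in> carrier_mat n n" "upper_triangular T" and v: "v \<in> carrier_vec n"
    and k: "k < n" "\<And>i. Suc k \<le> i \<Longrightarrow> i < n \<Longrightarrow> v $ i = 0" and i: "k \<le> i" "i < n"
  shows "shift_vec T (T $$ (k, k)) v $ i = 0"
proof -
  have "(T *\<^sub>v v) $ i = (\<Sum>j\<in>{0..<n}. T $$ (i, j) * v $ j)"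
    using T(1) v i by (simp add: scalar_prod_def)
  also have "\<dots> = (\<Sum>j\<in>{0..<n}. if j = k then T $$ (i, k) * v $ k else 0)"
  proof (rule sum.cong)
    fix j assume j: "j \<in> {0..<n}"
    show "T $$ (i, j) * v $ j = (if j = k then T $$ (i, k) * v $ k else 0)"
    proof (cases "j < k")
      case True
      then have "T $$ (i, j) = 0" using upper_triangularD[OF T(2), of j i] i T(1) by simp
      then show ?thesis using True by simp
    next
      case False
      then show ?thesis using k(2)[of j] j by auto
    qed
  qed simp
  also have "\<dots> = T $$ (i, k) * v $ k" using k(1) by simp
  finally have *: "(T *\<^sub>v v) $ i = T $$ (i, k) * v $ k" .
  have "T $$ (i, k) * v $ k = T $$ (k, k) * v $ i"
  proof (cases "i = k")
    case False
    then have "k < i" using i by simp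
    then have "T $$ (i, k) = 0" "v $ i = 0" using upper_triangularD[OF T(2), of k i] k(2)[of i] i T(1) by auto
    then show ?thesis by simp
  qed simp
  then show ?thesis using * T(1) v i by (simp add: shift_vec_def)
qed

text \<open>\<open>foldr\<close> applies the last diagonal entry first, so the vector is cleared
  from its last position upwards.\<close>

lemma foldr_shift_upper_triangular:
  assumes T: "T \<in> carrier_mat n n" "upper_triangular T" and v: "v \<in> carrier_vec n"
  shows "foldr (shift_vec T) (diag_mat T) v = 0\<^sub>v n"
proof -
  have main: "k \<le> n \<Longrightarrow> \<forall>i. k \<le> i \<and> i < n \<longrightarrow>
     foldr (shift_vec T) (map (\<lambda>i. T $$ (i, i)) [k..<n]) v $ i = 0" for k
  proof (induction rule: inc_induct)
    case (step k)
    have "[k..<n] = k # [Suc k..<n]" using step.hyps by (simp add: upt_conv_Cons)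
    then show ?case
      using shift_upper_triangular[OF T, of "foldr (shift_vec T) (map (\<lambda>i. T $$ (i, i)) [Suc k..<n]) v" k]
        step T v by simp
  qed auto
  have "diag_mat T = map (\<lambda>i. T $$ (i, i)) [0..<n]" using T(1) by (auto simp: diag_mat_def)
  then show ?thesis using main[of 0] T v foldr_shift_carrier[OF T(1) v, of "diag_mat T"]
    by (intro eq_vecI) auto
qed

text \<open>P need not be invertible: it may be a change of basis or, when A = B, any matrix
  commuting with A.\<close>

lemma foldr_shift_intertwine:
  assumes "A \<in> carrier_mat n n" "B \<in> carrier_mat n n" "P \<in> carrier_mat n n" "A * P = P * B" "v \<in> carrier_vec n"
  shows "foldr (shift_vec A) es (P *\<^sub>v v) = P *\<^sub>v foldr (shift_vec B) es v"
proof (induction es)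
  case (Cons e es)
  let ?w = "foldr (shift_vec B) es v"
  have w: "?w \<in> carrier_vec n" using assms by simp
  have "A *\<^sub>v (P *\<^sub>v ?w) = P *\<^sub>v (B *\<^sub>v ?w)"
    using assms w by (metis assoc_mult_mat_vec)
  then have "shift_vec A e (P *\<^sub>v ?w) = P *\<^sub>v (B *\<^sub>v ?w) - P *\<^sub>v (e \<cdot>\<^sub>v ?w)"
    using assms w by (simp add: shift_vec_def mult_mat_vec[of _ n n])
  also have "\<dots> = P *\<^sub>v (B *\<^sub>v ?w - e \<cdot>\<^sub>v ?w)"
    using mult_minus_distrib_mat_vec[OF assms(3) mult_mat_vec_carrier[OF assms(2) w] smult_carrier_vec[THEN iffD2, OF w]] by simp
  also have "B *\<^sub>v ?w - e \<cdot>\<^sub>v ?w = shift_vec B e ?w" by (simp add: shift_vec_def)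
  finally show ?case using Cons by simp
qed simp

text \<open>Cayley-Hamilton in factored form, by Schur triangularization. The factors are kept apart
  because the single eigenvalues are needed later.\<close>

lemma foldr_shift_char_poly:
  assumes A: "A \<in> carrier_mat n n" and cp: "char_poly A = (\<Prod>e\<leftarrow>es. [:- e, 1:])" and v: "v \<in> carrier_vec n"
  shows "foldr (shift_vec A) es v = 0\<^sub>v n"
proof -
  obtain B P Q where "schur_decomposition A es = (B, P, Q)" by (metis prod_cases3)
  from schur_decomposition[OF A cp this]
  have sim: "similar_mat_wit A B P Q" and B: "upper_triangular B" "diag_mat B = es" by auto
  have c: "B \<in> carrier_mat n n" "P \<in> carrier_mat n n" "Q \<in> carrier_mat n n"
    and PQ: "P * Q = 1\<^sub>m n" "Q * P = 1\<^sub>m n" and eq: "A = P * B * Q"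
    using similar_mat_witD2[OF A sim] by auto
  have "A * P = P * B * (Q * P)" unfolding eq using c by (simp add: assoc_mult_mat[of _ n n _ n _ n])
  then have AP: "A * P = P * B" using PQ c by simp
  have Qv: "Q *\<^sub>v v \<in> carrier_vec n" using c v by simp
  have "P *\<^sub>v (Q *\<^sub>v v) = v" using c v PQ by (simp flip: assoc_mult_mat_vec)
  then have "foldr (shift_vec A) es v = P *\<^sub>v foldr (shift_vec B) es (Q *\<^sub>v v)"
    using foldr_shift_intertwine[OF A c(1,2) AP Qv] by simp
  also have "foldr (shift_vec B) es (Q *\<^sub>v v) = 0\<^sub>v n"
    using foldr_shift_upper_triangular[OF c(1) B(1) Qv] B(2) by simp
  finally show ?thesis using c by auto
qed

section \<open>Invariant subspaces of commuting matrices\<close>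

definition vec_subspace :: "nat \<Rightarrow> complex vec set \<Rightarrow> bool" where
  "vec_subspace n U \<longleftrightarrow> U \<subseteq> carrier_vec n \<and> 0\<^sub>v n \<in> U \<and> (\<forall>u\<in>U. \<forall>v\<in>U. \<forall>c. u + c \<cdot>\<^sub>v v \<in> U)"

lemma vec_subspace_smult: "vec_subspace n U \<Longrightarrow> u \<in> U \<Longrightarrow> c \<cdot>\<^sub>v u \<in> U"
proof -
  assume U: "vec_subspace n U" "u \<in> U"
  then have "0\<^sub>v n + c \<cdot>\<^sub>v u \<in> U" "u \<in> carrier_vec n" by (auto simp: vec_subspace_def)
  then show ?thesis by simp
qed

lemma vec_subspace_diff: "vec_subspace n U \<Longrightarrow> u \<in> U \<Longrightarrow> v \<in> U \<Longrightarrow> u - v \<in> U"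
proof -
  assume U: "vec_subspace n U" "u \<in> U" "v \<in> U"
  then have "u + (- 1) \<cdot>\<^sub>v v \<in> U" "u \<in> carrier_vec n" "v \<in> carrier_vec n" by (auto simp: vec_subspace_def)
  moreover from this have "u + (- 1) \<cdot>\<^sub>v v = u - v" by (intro eq_vecI) auto
  ultimately show ?thesis by simp
qed

text \<open>Strict monotonicity of dimension, with pivots counted instead of basis vectors.\<close>

lemma vec_subspace_pivots:
  assumes "vec_subspace n U" "vec_subspace n W" "U \<subset> W"
  shows "card (pivots n (\<lambda>i v. v $ i) U) < card (pivots n (\<lambda>i v. v $ i) W)"
proof (rule ccontr)
  assume "\<not> ?thesis"
  then have "pivots n (\<lambda>i v. v $ i) U = pivots n (\<lambda>i v. v $ i) W"
    using card_seteq[OF finite_pivots pivots_mono[of U W]] assms(3) by (metis not_less psubset_imp_subset)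
  have "W = U"
  proof (rule eq_if_pivots_subset[where sb = "\<lambda>w c u. w + c \<cdot>\<^sub>v u" and co = "\<lambda>i v. v $ i" and N = n])
    fix w assume "w \<in> W" "\<And>j. j < n \<Longrightarrow> w $ j = 0"
    then have "w = 0\<^sub>v n" using assms(2) by (intro eq_vecI) (auto simp: vec_subspace_def)
    then show "w \<in> U" using assms(1) by (simp add: vec_subspace_def)
  next
    fix w u c assume "w \<in> W" "u \<in> W"
    then have "w \<in> carrier_vec n" "u \<in> carrier_vec n" using assms(2) by (auto simp: vec_subspace_def)
    then show "w + c \<cdot>\<^sub>v u + - c \<cdot>\<^sub>v u = w" by (intro eq_vecI) auto
  next
    fix w u c j assume "w \<in> W" "u \<in> W" "j < n"
    then have "w \<in> carrier_vec n" "u \<in> carrier_vec n" using assms(2) by (auto simp: vec_subspace_def)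
    then show "(w + c \<cdot>\<^sub>v u) $ j = w $ j + c * u $ j" using \<open>j < n\<close> by simp
  qed (use assms \<open>pivots n _ U = _\<close> in \<open>auto simp: vec_subspace_def\<close>)
  then show False using assms(3) by blast
qed

lemma vec_diff_cancel:
  fixes a b w :: "'a::comm_ring_1 vec"
  assumes "w \<in> carrier_vec n" "a \<in> carrier_vec n" "b \<in> carrier_vec n"
  shows "(a - e \<cdot>\<^sub>v w) - (b - e \<cdot>\<^sub>v w) = a - b"
  using assms by (intro eq_vecI) auto

text \<open>On a minimal invariant subspace \<open>W\<close> above \<open>U\<close> every \<open>x \<in> X\<close> acts modulo \<open>U\<close> as a scalar, which
  is one of the finitely many \<open>es\<close>.\<close>

lemma commuting_nilpotent_differences:
  fixes X :: "complex mat set"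
  assumes X: "X \<subseteq> carrier_mat n n" and comm: "\<And>x y. x \<in> X \<Longrightarrow> y \<in> X \<Longrightarrow> x * y = y * x"
    and es: "\<And>x v. x \<in> X \<Longrightarrow> v \<in> carrier_vec n \<Longrightarrow> foldr (shift_vec x) es v = 0\<^sub>v n"
    and U: "vec_subspace n U" "\<And>x u. x \<in> X \<Longrightarrow> u \<in> U \<Longrightarrow> x *\<^sub>v u \<in> U"
  shows "\<exists>(\<kappa> :: complex mat \<Rightarrow> complex list) r. finite (\<kappa> ` X) \<and>
    (\<forall>x\<in>X. \<forall>y\<in>X. \<kappa> x = \<kappa> y \<longrightarrow> (\<forall>v\<in>carrier_vec n. ((\<lambda>v. x *\<^sub>v v - y *\<^sub>v v) ^^ r) v \<in> U))"
  using U
proof (induction "n - card (pivots n (\<lambda>i v. v $ i :: complex) U)" arbitrary: U rule: less_induct)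
  case less
  let ?p = "\<lambda>U. card (pivots n (\<lambda>i v. v $ i :: complex) U)"
  define invar where "invar W \<longleftrightarrow> vec_subspace n W \<and> (\<forall>x\<in>X. \<forall>w\<in>W. x *\<^sub>v w \<in> W)" for W
  have Uc: "U \<subseteq> carrier_vec n" using less.prems(1) by (simp add: vec_subspace_def)
  show ?case
  proof (cases "U = carrier_vec n")
    case True
    have "finite ((\<lambda>x. []) ` X) \<and> (\<forall>x\<in>X. \<forall>y\<in>X. [] = [] \<longrightarrow>
        (\<forall>v\<in>carrier_vec n. ((\<lambda>v. x *\<^sub>v v - y *\<^sub>v v) ^^ 0) v \<in> U))"
      using True by (auto intro: finite_subset[of _ "{[]}"])
    then show ?thesis by blast
  next
    case False
    have "invar (carrier_vec n) \<and> U \<subset> carrier_vec n"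
      using X False Uc by (auto simp: invar_def vec_subspace_def subset_iff intro!: mult_mat_vec_carrier)
    then obtain W where W: "invar W" "U \<subset> W" and min: "\<And>W'. invar W' \<and> U \<subset> W' \<Longrightarrow> ?p W \<le> ?p W'"
      using ex_has_least_nat[of "\<lambda>W. invar W \<and> U \<subset> W" "carrier_vec n" ?p] by auto
    have Ws: "vec_subspace n W" and Wx: "\<And>x w. x \<in> X \<Longrightarrow> w \<in> W \<Longrightarrow> x *\<^sub>v w \<in> W"
      using W(1) by (auto simp: invar_def)
    have Wc: "W \<subseteq> carrier_vec n" using Ws by (simp add: vec_subspace_def)
    have lt: "?p U < ?p W" using vec_subspace_pivots[OF less.prems(1) Ws W(2)] .
    moreover have "?p W \<le> n" by (rule card_pivots)
    ultimately have "n - ?p W < n - ?p U" by simp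
    from less.hyps[OF this Ws Wx] obtain \<kappa> :: "complex mat \<Rightarrow> complex list" and r where
      \<kappa>: "finite (\<kappa> ` X)" "\<And>x y v. x \<in> X \<Longrightarrow> y \<in> X \<Longrightarrow> \<kappa> x = \<kappa> y \<Longrightarrow> v \<in> carrier_vec n \<Longrightarrow>
          ((\<lambda>v. x *\<^sub>v v - y *\<^sub>v v) ^^ r) v \<in> W" by blast
    have "\<exists>e\<in>set es. \<forall>w\<in>W. shift_vec x e w \<in> U" if x: "x \<in> X" for x
    proof -
      obtain w0 where w0: "w0 \<in> W" "w0 \<notin> U" using W(2) by blast
      have shW: "shift_vec x e w \<in> W" if "w \<in> W" for e w
        unfolding shift_vec_def using vec_subspace_diff[OF Ws Wx[OF x that] vec_subspace_smult[OF Ws that]] .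
      have fW: "foldr (shift_vec x) es' w0 \<in> W" for es'
        by (induction es') (use w0 shW in auto)
      have "foldr (shift_vec x) es w0 \<in> U" using es[OF x, of w0] w0 Wc less.prems(1) by (auto simp: vec_subspace_def)
      \<comment> \<open>The factors x - e take w0 from outside U into U. At a factor where U is
        entered, the preceding vector w shows that e is an eigenvalue of x on W modulo U.\<close>
      then obtain e w where e: "e \<in> set es" "w \<in> W" "w \<notin> U" "shift_vec x e w \<in> U"
      proof (induction es)
        case (Cons e es')
        show ?case
        proof (cases "foldr (shift_vec x) es' w0 \<in> U")
          case True
          then show ?thesis using Cons by auto
        next
          case False
          then show ?thesis using Cons.prems fW[of es'] by auto
        qed
      qed (use w0 in simp)
      \<comment> \<open>The eigenspace of x on W modulo U, pulled back to W. It is invariant because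
        X commutes and larger than U because of w; minimality of W makes it all of W.\<close>
      define K where "K = {w \<in> W. shift_vec x e w \<in> U}"
      have xc: "x \<in> carrier_mat n n" using x X by blast
      have lin: "shift_vec x e (u + c \<cdot>\<^sub>v v) = shift_vec x e u + c \<cdot>\<^sub>v shift_vec x e v"
        if uv: "u \<in> carrier_vec n" "v \<in> carrier_vec n" for u v c
      proof -
        have "x *\<^sub>v (u + c \<cdot>\<^sub>v v) = x *\<^sub>v u + c \<cdot>\<^sub>v (x *\<^sub>v v)"
          using xc uv by (simp add: mult_add_distrib_mat_vec[of _ n n] mult_mat_vec[of _ n n])
        moreover have "x *\<^sub>v u \<in> carrier_vec n" "x *\<^sub>v v \<in> carrier_vec n" using xc uv by auto
        ultimately show ?thesis using uv xc unfolding shift_vec_def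
          by (intro eq_vecI) (auto simp: algebra_simps)
      qed
      have "invar K"
        unfolding invar_def vec_subspace_def
      proof (intro conjI ballI allI)
        show "K \<subseteq> carrier_vec n" using Wc by (auto simp: K_def)
        have "shift_vec x e (0\<^sub>v n) = 0\<^sub>v n" using xc by (auto simp: shift_vec_def)
        then show "0\<^sub>v n \<in> K" using Ws less.prems(1) by (simp add: K_def vec_subspace_def)
      next
        fix u v c assume uv: "u \<in> K" "v \<in> K"
        then have "shift_vec x e (u + c \<cdot>\<^sub>v v) = shift_vec x e u + c \<cdot>\<^sub>v shift_vec x e v"
          using lin Wc by (auto simp: K_def)
        then show "u + c \<cdot>\<^sub>v v \<in> K" using uv Ws less.prems(1) by (simp add: K_def vec_subspace_def)
      next
        fix y w assume y: "y \<in> X" and w: "w \<in> K"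
        have yc: "y \<in> carrier_mat n n" and wc: "w \<in> carrier_vec n" using y X w Wc by (auto simp: K_def)
        have "foldr (shift_vec x) [e] (y *\<^sub>v w) = y *\<^sub>v foldr (shift_vec x) [e] w"
          by (rule foldr_shift_intertwine[OF xc xc yc comm[OF x y] wc])
        then have "shift_vec x e (y *\<^sub>v w) = y *\<^sub>v shift_vec x e w" by simp
        then show "y *\<^sub>v w \<in> K" using w y Wx less.prems(2) by (simp add: K_def)
      qed
      moreover have "U \<subset> K"
      proof
        have "shift_vec x e u \<in> U" if "u \<in> U" for u
          unfolding shift_vec_def
          using vec_subspace_diff[OF less.prems(1) less.prems(2)[OF x that] vec_subspace_smult[OF less.prems(1) that]] .
        then show "U \<subseteq> K" using W(2) by (auto simp: K_def)
        show "U \<noteq> K" using e by (auto simp: K_def)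
      qed
      ultimately have "?p W \<le> ?p K" using min by blast
      moreover have "K \<subseteq> W" by (auto simp: K_def)
      ultimately have "K = W" using vec_subspace_pivots[of n K W] \<open>invar K\<close> Ws by (auto simp: invar_def)
      then show ?thesis using e(1) by (auto simp: K_def)
    qed
    then obtain ev where ev: "\<And>x. x \<in> X \<Longrightarrow> ev x \<in> set es" "\<And>x w. x \<in> X \<Longrightarrow> w \<in> W \<Longrightarrow> shift_vec x (ev x) w \<in> U"
      by metis
    \<comment> \<open>The list attached to x records its scalars on the successive layers; the new
      head, from \<open>es\<close>, is the scalar on W modulo U.\<close>
    have "(\<lambda>x. ev x # \<kappa> x) ` X \<subseteq> (\<lambda>(a, b). a # b) ` (set es \<times> \<kappa> ` X)" using ev(1) by auto
    then have fin: "finite ((\<lambda>x. ev x # \<kappa> x) ` X)" by (rule finite_subset) (use \<kappa>(1) in auto)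
    have "((\<lambda>v. x *\<^sub>v v - y *\<^sub>v v) ^^ Suc r) v \<in> U"
      if xy: "x \<in> X" "y \<in> X" "ev x # \<kappa> x = ev y # \<kappa> y" "v \<in> carrier_vec n" for x y v
    proof -
      let ?w = "((\<lambda>v. x *\<^sub>v v - y *\<^sub>v v) ^^ r) v"
      have w: "?w \<in> W" using \<kappa>(2) xy by simp
      \<comment> \<open>Equal heads mean that x and y act on W modulo U by the same scalar, so x - y
        maps W into U.\<close>
      have "shift_vec x (ev x) ?w - shift_vec y (ev x) ?w \<in> U"
        using ev(2)[OF xy(1) w] ev(2)[OF xy(2) w] xy(3) vec_subspace_diff[OF less.prems(1)] by simp
      moreover have "shift_vec x (ev x) ?w - shift_vec y (ev x) ?w = x *\<^sub>v ?w - y *\<^sub>v ?w"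
      proof -
        have "?w \<in> carrier_vec n" "x *\<^sub>v ?w \<in> carrier_vec n" "y *\<^sub>v ?w \<in> carrier_vec n"
          using w Wc Wx[OF xy(1) w] Wx[OF xy(2) w] by auto
        then show ?thesis unfolding shift_vec_def by (rule vec_diff_cancel)
      qed
      ultimately show ?thesis by simp
    qed
    then show ?thesis using fin by (intro exI[of _ "\<lambda>x. ev x # \<kappa> x"] exI[of _ "Suc r"]) blast
  qed
qed

definition matrix_monoid :: "nat \<Rightarrow> complex mat set \<Rightarrow> complex mat monoid" where
  "matrix_monoid n C = \<lparr>carrier = C, monoid.mult = (*), one = 1\<^sub>m n\<rparr>"

text \<open>A commuting set of conjugates of one matrix splits into finitely many classes with nilpotent
  differences, and \<open>x - y\<close> nilpotent makes \<open>x y\<^sup>-\<^sup>1\<close> unipotent.\<close>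

theorem solvable_linear_group_virtually_abelian:
  fixes C :: "complex mat set" and n :: nat
  defines "L \<equiv> matrix_monoid n C"
  assumes C: "C \<subseteq> carrier_mat n n" and grp: "group L" and sol: "solvable L"
    and unip: "\<And>g r. g \<in> C \<Longrightarrow> (\<And>v. v \<in> carrier_vec n \<Longrightarrow> ((\<lambda>v. g *\<^sub>v v - v) ^^ r) v = 0\<^sub>v n) \<Longrightarrow> g = 1\<^sub>m n"
  shows "\<exists>K. subgroup K L \<and> group.finite_index_in L K C \<and> (\<forall>x\<in>K. \<forall>y\<in>K. x * y = y * x)"
proof -
  interpret group L by (rule grp)
  have L [simp]: "carrier L = C" "x \<otimes>\<^bsub>L\<^esub> y = x * y" "\<one>\<^bsub>L\<^esub> = 1\<^sub>m n" for x y by (auto simp: L_def matrix_monoid_def)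
  have invc: "inv\<^bsub>L\<^esub> x \<in> C" "inv\<^bsub>L\<^esub> x * x = 1\<^sub>m n" "x * inv\<^bsub>L\<^esub> x = 1\<^sub>m n" if "x \<in> C" for x
    using that inv_closed[of x] l_inv[of x] r_inv[of x] by auto
  have "\<exists>K. subgroup K L \<and> finite_index_in K (carrier L) \<and> (\<forall>x\<in>K. \<forall>y\<in>K. x \<otimes>\<^bsub>L\<^esub> y = y \<otimes>\<^bsub>L\<^esub> x)"
  proof (rule solvable_virtually_abelian_criterion[OF sol])
    fix S assume "S \<subseteq> carrier L"
    then have S: "S \<subseteq> carrier_mat n n" "S \<subseteq> C" using C by auto
    obtain S0 where S0: "S0 \<subseteq> S" "finite S0"
      "{Y \<in> carrier_mat n n. \<forall>s\<in>S0. s * Y = Y * s} \<subseteq> {Y \<in> carrier_mat n n. \<forall>s\<in>S. s * Y = Y * s}"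
      using finite_subset_same_commutant[OF S(1)] by blast
    have "commutant S0 \<subseteq> commutant S"
    proof
      fix Y assume Y: "Y \<in> commutant S0"
      then have YC: "Y \<in> C" and "\<forall>s\<in>S0. s * Y = Y * s" by (auto simp: commutant_def)
      then have "Y \<in> {Y \<in> carrier_mat n n. \<forall>s\<in>S0. s * Y = Y * s}" using C by blast
      then have "\<forall>s\<in>S. s * Y = Y * s" using S0(3) by blast
      then show "Y \<in> commutant S" using YC by (auto simp: commutant_def)
    qed
    then show "\<exists>S0\<subseteq>S. finite S0 \<and> commutant S0 \<subseteq> commutant S" using S0 by blast
  next
    fix b X assume b: "b \<in> carrier L" and Xb: "X \<subseteq> conj_class (carrier L) b"
      and "\<forall>y\<in>X. \<forall>z\<in>X. y \<otimes>\<^bsub>L\<^esub> z = z \<otimes>\<^bsub>L\<^esub> y"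
    then have comm: "\<And>x y. x \<in> X \<Longrightarrow> y \<in> X \<Longrightarrow> x * y = y * x" by simp
    have bC: "b \<in> C" "b \<in> carrier_mat n n" using b C by auto
    have XC: "X \<subseteq> C"
    proof
      fix x assume "x \<in> X"
      then obtain g where "g \<in> C" "x = inv\<^bsub>L\<^esub> g * b * g" using Xb by (auto simp: conj_class_def)
      then show "x \<in> C" using m_closed[of "inv\<^bsub>L\<^esub> g" b] m_closed[of "inv\<^bsub>L\<^esub> g * b" g] invc(1) bC(1) by simp
    qed
    have X: "X \<subseteq> carrier_mat n n" using XC C by blast
    obtain es where es: "char_poly b = (\<Prod>e\<leftarrow>es. [:- e, 1:])" using char_poly_factorized[OF bC(2)] by blast
    \<comment> \<open>Conjugation carries the product of the factors of b to that of x, so one list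
      \<open>es\<close> serves all of X.\<close>
    have kill: "foldr (shift_vec x) es v = 0\<^sub>v n" if x: "x \<in> X" and v: "v \<in> carrier_vec n" for x v
    proof -
      obtain g where g: "g \<in> C" "x = inv\<^bsub>L\<^esub> g * b * g" using x Xb by (auto simp: conj_class_def)
      let ?h = "inv\<^bsub>L\<^esub> g"
      have c: "g \<in> carrier_mat n n" "?h \<in> carrier_mat n n" "x \<in> carrier_mat n n"
        using g invc C x X by auto
      have "x * ?h = ?h * b * (g * ?h)"
        unfolding g(2) using c bC by (simp add: assoc_mult_mat[of _ n n _ n _ n])
      then have xh: "x * ?h = ?h * b" using invc(3)[OF g(1)] c bC by simp
      have gv: "g *\<^sub>v v \<in> carrier_vec n" using c v by simp
      have "?h *\<^sub>v (g *\<^sub>v v) = v" using c v invc(2)[OF g(1)] by (simp flip: assoc_mult_mat_vec)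
      then have "foldr (shift_vec x) es v = ?h *\<^sub>v foldr (shift_vec b) es (g *\<^sub>v v)"
        using foldr_shift_intertwine[OF c(3) bC(2) c(2) xh gv, of es] by simp
      also have "\<dots> = 0\<^sub>v n" using foldr_shift_char_poly[OF bC(2) es gv] c by auto
      finally show ?thesis .
    qed
    have sub0: "vec_subspace n {0\<^sub>v n}" by (auto simp: vec_subspace_def)
    have inv0: "\<And>x u. x \<in> X \<Longrightarrow> u \<in> {0\<^sub>v n} \<Longrightarrow> x *\<^sub>v u \<in> {0\<^sub>v n}"
    proof -
      fix x u assume "x \<in> X" "u \<in> {0\<^sub>v n :: complex vec}"
      then have "x \<in> carrier_mat n n" "u = 0\<^sub>v n" using X by auto
      then show "x *\<^sub>v u \<in> {0\<^sub>v n}" by auto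
    qed
    obtain \<kappa> :: "complex mat \<Rightarrow> complex list" and r where \<kappa>: "finite (\<kappa> ` X)"
      "\<forall>x\<in>X. \<forall>y\<in>X. \<kappa> x = \<kappa> y \<longrightarrow> (\<forall>v\<in>carrier_vec n. ((\<lambda>v. x *\<^sub>v v - y *\<^sub>v v) ^^ r) v \<in> {0\<^sub>v n})"
      using commuting_nilpotent_differences[OF X comm kill sub0 inv0] by blast
    have "x = y" if xy: "x \<in> X" "y \<in> X" "\<kappa> x = \<kappa> y" for x y
    proof -
      let ?h = "inv\<^bsub>L\<^esub> y" let ?d = "\<lambda>v. x *\<^sub>v v - y *\<^sub>v v"
      have xyC: "x \<in> C" "y \<in> C" using xy XC by auto
      have c: "x \<in> carrier_mat n n" "y \<in> carrier_mat n n" "?h \<in> carrier_mat n n" using xyC invc C by auto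
      have hC: "?h \<in> C" using invc xyC by blast
      have hx: "?h * x = x * ?h"
      proof -
        have "?h * x = ?h * x * (y * ?h)" using c invc(3)[OF xyC(2)] by simp
        also have "\<dots> = ?h * (x * y) * ?h" using c by (simp add: assoc_mult_mat[of _ n n _ n _ n])
        also have "\<dots> = ?h * (y * x) * ?h" using comm xy by simp
        also have "\<dots> = ?h * y * (x * ?h)" using c by (simp add: assoc_mult_mat[of _ n n _ n _ n])
        also have "\<dots> = x * ?h" using c invc(2)[OF xyC(2)] by simp
        finally show ?thesis .
      qed
      have dc: "?d v \<in> carrier_vec n" if "v \<in> carrier_vec n" for v
        using that c by (metis minus_carrier_vec mult_mat_vec_carrier)
      have hd: "?h *\<^sub>v ?d v = ?d (?h *\<^sub>v v)" if v: "v \<in> carrier_vec n" for v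
      proof -
        have "?h *\<^sub>v ?d v = (?h * x) *\<^sub>v v - (?h * y) *\<^sub>v v"
          using mult_minus_distrib_mat_vec[OF c(3), of "x *\<^sub>v v" "y *\<^sub>v v"] c v by simp
        also have "\<dots> = (x * ?h) *\<^sub>v v - (y * ?h) *\<^sub>v v" using hx invc(2,3)[OF xyC(2)] by simp
        finally show ?thesis using c v by simp
      qed
      \<comment> \<open>The inverse h of y commutes with x - y, so x h - 1 = (x - y) h gives (x h -
        1)^k = (x - y)^k h^k.\<close>
      have pow: "((\<lambda>v. (x * ?h) *\<^sub>v v - v) ^^ k) v = (?d ^^ k) (((\<lambda>v. ?h *\<^sub>v v) ^^ k) v) \<and>
          ((\<lambda>v. ?h *\<^sub>v v) ^^ k) v \<in> carrier_vec n" if v: "v \<in> carrier_vec n" for k v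
      proof (induction k)
        case (Suc k)
        let ?u = "((\<lambda>v. ?h *\<^sub>v v) ^^ k) v"
        have u: "?u \<in> carrier_vec n" using Suc by simp
        have dk: "(?d ^^ j) w \<in> carrier_vec n" if "w \<in> carrier_vec n" for j w
          by (induction j) (use that dc in auto)
        have hdk: "?h *\<^sub>v (?d ^^ j) w = (?d ^^ j) (?h *\<^sub>v w)" if "w \<in> carrier_vec n" for j w
          by (induction j) (use that hd dk in auto)
        have "((\<lambda>v. (x * ?h) *\<^sub>v v - v) ^^ Suc k) v = (x * ?h) *\<^sub>v (?d ^^ k) ?u - (?d ^^ k) ?u"
          using Suc by simp
        also have "\<dots> = ?d (?h *\<^sub>v (?d ^^ k) ?u)"
        proof -
          have "y *\<^sub>v (?h *\<^sub>v (?d ^^ k) ?u) = (y * ?h) *\<^sub>v (?d ^^ k) ?u"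
            by (rule assoc_mult_mat_vec[symmetric, OF c(2,3) dk[OF u]])
          also have "\<dots> = (?d ^^ k) ?u" using invc(3)[OF xyC(2)] dk[OF u] by simp
          finally show ?thesis using assoc_mult_mat_vec[OF c(1,3) dk[OF u]] by simp
        qed
        also have "\<dots> = (?d ^^ Suc k) (?h *\<^sub>v ?u)" using hdk[OF u] by simp
        finally show ?case using u c by simp
      qed (use v in simp)
      have "x * ?h = 1\<^sub>m n"
      proof (rule unip)
        show "x * ?h \<in> C" using m_closed[of x ?h] xyC hC by simp
        fix v :: "complex vec" assume v: "v \<in> carrier_vec n"
        then show "((\<lambda>v. (x * ?h) *\<^sub>v v - v) ^^ r) v = 0\<^sub>v n" using pow[OF v, of r] \<kappa>(2) xy by auto
      qed
      then have "x * ?h * y = y" using c by simp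
      then show ?thesis using c invc(2)[OF xyC(2)] by simp
    qed
    then have "inj_on \<kappa> X" by (auto simp: inj_on_def)
    then show "finite X" using \<kappa>(1) finite_imageD by blast
  qed
  then show ?thesis by simp
qed

section \<open>Coordinates on abelian subgroups\<close>

lemma lincomb_Nil [simp]: "lincomb G [] cs = \<one>\<^bsub>G\<^esub>"
  and lincomb_Cons [simp]: "lincomb G (a # as) (c # cs) = (a [^]\<^bsub>G\<^esub> c) \<otimes>\<^bsub>G\<^esub> lincomb G as cs"
  by (auto simp: lincomb_def)

context group
begin

lemma torsion_free_pow_eq_one:
  assumes "torsion_free G" "x \<in> carrier G" "x [^] m = \<one>" "m > (0::nat)"
  shows "x = \<one>"
  using assms unfolding torsion_free_def infinite_order_def by blast

text \<open>If \<open>z = [x, y]\<close> commutes with \<open>x\<close> and \<open>y\<close>, then \<open>z\<^sup>n = x\<^sup>n y x\<^sup>-\<^sup>n y\<^sup>-\<^sup>1\<close> has length at most \<open>2 l(y)\<close>.\<close>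

lemma central_commutator_eq_one:
  assumes tf: "torsion_free G" and l: "length_function G l" "purely_positive G l"
    and x: "x \<in> carrier G" and y: "y \<in> carrier G" and z: "z = x \<otimes> y \<otimes> inv x \<otimes> inv y"
    and zx: "z \<otimes> x = x \<otimes> z" and zy: "z \<otimes> y = y \<otimes> z"
  shows "z = \<one>"
proof (rule ccontr)
  assume "z \<noteq> \<one>"
  have zc: "z \<in> carrier G" using x y z by simp
  have "infinite_order G z" using tf zc \<open>z \<noteq> \<one>\<close> unfolding torsion_free_def by blast
  then have pos: "l z > 0" using l(2) zc unfolding purely_positive_def by blast
  have xy: "x \<otimes> y \<otimes> inv x = z \<otimes> y" using x y z by (simp add: m_assoc)
  have conj: "x [^] n \<otimes> y \<otimes> inv (x [^] n) = z [^] n \<otimes> y" for n :: nat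
  proof (induction n)
    case (Suc n)
    have zn: "x \<otimes> z [^] n = z [^] n \<otimes> x" using zx x zc group_commutes_pow by metis
    have "x [^] Suc n = x \<otimes> x [^] n" using nat_pow_Suc2[OF x] .
    then have "x [^] Suc n \<otimes> y \<otimes> inv (x [^] Suc n) = x \<otimes> (x [^] n \<otimes> y \<otimes> inv (x [^] n)) \<otimes> inv x"
      using x y by (simp add: inv_mult_group m_assoc del: nat_pow_Suc)
    also have "\<dots> = x \<otimes> (z [^] n \<otimes> y) \<otimes> inv x" using Suc by simp
    also have "\<dots> = (x \<otimes> z [^] n) \<otimes> y \<otimes> inv x" using x y zc by (simp add: m_assoc)
    also have "\<dots> = z [^] n \<otimes> (x \<otimes> y \<otimes> inv x)" using x y zc zn by (simp add: m_assoc)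
    also have "\<dots> = z [^] Suc n \<otimes> y" using xy y zc by (simp add: m_assoc)
    finally show ?case .
  qed (use y in simp)
  have bound: "real n * l z \<le> 2 * l y" for n :: nat
  proof -
    have zny: "z [^] n \<otimes> y = y \<otimes> z [^] n" using zy y zc group_commutes_pow by metis
    have "l (z [^] n) = l (z [^] int n)" by (simp add: int_pow_int)
    also have "\<dots> = real n * l z" using l(1) zc unfolding length_function_def by simp
    finally have 1: "l (z [^] n) = real n * l z" .
    have "l (inv y) = l (y [^] (- 1 :: int))" using y by (simp add: int_pow_neg)
    also have "\<dots> = l y" using l(1) y unfolding length_function_def by simp
    finally have 2: "l (inv y) = l y" .
    \<comment> \<open>By \<open>conj\<close>, z^n y is a conjugate of y. It also commutes with y, so
      subadditivity applies to z^n = (z^n y) y^{-1}.\<close>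
    have 3: "l (z [^] n \<otimes> y) = l y"
      using l(1) x y unfolding length_function_def conj[symmetric] by simp
    have "inv y \<otimes> (z [^] n \<otimes> y) = z [^] n" unfolding zny using y zc by (simp add: inv_mult_cancel)
    then have "(z [^] n \<otimes> y) \<otimes> inv y = inv y \<otimes> (z [^] n \<otimes> y)"
      using y zc by (simp add: m_assoc)
    then have "l ((z [^] n \<otimes> y) \<otimes> inv y) \<le> l (z [^] n \<otimes> y) + l (inv y)"
      using l(1) y zc unfolding length_function_def by simp
    moreover have "(z [^] n \<otimes> y) \<otimes> inv y = z [^] n" using y zc by (simp add: m_assoc)
    ultimately show ?thesis using 1 2 3 by simp
  qed
  obtain n :: nat where "2 * l y < real n * l z" using reals_Archimedean3[OF pos] by blast
  then show False using bound[of n] by simp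
qed

lemma lincomb_closed: "set as \<subseteq> carrier G \<Longrightarrow> lincomb G as cs \<in> carrier G"
proof (induction as arbitrary: cs)
  case (Cons a as)
  then show ?case by (cases cs) (auto simp: lincomb_def)
qed simp

lemma lincomb_append:
  assumes "length as = length cs" "set as \<subseteq> carrier G" "set bs \<subseteq> carrier G"
  shows "lincomb G (as @ bs) (cs @ ds) = lincomb G as cs \<otimes> lincomb G bs ds"
  using assms
proof (induction as cs rule: list_induct2)
  case (Cons a as c cs)
  then have "a \<in> carrier G" "lincomb G as cs \<in> carrier G" "lincomb G bs ds \<in> carrier G"
    by (auto simp: lincomb_closed)
  then show ?case using Cons by (simp add: m_assoc)
qed (simp add: lincomb_closed)

end

lemma vec_eq_zero_if_idem:
  fixes v :: "'a::ab_group_add vec"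
  assumes "v \<in> carrier_vec k" "v = v + v"
  shows "v = 0\<^sub>v k"
proof (rule eq_vecI)
  fix i assume "i < dim_vec (0\<^sub>v k :: 'a vec)"
  then have "v $ i = v $ i + v $ i" using arg_cong[OF assms(2), of "\<lambda>v. v $ i"] assms(1) by simp
  then show "v $ i = 0\<^sub>v k $ i" using \<open>i < _\<close> by simp
qed (use assms in simp)

locale abelian_subgroup = group +
  fixes A
  assumes A: "subgroup A G" and A_comm: "\<And>a b. a \<in> A \<Longrightarrow> b \<in> A \<Longrightarrow> a \<otimes> b = b \<otimes> a"
begin

lemma Ac: "a \<in> A \<Longrightarrow> a \<in> carrier G" and A_mult: "a \<in> A \<Longrightarrow> b \<in> A \<Longrightarrow> a \<otimes> b \<in> A"
  and A_inv: "a \<in> A \<Longrightarrow> inv a \<in> A" and A_one: "\<one> \<in> A"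
  using A by (auto simp: subgroup_def)

lemma A_pow: "a \<in> A \<Longrightarrow> a [^] (n::nat) \<in> A"
  by (induction n) (auto intro: A_one A_mult)

lemma A_int_pow: "a \<in> A \<Longrightarrow> a [^] (c::int) \<in> A"
  by (rule subgroup_int_pow_closed[OF A])

lemma lincomb_A: "set as \<subseteq> A \<Longrightarrow> lincomb G as cs \<in> A"
proof (induction as arbitrary: cs)
  case (Cons a as)
  then show ?case by (cases cs) (auto simp: lincomb_def A_one intro!: A_mult A_int_pow)
qed (simp add: A_one)

lemma lincomb_add:
  assumes "length as = length cs" "length cs = length ds" "set as \<subseteq> A"
  shows "lincomb G as (map2 (+) cs ds) = lincomb G as cs \<otimes> lincomb G as ds"
  using assms
proof (induction as cs ds rule: list_induct3)
  case (Cons a as c cs d ds)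
  let ?x = "a [^] c" and ?y = "a [^] d" and ?u = "lincomb G as cs" and ?v = "lincomb G as ds"
  have c: "?x \<in> A" "?y \<in> A" "?u \<in> A" "?v \<in> A" using Cons.prems by (auto intro: A_int_pow lincomb_A)
  have "lincomb G (a # as) (map2 (+) (c # cs) (d # ds)) = (?x \<otimes> ?y) \<otimes> (?u \<otimes> ?v)"
    using Cons Ac int_pow_mult by simp
  also have "\<dots> = ?x \<otimes> (?y \<otimes> ?u) \<otimes> ?v" using c Ac by (simp add: m_assoc)
  also have "\<dots> = ?x \<otimes> (?u \<otimes> ?y) \<otimes> ?v" using A_comm c by simp
  also have "\<dots> = (?x \<otimes> ?u) \<otimes> (?y \<otimes> ?v)" using c Ac by (simp add: m_assoc)
  finally show ?case by simp
qed (use A_one in simp)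

lemma lincomb_scale:
  assumes "length as = length cs" "set as \<subseteq> A"
  shows "lincomb G as (map ((*) k) cs) = lincomb G as cs [^] (k::int)"
  using assms
proof (induction as cs rule: list_induct2)
  case (Cons a as c cs)
  have c: "a [^] c \<in> A" "lincomb G as cs \<in> A" using Cons.prems by (auto intro: A_int_pow lincomb_A)
  then have "(a [^] c \<otimes> lincomb G as cs) [^] k = (a [^] c) [^] k \<otimes> lincomb G as cs [^] k"
    by (intro int_pow_mult_distrib A_comm Ac)
  also have "(a [^] c) [^] k = a [^] (k * c)" using Cons.prems Ac by (simp add: int_pow_pow mult.commute)
  finally show ?case using Cons by simp
qed (simp add: int_pow_one)

lemma lincomb_zero: "set as \<subseteq> A \<Longrightarrow> lincomb G as (replicate (length as) 0) = \<one>"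
  by (induction as) auto

lemma generate_lincomb:
  assumes "set as \<subseteq> A" "x \<in> generate G (set as)"
  shows "\<exists>cs. length cs = length as \<and> x = lincomb G as cs"
proof -
  have base: "\<exists>cs. length cs = length as \<and> a = lincomb G as cs" if "a \<in> set as" "set as \<subseteq> A" for a as
    using that
  proof (induction as)
    case (Cons b as)
    show ?case
    proof (cases "a = b")
      case True
      then have "a = lincomb G (b # as) (1 # replicate (length as) 0)"
        using Cons.prems Ac by (simp add: lincomb_zero)
      then show ?thesis by (intro exI[of _ "1 # replicate (length as) 0"]) simp
    next
      case False
      then obtain cs where cs: "length cs = length as" "a = lincomb G as cs" using Cons by auto
      then have "a = lincomb G (b # as) (0 # cs)" using Cons.prems lincomb_A[of as cs] Ac by simp
      then show ?thesis using cs by (intro exI[of _ "0 # cs"]) simp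
    qed
  qed simp
  show ?thesis using assms(2)
  proof (induction rule: generate.induct)
    case one
    then show ?case using lincomb_zero[OF assms(1)] by (intro exI[of _ "replicate (length as) 0"]) simp
  next
    case (incl h)
    then show ?case using base assms(1) by blast
  next
    case (inv h)
    then obtain cs where cs: "length cs = length as" "h = lincomb G as cs" using base assms(1) by blast
    have "h \<in> A" using inv assms by blast
    then have "inv h = h [^] (- 1 :: int)" using Ac by (simp add: int_pow_neg)
    then have "inv h = lincomb G as (map ((*) (- 1)) cs)" using lincomb_scale[of as cs "- 1"] cs assms by simp
    then show ?case using cs by (intro exI[of _ "map ((*) (- 1)) cs"]) simp
  next
    case (eng x y)
    then obtain cs ds where "length cs = length as" "x = lincomb G as cs" "length ds = length as" "y = lincomb G as ds"
      by blast
    then show ?case using lincomb_add[of as cs ds] assms(1) by (intro exI[of _ "map2 (+) cs ds"]) simp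
  qed
qed

lemma lincomb_generate:
  assumes "set as \<subseteq> B" "B \<subseteq> carrier G"
  shows "lincomb G as cs \<in> generate G B"
  using assms
proof (induction as arbitrary: cs)
  case Nil
  then show ?case by (simp add: generate.one)
next
  case (Cons a as)
  have "a [^] c \<in> generate G B" for c :: int
    using subgroup_int_pow_closed[OF generate_is_subgroup[OF assms(2)]] Cons.prems generate.incl by fastforce
  then show ?case using Cons generate.eng generate.one by (cases cs) (auto simp: lincomb_def intro!: generate.eng)
qed

text \<open>This sequential form is the one from which regularity of the t_i - 1 follows;
  \<open>independent_lincomb\<close> derives the symmetric form from it.\<close>

definition multiplicatively_independent :: "'a list \<Rightarrow> bool" where
  "multiplicatively_independent as \<longleftrightarrow>
     (\<forall>j<length as. \<forall>k::nat. k > 0 \<longrightarrow> as ! j [^] k \<notin> generate G (set (take j as)))"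

text \<open>In a relation the last factor a^d lies in the group generated by the earlier elements,
  so d = 0 and the relation becomes shorter.\<close>

lemma independent_lincomb:
  assumes "multiplicatively_independent as" "set as \<subseteq> A" "length cs = length as" "lincomb G as cs = \<one>" "c \<in> set cs"
  shows "c = 0"
  using assms
proof (induction as arbitrary: cs c rule: rev_induct)
  case (snoc a as)
  obtain ds d where cs: "cs = ds @ [d]" "length ds = length as"
    using snoc.prems(3) by (cases cs rule: rev_cases) auto
  have aA: "a \<in> A" "set as \<subseteq> A" "a \<in> carrier G" "set as \<subseteq> carrier G" using snoc.prems(2) Ac by auto
  have c: "lincomb G as ds \<in> carrier G" "a [^] d \<in> carrier G" using aA lincomb_closed by auto
  have e1: "lincomb G as ds \<otimes> a [^] d = \<one>"
    using snoc.prems(4) lincomb_append[of as ds "[a]" "[d]"] aA cs by simp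
  have sub: "subgroup (generate G (set as)) G" using generate_is_subgroup aA by simp
  have "lincomb G as ds \<in> generate G (set as)" using lincomb_generate aA by blast
  moreover have "inv (lincomb G as ds) = a [^] d"
    using e1 c by (metis inv_equality inv_inv)
  ultimately have ad': "a [^] d \<in> generate G (set as)" using subgroup.m_inv_closed[OF sub] by metis
  then have ad: "a [^] nat \<bar>d\<bar> \<in> generate G (set as)"
  proof (cases d rule: int_cases)
    case (nonneg k)
    then show ?thesis using ad' by (simp add: int_pow_int)
  next
    case (neg k)
    then have "inv (a [^] d) = a [^] Suc k"
      using aA(3) int_pow_neg_int[of a "Suc k"] nat_pow_closed[of a "Suc k"] by (simp del: nat_pow_Suc of_nat_Suc)
    then show ?thesis using subgroup.m_inv_closed[OF sub ad'] neg by (simp del: nat_pow_Suc of_nat_Suc)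
  qed
  have "d = 0"
  proof (rule ccontr)
    assume "d \<noteq> 0"
    then have "a [^] nat \<bar>d\<bar> \<notin> generate G (set as)"
      using snoc.prems(1)[unfolded multiplicatively_independent_def, rule_format, of "length as" "nat \<bar>d\<bar>"]
      by simp
    then show False using ad by blast
  qed
  then have "lincomb G as ds = \<one>" using e1 c by simp
  moreover have "multiplicatively_independent as"
    unfolding multiplicatively_independent_def
  proof (intro allI impI)
    fix j and k :: nat assume j: "j < length as" "k > 0"
    then have "(as @ [a]) ! j [^] k \<notin> generate G (set (take j (as @ [a])))"
      using snoc.prems(1) unfolding multiplicatively_independent_def by simp
    then show "as ! j [^] k \<notin> generate G (set (take j as))" using j by (simp add: nth_append)
  qed
  ultimately have "\<forall>e\<in>set ds. e = 0" using snoc.IH[of ds] aA cs by blast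
  then show ?case using \<open>d = 0\<close> snoc.prems(5) cs by auto
qed simp

lemma maximal_independent_spans:
  assumes as: "multiplicatively_independent as" "set as \<subseteq> A"
    and max: "\<And>bs. multiplicatively_independent bs \<Longrightarrow> set bs \<subseteq> A \<Longrightarrow> length bs \<le> length as"
    and a: "a \<in> A"
  shows "\<exists>m::nat. m > 0 \<and> a [^] m \<in> generate G (set as)"
proof (rule ccontr)
  assume H: "\<not> ?thesis"
  have "multiplicatively_independent (as @ [a])"
    unfolding multiplicatively_independent_def
  proof (intro allI impI)
    fix j and k :: nat assume j: "j < length (as @ [a])" "k > 0"
    show "(as @ [a]) ! j [^] k \<notin> generate G (set (take j (as @ [a])))"
    proof (cases "j < length as")
      case True
      then show ?thesis using as(1) j unfolding multiplicatively_independent_def by (simp add: nth_append)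
    next
      case False
      then have "j = length as" using j by simp
      moreover have "a [^] k \<notin> generate G (set as)" using H j(2) by blast
      ultimately show ?thesis by simp
    qed
  qed
  then show False using max[of "as @ [a]"] as(2) a by simp
qed

end

locale coordinates = abelian_subgroup +
  fixes as
  assumes tf: "torsion_free G" and as: "set as \<subseteq> A"
    and independent: "\<And>cs c. length cs = length as \<Longrightarrow> lincomb G as cs = \<one> \<Longrightarrow> c \<in> set cs \<Longrightarrow> c = 0"
    and spanning: "\<And>a. a \<in> A \<Longrightarrow> \<exists>m::nat. m > 0 \<and> a [^] m \<in> generate G (set as)"
begin

abbreviation "n \<equiv> length as"

lemma as_nth: "j < n \<Longrightarrow> as ! j \<in> A"
  using as by auto

text \<open>The coordinates of a tensor 1 in A tensor Q with respect to the basis given by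
  \<open>as\<close>: a suitable power of a is a combination with integer exponents, which are then
  divided by m.\<close>

definition is_coord :: "'a \<Rightarrow> rat vec \<Rightarrow> bool" where
  "is_coord a v \<longleftrightarrow> (\<exists>m cs. m > 0 \<and> length cs = n \<and> a [^] (m::nat) = lincomb G as cs \<and>
     v = vec n (\<lambda>i. of_int (cs ! i) / of_nat m))"

definition coord :: "'a \<Rightarrow> rat vec" where
  "coord a = (SOME v. is_coord a v)"

lemma is_coord_unique:
  assumes "a \<in> A" "is_coord a v" "is_coord a w"
  shows "v = w"
proof -
  obtain m cs where m: "m > 0" "length cs = n" "a [^] (m::nat) = lincomb G as cs"
    "v = vec n (\<lambda>i. of_int (cs ! i) / of_nat m)" using assms(2) unfolding is_coord_def by blast
  obtain k ds where k: "k > 0" "length ds = n" "a [^] (k::nat) = lincomb G as ds"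
    "w = vec n (\<lambda>i. of_int (ds ! i) / of_nat k)" using assms(3) unfolding is_coord_def by blast
  \<comment> \<open>Both representations are raised to the common power m k; dividing one by the
    other gives a relation with exponents k cs - m ds.\<close>
  let ?es = "map2 (+) (map ((*) (int k)) cs) (map ((*) (- int m)) ds)"
  have ac: "a \<in> carrier G" using assms Ac by blast
  have "lincomb G as ?es = lincomb G as cs [^] int k \<otimes> lincomb G as ds [^] (- int m)"
    using m k as by (simp add: lincomb_add lincomb_scale del: map_map)
  also have "\<dots> = a [^] (int m * int k) \<otimes> a [^] (int k * - int m)"
    unfolding m(3)[symmetric] k(3)[symmetric] int_pow_int[symmetric] using ac by (simp add: int_pow_pow)
  also have "\<dots> = a [^] (int m * int k + int k * - int m)" using int_pow_mult[OF ac] by metis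
  also have "\<dots> = \<one>" by (simp add: mult.commute)
  finally have one: "lincomb G as ?es = \<one>" .
  have "v $ i = w $ i" if i: "i < n" for i
  proof -
    have "?es ! i \<in> set ?es" using i m k by (intro nth_mem) simp
    then have "?es ! i = 0" using independent[OF _ one] m k by simp
    then have "int k * cs ! i = int m * ds ! i" using i m k by simp
    then have "of_int (int k * cs ! i) = (of_int (int m * ds ! i) :: rat)" by simp
    then show ?thesis using i m k by (simp add: field_simps)
  qed
  then show ?thesis using m k by (intro eq_vecI) auto
qed

lemma is_coord_coord: "a \<in> A \<Longrightarrow> is_coord a (coord a)"
proof -
  assume a: "a \<in> A"
  then obtain m where m: "m > 0" "a [^] (m::nat) \<in> generate G (set as)" using spanning by blast
  then obtain cs where "length cs = n" "a [^] m = lincomb G as cs" using generate_lincomb[OF as] by blast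
  then have "\<exists>v. is_coord a v" unfolding is_coord_def using m by blast
  then show ?thesis unfolding coord_def by (rule someI_ex)
qed

lemma coord_eqI: "a \<in> A \<Longrightarrow> is_coord a v \<Longrightarrow> coord a = v"
  using is_coord_unique is_coord_coord by blast

lemma coord_carrier [simp]: "a \<in> A \<Longrightarrow> coord a \<in> carrier_vec n"
  using is_coord_coord[of a] unfolding is_coord_def by (metis vec_carrier)

lemma coord_mult: 
  assumes "a \<in> A" "b \<in> A"
  shows "coord (a \<otimes> b) = coord a + coord b"
proof (rule coord_eqI)
  show "a \<otimes> b \<in> A" using A_mult assms by blast
  obtain m cs where m: "m > 0" "length cs = n" "a [^] (m::nat) = lincomb G as cs"
    "coord a = vec n (\<lambda>i. of_int (cs ! i) / of_nat m)" using is_coord_coord[OF assms(1)] unfolding is_coord_def by blast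
  obtain k ds where k: "k > 0" "length ds = n" "b [^] (k::nat) = lincomb G as ds"
    "coord b = vec n (\<lambda>i. of_int (ds ! i) / of_nat k)" using is_coord_coord[OF assms(2)] unfolding is_coord_def by blast
  let ?es = "map2 (+) (map ((*) (int k)) cs) (map ((*) (int m)) ds)"
  have c: "a \<in> carrier G" "b \<in> carrier G" using assms Ac by auto
  have "(a \<otimes> b) [^] (m * k) = a [^] (m * k) \<otimes> b [^] (k * m)"
    using pow_mult_distrib[OF A_comm[OF assms] c] by (simp add: mult.commute)
  also have "\<dots> = lincomb G as cs [^] int k \<otimes> lincomb G as ds [^] int m"
    unfolding m(3)[symmetric] k(3)[symmetric] int_pow_int using c by (simp add: nat_pow_pow)
  also have "\<dots> = lincomb G as ?es"
    using m k as by (simp add: lincomb_add lincomb_scale del: map_map)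
  finally have "(a \<otimes> b) [^] (m * k) = lincomb G as ?es" .
  moreover have "coord a + coord b = vec n (\<lambda>i. of_int (?es ! i) / of_nat (m * k))"
    using m k by (intro eq_vecI) (auto simp: field_simps)
  moreover have "m * k > 0" "length ?es = n" using m k by auto
  ultimately show "is_coord (a \<otimes> b) (coord a + coord b)" unfolding is_coord_def by blast
qed

lemma coord_one: "coord \<one> = 0\<^sub>v n"
proof -
  have "coord \<one> = coord \<one> + coord \<one>" using coord_mult[OF A_one A_one] by simp
  then show ?thesis by (rule vec_eq_zero_if_idem[OF coord_carrier[OF A_one]])
qed

text \<open>A is torsion-free and therefore embeds into A tensor Q: zero coordinates force x^m = 1
  for some positive m, hence x = 1.\<close>

lemma coord_inj:
  assumes "a \<in> A" "b \<in> A" "coord a = coord b"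
  shows "a = b"
proof -
  have z: "x = \<one>" if x: "x \<in> A" "coord x = 0\<^sub>v n" for x
  proof -
    obtain m cs where m: "m > 0" "length cs = n" "x [^] (m::nat) = lincomb G as cs"
      "coord x = vec n (\<lambda>i. of_int (cs ! i) / of_nat m)" using is_coord_coord[OF x(1)] unfolding is_coord_def by blast
    have "cs ! i = 0" if i: "i < n" for i
    proof -
      have "vec n (\<lambda>i. of_int (cs ! i) / of_nat m :: rat) $ i = 0\<^sub>v n $ i" using m(4) x(2) by simp
      then show ?thesis using i m(1) by simp
    qed
    then have "cs = replicate n 0" using m(2) by (intro nth_equalityI) auto
    then have "x [^] m = \<one>" using m(3) lincomb_zero[OF as] by simp
    then show ?thesis using torsion_free_pow_eq_one[OF tf] m(1) x(1) Ac by blast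
  qed
  have ib: "inv b \<in> A" using A_inv assms by blast
  have "coord (a \<otimes> inv b) = coord b + coord (inv b)" using coord_mult[OF assms(1) ib] assms(3) by simp
  also have "\<dots> = coord (b \<otimes> inv b)" using coord_mult[OF assms(2) ib] by simp
  also have "\<dots> = 0\<^sub>v n" using assms Ac coord_one by simp
  finally have "a \<otimes> inv b = \<one>" using z A_mult[OF assms(1) ib] by blast
  then show ?thesis using assms Ac by (metis inv_closed inv_equality inv_inv)
qed

lemma coord_basis: "j < n \<Longrightarrow> coord (as ! j) = unit_vec n j"
proof (rule coord_eqI)
  assume j: "j < n"
  then show aA: "as ! j \<in> A" using as by auto
  let ?e = "map (\<lambda>i. of_bool (i = j)) [0..<n] :: int list"
  have gen: "lincomb G bs (map (\<lambda>i. of_bool (i = j)) [0..<length bs]) = bs ! j"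
    if "j < length bs" "set bs \<subseteq> A" for bs and j :: nat
    using that
  proof (induction bs arbitrary: j)
    case (Cons b bs)
    have split: "map (\<lambda>i. of_bool (i = j)) [0..<length (b # bs)] =
      (of_bool (0 = j) :: int) # map (\<lambda>i. of_bool (Suc i = j)) [0..<length bs]"
      by (simp add: upt_conv_Cons map_Suc_upt[symmetric] del: upt_Suc)
    show ?case
    proof (cases j)
      case 0
      have "map (\<lambda>i. of_bool (Suc i = 0)) [0..<length bs] = replicate (length bs) (0::int)"
        by (intro nth_equalityI) auto
      then show ?thesis unfolding split using 0 Cons.prems Ac by (simp add: lincomb_zero)
    next
      case (Suc j')
      then have "bs ! j' \<in> A" using Cons.prems by auto
      then show ?thesis unfolding split using Suc Cons Ac by simp
    qed
  qed simp
  have "as ! j [^] (1::nat) = lincomb G as ?e" using gen[OF j as] aA Ac by simp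
  moreover have "(unit_vec n j :: rat vec) = vec n (\<lambda>i. of_int (?e ! i) / of_nat 1)"
  proof (rule eq_vecI)
    fix i assume "i < dim_vec (vec n (\<lambda>i. of_int (?e ! i) / of_nat 1 :: rat))"
    then have "i < n" by simp
    then show "(unit_vec n j :: rat vec) $ i = vec n (\<lambda>i. of_int (?e ! i) / of_nat 1) $ i"
      using j by (cases "i = j") simp_all
  qed simp
  moreover have "length ?e = n" "(0::nat) < 1" by simp_all
  ultimately show "is_coord (as ! j) (unit_vec n j)" unfolding is_coord_def by blast
qed

text \<open>A homomorphism from A to a rational vector space is determined by its values on
  \<open>as\<close>: these fix it on the generated subgroup, and division by m extends this to
  A.\<close>

lemma additive_ext:
  fixes \<psi> \<psi>' :: "'a \<Rightarrow> rat vec"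
  assumes \<psi>: "\<And>a. a \<in> A \<Longrightarrow> \<psi> a \<in> carrier_vec k" "\<And>a b. a \<in> A \<Longrightarrow> b \<in> A \<Longrightarrow> \<psi> (a \<otimes> b) = \<psi> a + \<psi> b"
    and \<psi>': "\<And>a. a \<in> A \<Longrightarrow> \<psi>' a \<in> carrier_vec k" "\<And>a b. a \<in> A \<Longrightarrow> b \<in> A \<Longrightarrow> \<psi>' (a \<otimes> b) = \<psi>' a + \<psi>' b"
    and eq: "\<And>b. b \<in> set as \<Longrightarrow> \<psi> b = \<psi>' b" and a: "a \<in> A"
  shows "\<psi> a = \<psi>' a"
proof -
  have at_one: "\<chi> \<one> = 0\<^sub>v k" if "\<And>a. a \<in> A \<Longrightarrow> \<chi> a \<in> carrier_vec k"
    "\<And>a b. a \<in> A \<Longrightarrow> b \<in> A \<Longrightarrow> \<chi> (a \<otimes> b) = \<chi> a + \<chi> b" for \<chi> :: "'a \<Rightarrow> rat vec"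
  proof -
    have "\<chi> \<one> = \<chi> \<one> + \<chi> \<one>" using that(2)[OF A_one A_one] by simp
    then show ?thesis by (rule vec_eq_zero_if_idem[OF that(1)[OF A_one]])
  qed
  have pow: "\<chi> (a [^] m) = of_nat m \<cdot>\<^sub>v \<chi> a" if "\<And>a. a \<in> A \<Longrightarrow> \<chi> a \<in> carrier_vec k"
    "\<And>a b. a \<in> A \<Longrightarrow> b \<in> A \<Longrightarrow> \<chi> (a \<otimes> b) = \<chi> a + \<chi> b" "a \<in> A" for \<chi> :: "'a \<Rightarrow> rat vec" and m :: nat and a
  proof (induction m)
    case 0
    then show ?case using at_one[OF that(1,2)] that(1)[OF that(3)] by (intro eq_vecI) auto
  next
    case (Suc m)
    have "\<chi> a \<in> carrier_vec k" using that by blast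
    then show ?case using Suc that(2)[OF A_pow[OF that(3)] that(3)]
      by (intro eq_vecI) (auto simp: algebra_simps)
  qed
  have gen: "x \<in> A \<and> \<psi> x = \<psi>' x" if "x \<in> generate G (set as)" for x
    using that
  proof (induction rule: generate.induct)
    case one
    have "\<psi> \<one> = 0\<^sub>v k" by (rule at_one[OF \<psi>])
    moreover have "\<psi>' \<one> = 0\<^sub>v k" by (rule at_one[OF \<psi>'])
    ultimately show ?case using A_one by simp
  next
    case (incl h)
    then show ?case using eq as by auto
  next
    case (inv h)
    then have h: "h \<in> A" "inv h \<in> A" "\<psi> h = \<psi>' h" using as A_inv eq by auto
    have "\<psi> h + \<psi> (inv h) = \<psi>' h + \<psi>' (inv h)"
      using \<psi>(2)[OF h(1,2)] \<psi>'(2)[OF h(1,2)] h(1) Ac at_one[OF \<psi>] at_one[OF \<psi>'] by simp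
    then have "(\<psi> h + \<psi> (inv h)) $ i = (\<psi>' h + \<psi>' (inv h)) $ i" for i by simp
    then have "\<psi> (inv h) $ i = \<psi>' (inv h) $ i" if "i < k" for i
      using h \<psi>(1)[OF h(1)] \<psi>(1)[OF h(2)] \<psi>'(1)[OF h(1)] \<psi>'(1)[OF h(2)] that by (metis add_left_cancel carrier_vecD index_add_vec(1))
    then show ?case using h \<psi>(1)[OF h(2)] \<psi>'(1)[OF h(2)] by (auto intro: eq_vecI)
  next
    case (eng x y)
    then show ?case using \<psi>(2) \<psi>'(2) A_mult by simp
  qed
  obtain m where m: "m > 0" "a [^] (m::nat) \<in> generate G (set as)" using spanning a by blast
  have "of_nat m \<cdot>\<^sub>v \<psi> a = of_nat m \<cdot>\<^sub>v \<psi>' a"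
    using gen[OF m(2)] pow[OF \<psi> a, of m] pow[OF \<psi>' a, of m] by simp
  then have "(of_nat m \<cdot>\<^sub>v \<psi> a) $ i = (of_nat m \<cdot>\<^sub>v \<psi>' a) $ i" for i by simp
  then have "\<psi> a $ i = \<psi>' a $ i" if "i < k" for i
    using \<psi>(1)[OF a] \<psi>'(1)[OF a] m(1) that by (metis carrier_vecD index_smult_vec(1) mult_cancel_left of_nat_eq_0_iff not_gr_zero)
  then show ?thesis using \<psi>(1)[OF a] \<psi>'(1)[OF a] by (auto intro: eq_vecI)
qed

end

locale conjugation_coordinates = coordinates +
  assumes normal: "\<And>h a. h \<in> carrier G \<Longrightarrow> a \<in> A \<Longrightarrow> h \<otimes> a \<otimes> inv h \<in> A"
begin

definition conj_mat :: "'a \<Rightarrow> rat mat" where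
  "conj_mat h = mat n n (\<lambda>(i, j). coord (h \<otimes> as ! j \<otimes> inv h) $ i)"

lemma conj_mat_carrier [simp]: "conj_mat h \<in> carrier_mat n n"
  by (simp add: conj_mat_def)

lemma conj_mat_col: "h \<in> carrier G \<Longrightarrow> j < n \<Longrightarrow> col (conj_mat h) j = coord (h \<otimes> as ! j \<otimes> inv h)"
  using carrier_vecD[OF coord_carrier[OF normal[OF _ as_nth]]]
  by (intro eq_vecI) (auto simp: conj_mat_def)

text \<open>Both sides are additive in a and agree on the basis by the choice of the
  columns.\<close>

lemma conj_mat_coord:
  assumes h: "h \<in> carrier G" and a: "a \<in> A"
  shows "conj_mat h *\<^sub>v coord a = coord (h \<otimes> a \<otimes> inv h)"
proof (rule additive_ext[where k = n and \<psi> = "\<lambda>a. conj_mat h *\<^sub>v coord a" and \<psi>' = "\<lambda>a. coord (h \<otimes> a \<otimes> inv h)"])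
  fix a b assume ab: "a \<in> A" "b \<in> A"
  show "conj_mat h *\<^sub>v coord (a \<otimes> b) = conj_mat h *\<^sub>v coord a + conj_mat h *\<^sub>v coord b"
    using ab coord_mult by (simp add: mult_add_distrib_mat_vec[of _ n n])
  show "coord (h \<otimes> (a \<otimes> b) \<otimes> inv h) = coord (h \<otimes> a \<otimes> inv h) + coord (h \<otimes> b \<otimes> inv h)"
    using ab conj_mult[OF h] Ac coord_mult normal h by simp
next
  fix b assume "b \<in> set as"
  then obtain j where j: "j < n" "b = as ! j" by (metis in_set_conv_nth)
  have "conj_mat h *\<^sub>v unit_vec n j = col (conj_mat h) j"
    using j by (intro eq_vecI) (auto simp: conj_mat_def)
  then show "conj_mat h *\<^sub>v coord b = coord (h \<otimes> b \<otimes> inv h)"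
    using j conj_mat_col[OF h] coord_basis by simp
qed (use a h normal in \<open>auto intro!: mult_mat_vec_carrier[of _ n n]\<close>)

lemma conj_mat_mult:
  assumes g: "g \<in> carrier G" and h: "h \<in> carrier G"
  shows "conj_mat (g \<otimes> h) = conj_mat g * conj_mat h"
proof (rule mat_col_eqI)
  fix j assume "j < dim_col (conj_mat g * conj_mat h)"
  then have j: "j < n" by (simp add: conj_mat_def)
  have aj: "as ! j \<in> A" using j as by auto
  have "col (conj_mat g * conj_mat h) j = conj_mat g *\<^sub>v col (conj_mat h) j"
    using j by (intro col_mult2[of _ n n _ n]) auto
  also have "\<dots> = coord (g \<otimes> (h \<otimes> as ! j \<otimes> inv h) \<otimes> inv g)"
    using conj_mat_col[OF h j] conj_mat_coord[OF g normal[OF h aj]] by simp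
  also have "g \<otimes> (h \<otimes> as ! j \<otimes> inv h) \<otimes> inv g = (g \<otimes> h) \<otimes> as ! j \<otimes> inv (g \<otimes> h)"
    using g h Ac[OF aj] by (simp add: inv_mult_group m_assoc)
  finally show "col (conj_mat (g \<otimes> h)) j = col (conj_mat g * conj_mat h) j"
    using conj_mat_col[OF m_closed[OF g h] j] by simp
qed (auto simp: conj_mat_def)

lemma conj_mat_eq_one_iff:
  assumes h: "h \<in> carrier G"
  shows "conj_mat h = 1\<^sub>m n \<longleftrightarrow> (\<forall>a\<in>A. h \<otimes> a = a \<otimes> h)"
proof
  assume 1: "conj_mat h = 1\<^sub>m n"
  show "\<forall>a\<in>A. h \<otimes> a = a \<otimes> h"
  proof
    fix a assume a: "a \<in> A"
    have "coord (h \<otimes> a \<otimes> inv h) = coord a" using conj_mat_coord[OF h a] 1 a by simp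
    then have "h \<otimes> a \<otimes> inv h = a" using coord_inj normal[OF h a] a by blast
    then show "h \<otimes> a = a \<otimes> h" using commutator_cancel(2)[OF h Ac[OF a]] by simp
  qed
next
  assume C: "\<forall>a\<in>A. h \<otimes> a = a \<otimes> h"
  show "conj_mat h = 1\<^sub>m n"
  proof (rule mat_col_eqI)
    fix j assume "j < dim_col (1\<^sub>m n :: rat mat)"
    then have j: "j < n" by simp
    have aj: "as ! j \<in> A" using j as by auto
    then have "h \<otimes> as ! j \<otimes> inv h = as ! j" using C h Ac by (simp add: m_assoc)
    then show "col (conj_mat h) j = col (1\<^sub>m n) j" using conj_mat_col[OF h j] coord_basis[OF j] j by simp
  qed (auto simp: conj_mat_def)
qed

lemma conj_matrix_conj_mat:
  assumes "h \<in> carrier G"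
  shows "conj_matrix G as h (conj_mat h)"
  unfolding conj_matrix_def
proof (intro conjI allI impI conj_mat_carrier)
  fix j assume j: "j < n"
  have aj: "h \<otimes> as ! j \<otimes> inv h \<in> A" using normal[OF assms as_nth[OF j]] .
  obtain m cs where "m > 0" "length cs = n" "(h \<otimes> as ! j \<otimes> inv h) [^] (m::nat) = lincomb G as cs"
    "coord (h \<otimes> as ! j \<otimes> inv h) = vec n (\<lambda>i. of_int (cs ! i) / of_nat m)"
    using is_coord_coord[OF aj] unfolding is_coord_def by blast
  then show "\<exists>m::nat. m > 0 \<and> (\<exists>cs. length cs = n \<and> (h \<otimes> as ! j \<otimes> inv h) [^] m = lincomb G as cs \<and>
        (\<forall>i<n. conj_mat h $$ (i, j) = of_int (cs ! i) / of_nat m))"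
    using j by (intro exI[of _ m] conjI exI[of _ cs]) (auto simp: conj_mat_def)
qed

text \<open>\<open>conj_matrix\<close> lets the denominator and the exponents be chosen anew for
  each column; uniqueness of coordinates makes the matrix independent of the choice. The
  effectiveness of the action rests on this, as it starts from an arbitrary presentation of the
  identity matrix.\<close>

lemma conj_matrix_unique:
  assumes h: "h \<in> carrier G" and M: "conj_matrix G as h M"
  shows "M = conj_mat h"
proof (rule mat_col_eqI)
  fix j assume "j < dim_col (conj_mat h)"
  then have j: "j < n" by (simp add: conj_mat_def)
  have aj: "h \<otimes> as ! j \<otimes> inv h \<in> A" using normal[OF h as_nth[OF j]] .
  have Mc: "M \<in> carrier_mat n n" using M by (simp add: conj_matrix_def)
  obtain m cs where m: "m > 0" "length cs = n" "(h \<otimes> as ! j \<otimes> inv h) [^] (m::nat) = lincomb G as cs"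
    "\<And>i. i < n \<Longrightarrow> M $$ (i, j) = of_int (cs ! i) / of_nat m" using M j unfolding conj_matrix_def by blast
  have "coord (h \<otimes> as ! j \<otimes> inv h) = vec n (\<lambda>i. of_int (cs ! i) / of_nat m)"
    by (rule coord_eqI[OF aj]) (use m in \<open>auto simp: is_coord_def\<close>)
  also have "\<dots> = col M j" using Mc m(4) j by (intro eq_vecI) auto
  finally show "col M j = col (conj_mat h) j" using conj_mat_col[OF h j] by simp
qed (use M in \<open>auto simp: conj_matrix_def conj_mat_def\<close>)

end

section \<open>The structure theorem\<close>

text \<open>All roots of the characteristic polynomial are 1, so its factored form is a power of M -
  1.\<close>

lemma unipotent_imp_nilpotent:
  assumes M: "M \<in> carrier_mat n n" and u: "unipotent M"
  shows "\<exists>r. \<forall>v\<in>carrier_vec n. ((\<lambda>v. M *\<^sub>v v - v) ^^ r) v = 0\<^sub>v n"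
proof -
  obtain es where es: "char_poly M = (\<Prod>e\<leftarrow>es. [:- e, 1:])" using char_poly_factorized[OF M] by blast
  have ones: "\<forall>e\<in>set es. e = 1"
  proof
    fix e assume "e \<in> set es"
    then have "poly (char_poly M) e = 0" unfolding es by (induction es) auto
    then show "e = 1" using u eigenvalue_root_char_poly[OF M] unfolding unipotent_def by blast
  qed
  have "foldr (shift_vec M) es v = ((\<lambda>v. M *\<^sub>v v - v) ^^ length es) v" if "v \<in> carrier_vec n" for v
    using ones
  proof (induction es)
    case (Cons e es)
    then show ?case by (simp add: shift_vec_def)
  qed simp
  then show ?thesis using foldr_shift_char_poly[OF M es] by (intro exI[of _ "length es"]) simp
qed

context conjugation_coordinates
begin

definition act_mat :: "'a \<Rightarrow> complex mat" where
  "act_mat h = map_mat of_rat (conj_mat h)"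

lemma act_mat_carrier [simp]: "act_mat h \<in> carrier_mat n n"
  by (simp add: act_mat_def)

lemma act_mat_mult: "g \<in> carrier G \<Longrightarrow> h \<in> carrier G \<Longrightarrow> act_mat (g \<otimes> h) = act_mat g * act_mat h"
  unfolding act_mat_def by (simp add: conj_mat_mult of_rat_hom.mat_hom_mult[of _ n n _ n])

lemma act_mat_eq_one_iff:
  assumes h: "h \<in> carrier G"
  shows "act_mat h = 1\<^sub>m n \<longleftrightarrow> (\<forall>a\<in>A. h \<otimes> a = a \<otimes> h)"
proof -
  have "act_mat h = 1\<^sub>m n \<longleftrightarrow> conj_mat h = 1\<^sub>m n"
  proof
    assume "act_mat h = 1\<^sub>m n"
    have "of_rat (conj_mat h $$ (i, j)) = (of_rat (1\<^sub>m n $$ (i, j)) :: complex)" if "i < n" "j < n" for i j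
    proof -
      have "of_rat (conj_mat h $$ (i, j)) = act_mat h $$ (i, j)"
        using that carrier_matD[OF conj_mat_carrier] by (simp add: act_mat_def)
      then show ?thesis using \<open>act_mat h = 1\<^sub>m n\<close> that by simp
    qed
    then have "conj_mat h $$ (i, j) = 1\<^sub>m n $$ (i, j)" if "i < n" "j < n" for i j
      using that of_rat_eq_iff by blast
    then show "conj_mat h = 1\<^sub>m n" using carrier_matD[OF conj_mat_carrier, of h] by (intro eq_matI) auto
  next
    assume "conj_mat h = 1\<^sub>m n"
    then show "act_mat h = 1\<^sub>m n" by (simp add: act_mat_def of_rat_hom.mat_hom_one)
  qed
  then show ?thesis using conj_mat_eq_one_iff[OF h] by simp
qed

section \<open>Unipotent elements and the length function\<close>

context
  fixes l
  assumes l: "length_function G l" "purely_positive G l"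
begin

text \<open>Put D a = [h, a]. If D (D c) = 1, then D c commutes with h, and it commutes with c
  because both lie in A; so D c = 1 by \<open>central_commutator_eq_one\<close>. Thus the exponent r
  drops to 1, where D a = 1 is the claim.\<close>

lemma unipotent_conj_trivial:
  assumes h: "h \<in> carrier G" and "\<And>a. a \<in> A \<Longrightarrow> ((\<lambda>a. h \<otimes> a \<otimes> inv h \<otimes> inv a) ^^ r) a = \<one>" and "a \<in> A"
  shows "h \<otimes> a = a \<otimes> h"
  using assms(2,3)
proof (induction r arbitrary: a)
  case 0
  then have "a = \<one>" by simp
  then show ?case using h by simp
next
  case (Suc r)
  let ?D = "\<lambda>a. h \<otimes> a \<otimes> inv h \<otimes> inv a"
  have DA: "?D c \<in> A" if "c \<in> A" for c using normal[OF h that] A_inv[OF that] A_mult by blast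
  have powA: "(?D ^^ k) c \<in> A" if "c \<in> A" for c k by (induction k) (use that DA in auto)
  show ?case
  proof (cases r)
    case 0
    then have "?D a = \<one>" using Suc.prems by simp
    then show ?thesis using commutator_eq_one_iff[OF h Ac[OF Suc.prems(2)]] by simp
  next
    case (Suc r')
    have "(?D ^^ r) b = \<one>" if b: "b \<in> A" for b
    proof -
      let ?c = "(?D ^^ r') b"
      have c: "?c \<in> A" using powA[OF b] .
      have "?D (?D ?c) = \<one>" using Suc.prems(1)[OF b] Suc by simp
      then have "h \<otimes> ?D ?c = ?D ?c \<otimes> h" using commutator_eq_one_iff[OF h Ac[OF DA[OF c]]] by simp
      then have "?D ?c = \<one>"
        using central_commutator_eq_one[OF tf l h Ac[OF c] refl] A_comm[OF DA[OF c] c] by simp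
      then show ?thesis using Suc by simp
    qed
    then show ?thesis using Suc.IH Suc.prems(2) by blast
  qed
qed

text \<open>The coordinate map turns a -> [h, a] into M - 1, where M is the matrix of h. As
  coordinates separate the points of A, nilpotency of M - 1 makes an iterate of the commutator map
  trivial.\<close>

lemma unipotent_act_mat_trivial:
  assumes h: "h \<in> carrier G" and u: "\<And>v. v \<in> carrier_vec n \<Longrightarrow> ((\<lambda>v. act_mat h *\<^sub>v v - v) ^^ r) v = 0\<^sub>v n"
  shows "\<forall>a\<in>A. h \<otimes> a = a \<otimes> h"
proof
  fix a assume "a \<in> A"
  let ?D = "\<lambda>a. h \<otimes> a \<otimes> inv h \<otimes> inv a" and ?E = "\<lambda>v. act_mat h *\<^sub>v v - v"
  define \<phi> :: "'a \<Rightarrow> complex vec" where "\<phi> a = map_vec of_rat (coord a)" for a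
  have DA: "?D c \<in> A" if "c \<in> A" for c using normal[OF h that] A_inv[OF that] A_mult by blast
  have step: "?E (\<phi> c) = \<phi> (?D c)" if c: "c \<in> A" for c
  proof -
    have "?D c \<otimes> c = h \<otimes> c \<otimes> inv h" using commutator_cancel(1)[OF h Ac[OF c]] .
    then have "conj_mat h *\<^sub>v coord c = coord (?D c) + coord c"
      using conj_mat_coord[OF h c] coord_mult[OF DA[OF c] c] by simp
    then have "map_vec of_rat (conj_mat h *\<^sub>v coord c) = (map_vec of_rat (coord (?D c) + coord c) :: complex vec)"
      by simp
    moreover have "map_vec of_rat (conj_mat h *\<^sub>v coord c) = act_mat h *\<^sub>v \<phi> c"
      unfolding act_mat_def \<phi>_def using c by (intro of_rat_hom.mult_mat_vec_hom[of _ n n]) auto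
    moreover have "map_vec of_rat (coord (?D c) + coord c) = \<phi> (?D c) + \<phi> c"
      using coord_carrier[OF c] coord_carrier[OF DA[OF c]] by (intro eq_vecI) (auto simp: \<phi>_def of_rat_add)
    ultimately have "act_mat h *\<^sub>v \<phi> c = \<phi> (?D c) + \<phi> c" by simp
    moreover have "\<phi> (?D c) \<in> carrier_vec n" "\<phi> c \<in> carrier_vec n"
      using coord_carrier[OF c] coord_carrier[OF DA[OF c]] by (auto simp: \<phi>_def)
    ultimately show ?thesis by (auto intro: eq_vecI)
  qed
  have pow: "(?D ^^ k) c \<in> A \<and> (?E ^^ k) (\<phi> c) = \<phi> ((?D ^^ k) c)" if "c \<in> A" for c k
    by (induction k) (use that DA step in auto)
  have "(?D ^^ r) c = \<one>" if c: "c \<in> A" for c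
  proof (rule coord_inj)
    have "\<phi> c \<in> carrier_vec n" using coord_carrier[OF c] by (simp add: \<phi>_def)
    then have "\<phi> ((?D ^^ r) c) = 0\<^sub>v n" using u pow[OF c, of r] by simp
    then have "\<phi> ((?D ^^ r) c) $ i = 0" if "i < n" for i using that by simp
    then have "coord ((?D ^^ r) c) $ i = 0" if "i < n" for i
      using that carrier_vecD[OF coord_carrier] pow[OF c, of r] by (simp add: \<phi>_def)
    then show "coord ((?D ^^ r) c) = coord \<one>"
      unfolding coord_one using carrier_vecD[OF coord_carrier] pow[OF c, of r] by (intro eq_vecI) auto
  qed (use pow[OF c] A_one in auto)
  then show "h \<otimes> a = a \<otimes> h" using unipotent_conj_trivial[OF h _ \<open>a \<in> A\<close>] by blast
qed

text \<open>G/A is realized as the matrix group \<open>C\<close>: the kernel of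
  \<open>act_mat\<close> is A because A is its own centralizer. An abelian subgroup of finite index
  in \<open>C\<close> is pulled back; commutators of the preimage are killed by
  \<open>act_mat\<close> and so lie in A.\<close>

lemma virtually_abelian_over_self_centralizing:
  assumes sol: "solvable G" and self: "\<And>h. h \<in> carrier G \<Longrightarrow> (\<forall>a\<in>A. h \<otimes> a = a \<otimes> h) \<Longrightarrow> h \<in> A"
  shows "\<exists>K. subgroup K G \<and> finite_index_in K (carrier G) \<and> A \<subseteq> K \<and>
    (\<forall>x\<in>K. \<forall>y\<in>K. x \<otimes> y \<otimes> inv x \<otimes> inv y \<in> A)"
proof -
  define C where "C = act_mat ` carrier G"
  define L where "L = matrix_monoid n C"
  have L: "carrier L = C" "\<And>x y. x \<otimes>\<^bsub>L\<^esub> y = x * y" "\<one>\<^bsub>L\<^esub> = 1\<^sub>m n" by (auto simp: L_def matrix_monoid_def)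
  have Cc: "C \<subseteq> carrier_mat n n" by (auto simp: C_def)
  have act_one: "act_mat \<one> = 1\<^sub>m n" using act_mat_eq_one_iff[of \<one>] Ac by simp
  have grp: "group L"
  proof (rule groupI)
    show "\<one>\<^bsub>L\<^esub> \<in> carrier L" using act_one by (auto simp: L C_def intro!: image_eqI[of _ _ \<one>])
    fix x y assume "x \<in> carrier L" "y \<in> carrier L"
    then obtain g h where "g \<in> carrier G" "h \<in> carrier G" "x = act_mat g" "y = act_mat h" by (auto simp: L C_def)
    then show "x \<otimes>\<^bsub>L\<^esub> y \<in> carrier L"
      using act_mat_mult[of g h] imageI[of "g \<otimes> h" "carrier G" act_mat] by (simp add: L C_def)
  next
    fix x y z assume "x \<in> carrier L" "y \<in> carrier L" "z \<in> carrier L"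
    then have "x \<in> carrier_mat n n" "y \<in> carrier_mat n n" "z \<in> carrier_mat n n" using Cc L by auto
    then show "x \<otimes>\<^bsub>L\<^esub> y \<otimes>\<^bsub>L\<^esub> z = x \<otimes>\<^bsub>L\<^esub> (y \<otimes>\<^bsub>L\<^esub> z)" by (simp add: L assoc_mult_mat[of _ n n _ n _ n])
  next
    fix x assume "x \<in> carrier L"
    then have "x \<in> carrier_mat n n" using Cc L by auto
    then show "\<one>\<^bsub>L\<^esub> \<otimes>\<^bsub>L\<^esub> x = x" by (simp add: L)
  next
    fix x assume "x \<in> carrier L"
    then obtain g where g: "g \<in> carrier G" "x = act_mat g" by (auto simp: L C_def)
    have "act_mat (inv g) * act_mat g = 1\<^sub>m n" using act_mat_mult[of "inv g" g] g act_one by simp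
    then show "\<exists>y\<in>carrier L. y \<otimes>\<^bsub>L\<^esub> x = \<one>\<^bsub>L\<^esub>" using g by (auto simp: L C_def)
  qed
  interpret L: group L by (rule grp)
  have hom: "act_mat \<in> hom G L" using act_mat_mult by (auto simp: hom_def L C_def)
  interpret act: group_hom G L act_mat by unfold_locales (rule hom)
  have solL: "solvable L" by (rule act.surj_hom_imp_solvable) (auto simp: L C_def sol)
  have kernel: "act_mat g = 1\<^sub>m n \<longleftrightarrow> g \<in> A" if "g \<in> carrier G" for g
    using act_mat_eq_one_iff[OF that] self[OF that] A_comm by blast
  have "\<exists>K. subgroup K L \<and> L.finite_index_in K C \<and> (\<forall>x\<in>K. \<forall>y\<in>K. x * y = y * x)"
    unfolding L_def
  proof (rule solvable_linear_group_virtually_abelian[OF Cc])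
    fix g r assume g: "g \<in> C" and u: "\<And>v. v \<in> carrier_vec n \<Longrightarrow> ((\<lambda>v. g *\<^sub>v v - v) ^^ r) v = 0\<^sub>v n"
    obtain h where h: "h \<in> carrier G" "g = act_mat h" using g by (auto simp: C_def)
    then show "g = 1\<^sub>m n" using unipotent_act_mat_trivial[OF h(1), of r] u act_mat_eq_one_iff by simp
  qed (use grp solL in \<open>simp_all add: L_def\<close>)
  then obtain K where K: "subgroup K L" "L.finite_index_in K C" "\<And>x y. x \<in> K \<Longrightarrow> y \<in> K \<Longrightarrow> x * y = y * x" by blast
  define K' where "K' = {g \<in> carrier G. act_mat g \<in> K}"
  have act_inv: "act_mat (inv g) = inv\<^bsub>L\<^esub> act_mat g" if "g \<in> carrier G" for g using that by simp
  have K'sub: "subgroup K' G"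
  proof (rule subgroupI)
    show "K' \<subseteq> carrier G" by (auto simp: K'_def)
    have "\<one> \<in> K'" using subgroup.one_closed[OF K(1)] act_one by (simp add: K'_def L)
    then show "K' \<noteq> {}" by blast
  next
    fix a assume "a \<in> K'"
    then show "inv a \<in> K'" using subgroup.m_inv_closed[OF K(1)] by (simp add: K'_def)
  next
    fix a b assume "a \<in> K'" "b \<in> K'"
    then show "a \<otimes> b \<in> K'" using subgroup.m_closed[OF K(1)] by (simp add: K'_def)
  qed
  obtain F where F: "finite F" "F \<subseteq> C" "\<And>x. x \<in> C \<Longrightarrow> \<exists>f\<in>F. x \<otimes>\<^bsub>L\<^esub> inv\<^bsub>L\<^esub> f \<in> K"
    using K(2) unfolding L.finite_index_in_def by blast
  obtain F' where F': "F' \<subseteq> carrier G" "finite F'" "F = act_mat ` F'"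
    using finite_subset_image[OF F(1), of act_mat "carrier G"] F(2) by (auto simp: C_def)
  have "\<exists>f\<in>F'. g \<otimes> inv f \<in> K'" if g: "g \<in> carrier G" for g
  proof -
    obtain f where f: "f \<in> F'" "act_mat g \<otimes>\<^bsub>L\<^esub> inv\<^bsub>L\<^esub> act_mat f \<in> K" using F(3)[of "act_mat g"] g F'(3) by (auto simp: C_def)
    have "f \<in> carrier G" using f F' by blast
    then show ?thesis using f g by (intro bexI[of _ f]) (auto simp: K'_def)
  qed
  then have "finite_index_in K' (carrier G)" unfolding finite_index_in_def using F' by blast
  moreover have "A \<subseteq> K'"
  proof
    fix a assume "a \<in> A"
    then have "act_mat a = 1\<^sub>m n" "a \<in> carrier G" using kernel Ac by auto
    then show "a \<in> K'" using subgroup.one_closed[OF K(1)] by (simp add: K'_def L)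
  qed
  moreover have "x \<otimes> y \<otimes> inv x \<otimes> inv y \<in> A" if xy: "x \<in> K'" "y \<in> K'" for x y
  proof -
    have c: "x \<in> carrier G" "y \<in> carrier G" using xy by (auto simp: K'_def)
    have "act_mat x \<otimes>\<^bsub>L\<^esub> act_mat y = act_mat y \<otimes>\<^bsub>L\<^esub> act_mat x" using K(3) xy by (simp add: K'_def L)
    then have "act_mat x \<otimes>\<^bsub>L\<^esub> act_mat y \<otimes>\<^bsub>L\<^esub> inv\<^bsub>L\<^esub> act_mat x \<otimes>\<^bsub>L\<^esub> inv\<^bsub>L\<^esub> act_mat y = \<one>\<^bsub>L\<^esub>"
      using L.commutator_eq_one_iff[OF act.hom_closed[OF c(1)] act.hom_closed[OF c(2)]] by blast
    then have "act_mat (x \<otimes> y \<otimes> inv x \<otimes> inv y) = \<one>\<^bsub>L\<^esub>" using c by simp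
    then have "act_mat (x \<otimes> y \<otimes> inv x \<otimes> inv y) = 1\<^sub>m n" by (simp only: L)
    then show ?thesis using kernel[of "x \<otimes> y \<otimes> inv x \<otimes> inv y"] c by blast
  qed
  ultimately show ?thesis using K'sub by blast
qed

end

end

context group
begin

text \<open>The centralizer of S contains S and hence the generated group; so S centralizes that
  group, and the same argument once more makes the group abelian.\<close>

lemma generate_comm:
  assumes "S \<subseteq> carrier G" "\<And>x y. x \<in> S \<Longrightarrow> y \<in> S \<Longrightarrow> x \<otimes> y = y \<otimes> x"
    "x \<in> generate G S" "y \<in> generate G S"
  shows "x \<otimes> y = y \<otimes> x"
proof -
  have "S \<subseteq> commutant S" using assms by (auto simp: commutant_def)
  then have g: "generate G S \<subseteq> commutant S"
    using generate_subgroup_incl commutant_subgroup[OF assms(1)] by blast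
  have gc: "generate G S \<subseteq> carrier G" using generate_incl[OF assms(1)] .
  have "S \<subseteq> commutant (generate G S)" using g assms(1) by (fastforce simp: commutant_def)
  then have "generate G S \<subseteq> commutant (generate G S)"
    using generate_subgroup_incl commutant_subgroup[OF gc] by blast
  then show ?thesis using assms(3,4) by (auto simp: commutant_def)
qed

section \<open>Maximal abelian normal subgroups\<close>

definition abelian_normal :: "'a set \<Rightarrow> bool" where
  "abelian_normal A \<longleftrightarrow> subgroup A G \<and> (\<forall>h\<in>carrier G. \<forall>a\<in>A. h \<otimes> a \<otimes> inv h \<in> A) \<and>
     (\<forall>a\<in>A. \<forall>b\<in>A. a \<otimes> b = b \<otimes> a)"

text \<open>Zorn's lemma: any two elements of the union of a chain lie in one of its members, so the
  union is again an abelian subgroup.\<close>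

lemma maximal_abelian_normal:
  obtains A where "abelian_normal A" "\<And>B. abelian_normal B \<Longrightarrow> A \<subseteq> B \<Longrightarrow> B = A"
proof -
  have "\<exists>A\<in>Collect abelian_normal. \<forall>B\<in>Collect abelian_normal. A \<subseteq> B \<longrightarrow> B = A"
  proof (rule subset_Zorn_nonempty)
    have "abelian_normal {\<one>}" by (auto simp: abelian_normal_def triv_subgroup)
    then show "Collect abelian_normal \<noteq> {}" by blast
  next
    fix \<C> assume ne: "\<C> \<noteq> {}" and ch: "subset.chain (Collect abelian_normal) \<C>"
    have an: "\<And>A. A \<in> \<C> \<Longrightarrow> abelian_normal A" using ch by (auto simp: subset.chain_def)
    have sub: "\<And>A. A \<in> \<C> \<Longrightarrow> subgroup A G" using an by (simp add: abelian_normal_def)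
    have pair: "\<exists>B\<in>\<C>. a \<in> B \<and> b \<in> B" if "a \<in> \<Union>\<C>" "b \<in> \<Union>\<C>" for a b
      using that ch unfolding subset_chain_def by blast
    have "subgroup (\<Union>\<C>) G"
    proof (rule subgroupI)
      show "\<Union>\<C> \<subseteq> carrier G" by (rule Union_least) (rule subgroup.subset[OF sub])
      show "\<Union>\<C> \<noteq> {}" using ne subgroup.one_closed[OF sub] by blast
    next
      fix a assume "a \<in> \<Union>\<C>"
      then show "inv a \<in> \<Union>\<C>" using subgroup.m_inv_closed[OF sub] by blast
    next
      fix a b assume "a \<in> \<Union>\<C>" "b \<in> \<Union>\<C>"
      then obtain B where "B \<in> \<C>" "a \<in> B" "b \<in> B" using pair by blast
      then show "a \<otimes> b \<in> \<Union>\<C>" using subgroup.m_closed[OF sub[of B]] by blast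
    qed
    moreover have "\<forall>h\<in>carrier G. \<forall>a\<in>\<Union>\<C>. h \<otimes> a \<otimes> inv h \<in> \<Union>\<C>"
      using an unfolding abelian_normal_def by blast
    moreover have "a \<otimes> b = b \<otimes> a" if "a \<in> \<Union>\<C>" "b \<in> \<Union>\<C>" for a b
      using pair[OF that] an unfolding abelian_normal_def by blast
    ultimately show "\<Union>\<C> \<in> Collect abelian_normal" unfolding abelian_normal_def by blast
  qed
  then show thesis using that by blast
qed

text \<open>Otherwise a layer of the derived series inside the centralizer of \<open>A\<close> is nilpotent of class at
  most two, hence abelian by the length function, and together with \<open>A\<close> contradicts maximality.\<close>

lemma maximal_abelian_normal_self_centralizing:
  assumes tf: "torsion_free G" and sol: "solvable G" and l: "length_function G l" "purely_positive G l"
    and A: "abelian_normal A" and max: "\<And>B. abelian_normal B \<Longrightarrow> A \<subseteq> B \<Longrightarrow> B = A"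
  shows "commutant A \<subseteq> A"
proof (rule ccontr)
  assume not: "\<not> commutant A \<subseteq> A"
  have sA: "subgroup A G" and nA: "\<And>h a. h \<in> carrier G \<Longrightarrow> a \<in> A \<Longrightarrow> h \<otimes> a \<otimes> inv h \<in> A"
    and cA: "\<And>a b. a \<in> A \<Longrightarrow> b \<in> A \<Longrightarrow> a \<otimes> b = b \<otimes> a" using A by (auto simp: abelian_normal_def)
  have Ac: "A \<subseteq> carrier G" using subgroup.subset[OF sA] .
  have sC: "subgroup (commutant A) G" using commutant_subgroup[OF Ac] .
  have Cc: "commutant A \<subseteq> carrier G" using subgroup.subset[OF sC] .
  obtain k where k: "(derived G ^^ k) (carrier G) = {\<one>}" using sol solvable_iff_trivial_derived_seq by auto
  have nC: "h \<otimes> c \<otimes> inv h \<in> commutant A" if h: "h \<in> carrier G" and c: "c \<in> commutant A" for h c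
  proof -
    have cc: "c \<in> carrier G" using c Cc by blast
    have "(h \<otimes> c \<otimes> inv h) \<otimes> a = a \<otimes> (h \<otimes> c \<otimes> inv h)" if a: "a \<in> A" for a
    proof -
      have ac: "a \<in> carrier G" using a Ac by blast
      let ?b = "inv h \<otimes> a \<otimes> h"
      have b: "?b \<in> A" using nA[of "inv h" a] h a by simp
      have bc: "?b \<in> carrier G" using b Ac by blast
      have e: "a = h \<otimes> ?b \<otimes> inv h" using h ac by (simp add: m_assoc inv_mult_cancel)
      have "c \<otimes> ?b = ?b \<otimes> c" using c b by (simp add: commutant_def)
      then have "h \<otimes> (c \<otimes> ?b) \<otimes> inv h = h \<otimes> (?b \<otimes> c) \<otimes> inv h" by simp
      then show ?thesis unfolding conj_mult[OF h cc bc] conj_mult[OF h bc cc] e[symmetric] .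
    qed
    then show ?thesis using h cc by (simp add: commutant_def)
  qed
  have nsub: "\<not> carrier G \<inter> commutant A \<subseteq> A" using not Cc by blast
  obtain M where M: "subgroup M G" "M \<subseteq> carrier G \<inter> commutant A" "\<not> M \<subseteq> A"
    "\<And>x y. x \<in> M \<Longrightarrow> y \<in> M \<Longrightarrow> x \<otimes> y \<otimes> inv x \<otimes> inv y \<in> A"
    "\<And>h x. h \<in> carrier G \<Longrightarrow> (\<And>c. c \<in> commutant A \<Longrightarrow> h \<otimes> c \<otimes> inv h \<in> commutant A) \<Longrightarrow> x \<in> M \<Longrightarrow> h \<otimes> x \<otimes> inv h \<in> M"
    using solvable_layer[OF subgroup_self k sC subgroup.one_closed[OF sA] nsub] by metis
  have MA: "m \<otimes> a = a \<otimes> m" if "m \<in> M" "a \<in> A" for m a using M(2) that by (auto simp: commutant_def)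
  \<comment> \<open>Commutators of M lie in A, and M centralizes A, so each of them commutes with
    both of its entries.\<close>
  have Mab: "x \<otimes> y = y \<otimes> x" if xy: "x \<in> M" "y \<in> M" for x y
  proof -
    have c: "x \<in> carrier G" "y \<in> carrier G" using xy M(2) by auto
    have "x \<otimes> y \<otimes> inv x \<otimes> inv y = \<one>"
      using central_commutator_eq_one[OF tf l c refl MA[OF xy(1) M(4)[OF xy], symmetric]
          MA[OF xy(2) M(4)[OF xy], symmetric]] .
    then show ?thesis using commutator_eq_one_iff[OF c] by simp
  qed
  let ?S = "A \<union> M" let ?N = "generate G ?S"
  have Sc: "?S \<subseteq> carrier G" using Ac M(2) by blast
  have "abelian_normal ?N"
    unfolding abelian_normal_def
  proof (intro conjI ballI)
    show "subgroup ?N G" using generate_is_subgroup[OF Sc] .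
  next
    fix h a assume h: "h \<in> carrier G" and a: "a \<in> ?N"
    have "h \<otimes> s \<otimes> inv h \<in> ?S" if "s \<in> ?S" for s
      using that nA[OF h, of s] M(5)[OF h nC[OF h], of s] by blast
    then show "h \<otimes> a \<otimes> inv h \<in> ?N" using conj_generate[OF Sc h generate.incl a] by blast
  next
    fix a b assume "a \<in> ?N" "b \<in> ?N"
    then show "a \<otimes> b = b \<otimes> a"
      by (rule generate_comm[OF Sc, rotated 1]) (use cA MA Mab in \<open>auto simp: eq_commute\<close>)
  qed
  moreover have "?S \<subseteq> ?N" by (auto intro: generate.incl)
  ultimately have "?N = A" using max[of ?N] by blast
  then show False using M(3) \<open>?S \<subseteq> ?N\<close> by blast
qed

text \<open>The length N of a resolution bounds the length of independent lists in A, so a longest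
  list exists and gives a basis of A tensor Q.\<close>

theorem torsion_free_solvable_structure:
  assumes tf: "torsion_free G" and sol: "solvable G" and l: "length_function G l" "purely_positive G l"
    and cd: "finite_cd G TYPE('m::ab_group_add)"
  shows "\<exists>K A as. subgroup K G \<and> finite_index_in K (carrier G) \<and> abelian_normal A \<and> A \<subseteq> K \<and>
    (\<forall>x\<in>K. \<forall>y\<in>K. x \<otimes> y \<otimes> inv x \<otimes> inv y \<in> A) \<and> Q_basis G A as \<and>
    (\<forall>k\<in>K. conj_matrix G as k (1\<^sub>m (length as)) \<longrightarrow> k \<in> A) \<and>
    (\<forall>k\<in>K - A. \<exists>M. conj_matrix G as k M \<and> \<not> unipotent (map_mat of_rat M))"
proof -
  obtain A where abn: "abelian_normal A" and max: "\<And>B. abelian_normal B \<Longrightarrow> A \<subseteq> B \<Longrightarrow> B = A"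
    using maximal_abelian_normal by blast
  have self: "commutant A \<subseteq> A"
    by (rule maximal_abelian_normal_self_centralizing[OF tf sol l abn max])
  have nA: "\<And>h a. h \<in> carrier G \<Longrightarrow> a \<in> A \<Longrightarrow> h \<otimes> a \<otimes> inv h \<in> A"
    using abn by (simp add: abelian_normal_def)
  interpret abelian_subgroup G A
    by (intro abelian_subgroup.intro abelian_subgroup_axioms.intro is_group)
      (use abn in \<open>auto simp: abelian_normal_def\<close>)
  obtain N P act d eps where res: "proj_resolution G N (P :: nat \<Rightarrow> 'm set) act d eps"
    using cd unfolding finite_cd_def by blast
  have bound: "length bs \<le> N" if bs: "multiplicatively_independent bs" "set bs \<subseteq> A" for bs
  proof -
    \<comment> \<open>Beyond the list t is padded by the identity, whose operator is zero; the
      padding lies outside the range of indices for which independence is claimed.\<close>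
    define t where "t i = (if i < length bs then bs ! i else \<one>)" for i
    have tA: "t i \<in> A" for i using bs(2) A_one by (auto simp: t_def)
    have img: "t ` {..<j} = set (take j bs)" if "j < length bs" for j
      using that by (auto simp: t_def nth_image[symmetric] image_def) 
    show ?thesis
    proof (rule cd_bounds_rank[of t, OF _ _ res])
      fix j and k :: nat assume "j < length bs" "k > 0"
      then show "t j [^] k \<notin> generate G (t ` {..<j})"
        using bs(1) img unfolding multiplicatively_independent_def by (simp add: t_def)
    qed (use tA Ac A_comm in auto)
  qed
  have "\<exists>as. (multiplicatively_independent as \<and> set as \<subseteq> A) \<and>
    (\<forall>bs. multiplicatively_independent bs \<and> set bs \<subseteq> A \<longrightarrow> length bs \<le> length as)"
    by (rule ex_has_greatest_nat[of _ "[]" _ "Suc N"])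
      (use bound in \<open>auto simp: multiplicatively_independent_def le_imp_less_Suc\<close>)
  then obtain as where as: "multiplicatively_independent as" "set as \<subseteq> A"
    and asmax: "\<And>bs. multiplicatively_independent bs \<Longrightarrow> set bs \<subseteq> A \<Longrightarrow> length bs \<le> length as" by blast
  interpret conjugation_coordinates G A as
    by unfold_locales
      (use tf as independent_lincomb[OF as] maximal_independent_spans[OF as asmax] nA in auto)
  have central: "h \<in> A" if "h \<in> carrier G" "\<forall>a\<in>A. h \<otimes> a = a \<otimes> h" for h
    using self that by (auto simp: commutant_def)
  obtain K where K: "subgroup K G" "finite_index_in K (carrier G)" "A \<subseteq> K"
    "\<forall>x\<in>K. \<forall>y\<in>K. x \<otimes> y \<otimes> inv x \<otimes> inv y \<in> A"
    using virtually_abelian_over_self_centralizing[OF l sol central] by blast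
  have Kc: "k \<in> carrier G" if "k \<in> K" for k using subgroup.mem_carrier[OF K(1) that] .
  have basis: "Q_basis G A as"
    unfolding Q_basis_def
  proof (intro conjI allI impI ballI)
    fix cs c assume cs: "length cs = n \<and> \<not> infinite_order G (lincomb G as cs)" and c: "c \<in> set cs"
    then have "lincomb G as cs = \<one>" using tf lincomb_A[OF as] Ac unfolding torsion_free_def by blast
    then show "c = 0" using independent cs c by blast
  next
    fix a assume "a \<in> A"
    then show "\<exists>m::nat. m > 0 \<and> (\<exists>cs. length cs = n \<and> a [^] m = lincomb G as cs)"
      using spanning generate_lincomb[OF as] by blast
  qed (rule as)
  have faithful: "k \<in> A" if k: "k \<in> K" and one: "conj_matrix G as k (1\<^sub>m n)" for k
    using conj_matrix_unique[OF Kc[OF k] one] conj_mat_eq_one_iff[OF Kc[OF k]] central[OF Kc[OF k]] by simp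
  have not_unipotent: "\<exists>M. conj_matrix G as k M \<and> \<not> unipotent (map_mat of_rat M)" if k: "k \<in> K - A" for k
  proof -
    have kc: "k \<in> carrier G" using k Kc by blast
    have "\<not> unipotent (act_mat k)"
    proof
      assume "unipotent (act_mat k)"
      then obtain r where "\<forall>v\<in>carrier_vec n. ((\<lambda>v. act_mat k *\<^sub>v v - v) ^^ r) v = 0\<^sub>v n"
        using unipotent_imp_nilpotent[OF act_mat_carrier] by blast
      then have "\<forall>a\<in>A. k \<otimes> a = a \<otimes> k" using unipotent_act_mat_trivial[OF l kc] by blast
      then show False using central[OF kc] k by blast
    qed
    then show ?thesis using conj_matrix_conj_mat[OF kc] by (auto simp: act_mat_def)
  qed
  show ?thesis
  proof (intro exI conjI)
    show "\<forall>k\<in>K. conj_matrix G as k (1\<^sub>m n) \<longrightarrow> k \<in> A" using faithful by blast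
    show "\<forall>k\<in>K - A. \<exists>M. conj_matrix G as k M \<and> \<not> unipotent (map_mat of_rat M)"
      using not_unipotent by blast
  qed (rule K abn basis)+
qed

section \<open>From the torsion-free subgroup to the whole group\<close>

lemma finite_index_in_trans:
  assumes "H \<subseteq> carrier G" "finite_index_in K H" "K \<subseteq> carrier G" "finite_index_in H (carrier G)"
  shows "finite_index_in K (carrier G)"
proof -
  obtain F where F: "finite F" "F \<subseteq> H" "\<And>h. h \<in> H \<Longrightarrow> \<exists>f\<in>F. h \<otimes> inv f \<in> K"
    using assms(2) unfolding finite_index_in_def by blast
  obtain E where E: "finite E" "E \<subseteq> carrier G" "\<And>g. g \<in> carrier G \<Longrightarrow> \<exists>e\<in>E. g \<otimes> inv e \<in> H"
    using assms(4) unfolding finite_index_in_def by blast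
  have "\<exists>c\<in>(\<lambda>(f, e). f \<otimes> e) ` (F \<times> E). g \<otimes> inv c \<in> K" if g: "g \<in> carrier G" for g
  proof -
    obtain e where e: "e \<in> E" "g \<otimes> inv e \<in> H" using E(3) g by blast
    obtain f where f: "f \<in> F" "g \<otimes> inv e \<otimes> inv f \<in> K" using F(3) e by blast
    have "f \<in> carrier G" "e \<in> carrier G" using e f E F assms(1) by auto
    then have "g \<otimes> inv (f \<otimes> e) = g \<otimes> inv e \<otimes> inv f" using g by (simp add: inv_mult_group m_assoc)
    then show ?thesis using e f by force
  qed
  then show ?thesis unfolding finite_index_in_def
    using F(1,2) E(1,2) assms(1) by (intro exI[of _ "(\<lambda>(f, e). f \<otimes> e) ` (F \<times> E)"]) (auto simp: subset_iff)
qed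

lemma finite_rcosets_iff:
  assumes K: "subgroup K G"
  shows "finite (rcosets K) \<longleftrightarrow> finite_index_in K (carrier G)"
proof
  assume fin: "finite (rcosets K)"
  show "finite_index_in K (carrier G)"
  proof (rule finite_index_in_fibres[where \<kappa> = "\<lambda>g. K #> g"])
    have "(\<lambda>g. K #> g) ` carrier G = rcosets K" by (auto simp: RCOSETS_def)
    then show "finite ((\<lambda>g. K #> g) ` carrier G)" using fin by simp
  next
    fix g f assume gf: "g \<in> carrier G" "f \<in> carrier G" "K #> g = K #> f"
    then have "g \<in> K #> f" using rcos_self[OF gf(1) K] by simp
    then show "g \<otimes> inv f \<in> K" using subgroup.rcos_module[OF K is_group gf(2,1)] by simp
  qed
next
  assume "finite_index_in K (carrier G)"
  then obtain F where F: "finite F" "F \<subseteq> carrier G" "\<And>g. g \<in> carrier G \<Longrightarrow> \<exists>f\<in>F. g \<otimes> inv f \<in> K"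
    unfolding finite_index_in_def by blast
  have "rcosets K \<subseteq> (\<lambda>f. K #> f) ` F"
  proof
    fix U assume "U \<in> rcosets K"
    then obtain g where g: "g \<in> carrier G" "U = K #> g" by (auto simp: RCOSETS_def)
    obtain f where f: "f \<in> F" "g \<otimes> inv f \<in> K" using F(3) g by blast
    have fc: "f \<in> carrier G" using f F by blast
    then have "g \<in> K #> f" using subgroup.rcos_module[OF K is_group fc g(1)] f by simp
    then show "U \<in> (\<lambda>f. K #> f) ` F" using repr_independence[OF _ fc K] g f by auto
  qed
  then show "finite (rcosets K)" using F(1) finite_surj by blast
qed

lemma comm_factor_group:
  assumes A: "A \<lhd> G" and comm: "\<And>x y. x \<in> carrier G \<Longrightarrow> y \<in> carrier G \<Longrightarrow> x \<otimes> y \<otimes> inv x \<otimes> inv y \<in> A"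
  shows "comm_group (G Mod A)"
proof -
  interpret A: normal A G by (rule A)
  have sub: "subgroup A G" by (rule A.subgroup_axioms)
  show ?thesis
  proof (rule group.group_comm_groupI[OF A.factorgroup_is_group])
    fix U V assume "U \<in> carrier (G Mod A)" "V \<in> carrier (G Mod A)"
    then obtain x y where xy: "x \<in> carrier G" "y \<in> carrier G" "U = A #> x" "V = A #> y"
      by (auto simp: FactGroup_def RCOSETS_def)
    have "(x \<otimes> y) \<otimes> inv (y \<otimes> x) = x \<otimes> y \<otimes> inv x \<otimes> inv y"
      using xy by (simp add: inv_mult_group m_assoc)
    then have "x \<otimes> y \<in> A #> (y \<otimes> x)"
      using comm[OF xy(1,2)] A.rcos_module[OF is_group, of "y \<otimes> x" "x \<otimes> y"] xy by simp
    then have "A #> (y \<otimes> x) = A #> (x \<otimes> y)" using repr_independence[OF _ _ sub] xy by simp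
    then show "U \<otimes>\<^bsub>G Mod A\<^esub> V = V \<otimes>\<^bsub>G Mod A\<^esub> U" using xy by (simp add: A.rcos_sum)
  qed
qed

text \<open>The structure is found inside the torsion-free subgroup H. A is normal in H but possibly
  not in G, which is why normality is claimed in K. The other clauses speak of products, inverses
  and powers, on which H and G agree.\<close>

theorem finite_vcd_solvable_structure:
  assumes "solvable G" "length_function G l" "purely_positive G l"
    "finite_vcd G TYPE('m::ab_group_add)"
  shows "\<exists>K A as. subgroup K G \<and> finite (rcosets K) \<and> A \<lhd> G\<lparr>carrier := K\<rparr> \<and>
    comm_group (G\<lparr>carrier := A\<rparr>) \<and> comm_group ((G\<lparr>carrier := K\<rparr>) Mod A) \<and> Q_basis G A as \<and>
    (\<forall>k\<in>K. conj_matrix G as k (1\<^sub>m (length as)) \<longrightarrow> k \<in> A) \<and>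
    (\<forall>k\<in>K - A. \<exists>M. conj_matrix G as k M \<and> \<not> unipotent (map_mat of_rat M))"
proof -
  obtain H where H: "subgroup H G" "finite (rcosets H)" "torsion_free (G\<lparr>carrier := H\<rparr>)"
    "finite_cd (G\<lparr>carrier := H\<rparr>) TYPE('m)"
    using assms(4) unfolding finite_vcd_def by blast
  define GH where "GH = G\<lparr>carrier := H\<rparr>"
  have Hc: "H \<subseteq> carrier G" using subgroup.subset[OF H(1)] .
  interpret GH: group GH unfolding GH_def using subgroup.subgroup_is_group[OF H(1) is_group] .
  have GH [simp]: "carrier GH = H" "\<one>\<^bsub>GH\<^esub> = \<one>" "x \<otimes>\<^bsub>GH\<^esub> y = x \<otimes> y" for x y by (auto simp: GH_def)
  \<comment> \<open>Inverses, and with them integer powers, are defined through the carrier, so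
    their agreement with those of G has to be proved.\<close>
  have inv_GH [simp]: "inv\<^bsub>GH\<^esub> x = inv x" if "x \<in> H" for x
    using m_inv_consistent[OF H(1) that] by (simp add: GH_def)
  have pow_GH: "x [^]\<^bsub>GH\<^esub> (k::nat) = x [^] k" for x k unfolding GH_def nat_pow_consistent[symmetric] ..
  have int_pow_GH: "x [^]\<^bsub>GH\<^esub> (k::int) = x [^] k" if "x \<in> H" for x k
    unfolding GH_def int_pow_consistent[OF H(1) that, symmetric] ..
  have inf_GH: "infinite_order GH x \<longleftrightarrow> infinite_order G x" for x
    by (simp add: infinite_order_def pow_GH)
  have lincomb_GH: "lincomb GH as cs = lincomb G as cs" if "set as \<subseteq> H" for as cs
    using that
  proof (induction as arbitrary: cs)
    case (Cons a as)
    then show ?case by (cases cs) (auto simp: int_pow_GH lincomb_def)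
  qed simp
  have solGH: "solvable GH"
  proof -
    have "id \<in> hom GH G" using Hc by (auto simp: hom_def)
    then have "group_hom GH G id" using GH.is_group is_group by (simp add: group_hom_def group_hom_axioms_def)
    then show ?thesis using group_hom.inj_hom_imp_solvable assms(1) by (metis inj_on_id)
  qed
  have lGH: "length_function GH l" "purely_positive GH l"
    using assms(2,3) Hc unfolding length_function_def purely_positive_def
    by (auto simp: int_pow_GH inf_GH subset_iff)
  obtain K A as where KA: "subgroup K GH" "GH.finite_index_in K H" "GH.abelian_normal A" "A \<subseteq> K"
    and commK: "\<And>x y. x \<in> K \<Longrightarrow> y \<in> K \<Longrightarrow> x \<otimes> y \<otimes> inv\<^bsub>GH\<^esub> x \<otimes> inv\<^bsub>GH\<^esub> y \<in> A"
    and as: "Q_basis GH A as" "\<And>k. k \<in> K \<Longrightarrow> conj_matrix GH as k (1\<^sub>m (length as)) \<Longrightarrow> k \<in> A"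
      "\<And>k. k \<in> K - A \<Longrightarrow> \<exists>M. conj_matrix GH as k M \<and> \<not> unipotent (map_mat of_rat M)"
    using GH.torsion_free_solvable_structure[OF _ solGH lGH, where 'm = 'm] H(3,4)
    unfolding GH_def[symmetric] GH by blast
  have KH: "K \<subseteq> H" using subgroup.subset[OF KA(1)] by simp
  have AH: "A \<subseteq> H" using KA(4) KH by blast
  have K: "subgroup K G" using incl_subgroup[OF H(1)] KA(1) by (simp add: GH_def)
  have A_GH: "subgroup A GH" using KA(3) by (simp add: GH.abelian_normal_def)
  then have A: "subgroup A G" using incl_subgroup[OF H(1)] by (simp add: GH_def)
  have asH: "set as \<subseteq> H" using as(1) AH by (auto simp: Q_basis_def)
  have "finite_index_in K H"
    using KA(2) unfolding GH.finite_index_in_def finite_index_in_def by (metis GH(3) inv_GH subsetD)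
  then have "finite_index_in K (carrier G)"
    using finite_index_in_trans[OF Hc] finite_rcosets_iff[OF H(1)] H(2) KH Hc by blast
  then have finK: "finite (rcosets K)" using finite_rcosets_iff[OF K] by simp
  let ?GK = "G\<lparr>carrier := K\<rparr>"
  interpret GK: group ?GK using subgroup.subgroup_is_group[OF K is_group] .
  have inv_GK: "inv\<^bsub>?GK\<^esub> x = inv x" if "x \<in> K" for x using m_inv_consistent[OF K that] .
  have "subgroup A ?GK" using subgroup_incl[OF A K KA(4)] .
  moreover have "x \<otimes> a \<otimes> inv x \<in> A" if "x \<in> K" "a \<in> A" for x a
    using KA(3) that KH unfolding GH.abelian_normal_def by auto
  ultimately have normal: "A \<lhd> ?GK" unfolding GK.normal_inv_iff by (simp add: inv_GK)
  have "comm_group (G\<lparr>carrier := A\<rparr>)"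
    by (rule group.group_comm_groupI[OF subgroup.subgroup_is_group[OF A is_group]])
      (use KA(3) in \<open>auto simp: GH.abelian_normal_def\<close>)
  moreover have "comm_group (?GK Mod A)"
    by (rule GK.comm_factor_group[OF normal]) (use commK KH in \<open>auto simp: inv_GK subset_iff\<close>)
  moreover have "Q_basis G A as"
    using as(1) asH unfolding Q_basis_def by (simp add: lincomb_GH inf_GH pow_GH)
  moreover have conj_GH: "conj_matrix GH as k M \<longleftrightarrow> conj_matrix G as k M" if "k \<in> K" for k M
    using that KH asH unfolding conj_matrix_def by (auto simp: lincomb_GH pow_GH)
  moreover have "\<forall>k\<in>K. conj_matrix G as k (1\<^sub>m (length as)) \<longrightarrow> k \<in> A" using as(2) conj_GH by blast
  moreover have "\<forall>k\<in>K - A. \<exists>M. conj_matrix G as k M \<and> \<not> unipotent (map_mat of_rat M)"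
    using as(3) conj_GH by blast
  ultimately show ?thesis using K finK normal by blast
qed

end

theorem theorem17:
  fixes G :: "('g, 'b) monoid_scheme" and l :: "'g \<Rightarrow> real"
  assumes "group G" and "solvable G"
    and "length_function G l" and "purely_positive G l"
    and "finite_vcd G TYPE('m::ab_group_add)"
  shows "\<exists>K. subgroup K G \<and> finite (rcosets\<^bsub>G\<^esub> K) \<and>
           (comm_group (G\<lparr>carrier := K\<rparr>) \<or>
            (\<exists>A. A \<lhd> G\<lparr>carrier := K\<rparr> \<and> comm_group (G\<lparr>carrier := A\<rparr>) \<and>
                 comm_group ((G\<lparr>carrier := K\<rparr>) Mod A) \<and>
                 (\<exists>as. Q_basis G A as \<and>
                    (\<forall>k\<in>K. conj_matrix G as k (1\<^sub>m (length as)) \<longrightarrow> k \<in> A) \<and>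
                    (\<forall>k\<in>K - A. \<exists>M. conj_matrix G as k M \<and>
                                     \<not> unipotent (map_mat of_rat M)))))"
  \<comment> \<open>The second alternative is established in every case; it includes K = A with
    trivial quotient.\<close>
  using group.finite_vcd_solvable_structure[OF assms(1-5)] by blast

end
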